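(* There exists a randomized algorithm that, given a directed graph $G$ and a nonnegative integer $k$, decides whether $G$ has a spanning out-branching with at least $k$ internal vertices, running in time $O^*(2^k)$ and with negligible probability of reporting a false negative.
   Context: All graphs are directed, without loops and parallel arcs. A subgraph is spanning if it has the same vertex set as the graph. A directed graph is connected if its underlying undirected graph is connected. A connected directed graph is an out-branching if every vertex has in-degree $1$ except a single root vertex with in-degree $0$. A vertex of an out-branching is internal if it has out-degree at least $1$ in the out-branching; otherwise it is a leaf. The notation $O^*(\cdot)$ suppresses a multiplicative factor polynomial in the input size. An event parameterized by $n$ (the number of vertices) has negligible probability if its probability tends to zero as $n\to\infty$. *)

theory Defs
  imports
    "HOL-Probability.Probability"
    "HOL-Computational_Algebra.Polynomial"
    "HOL-Library.Log_Nat"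
    "Graph_Theory.Graph_Theory"
begin

section \<open>Out-branchings\<close>

text \<open>
  \<^const>\<open>Digraph_Component.connected\<close> is connectedness of the underlying undirected graph; it has to be
  qualified because of the topological notion of the same name.
\<close>

definition out_branching :: "('a, 'b) pre_digraph \<Rightarrow> bool" where
  "out_branching T \<longleftrightarrow>
     Digraph_Component.connected T \<and>
     (\<exists>r \<in> verts T. in_degree T r = 0 \<and> (\<forall>v \<in> verts T - {r}. in_degree T v = 1))"

definition internal_vertices :: "('a, 'b) pre_digraph \<Rightarrow> 'a set" where
  "internal_vertices T = {v \<in> verts T. out_degree T v \<ge> 1}"

definition has_internal_out_branching :: "('a, 'b) pre_digraph \<Rightarrow> nat \<Rightarrow> bool" where
  "has_internal_out_branching G k \<longleftrightarrow>
     (\<exists>T. spanning T G \<and> out_branching T \<and> card (internal_vertices T) \<ge> k)"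


section \<open>Randomized random-access machines with logarithmic cost\<close>

text \<open>
  A program is a fixed finite piece of syntax, used for inputs of every size. It works on registers
  $R_0, R_1, \ldots$, of which it can name only finitely many, and on an infinite memory
  $M_0, M_1, \ldots$ that is reached by indirect addressing. All cells hold natural numbers.
  Randomness is available only through \<open>Toss\<close>, one fair coin at a time.
\<close>

datatype binop = Add | Sub | Mul | Div | Mod | Band | Bxor

datatype prog =
    Imm nat nat             \<comment> \<open>\<open>Imm i c\<close>: $R_i := c$\<close>
  | Arith binop nat nat nat \<comment> \<open>\<open>Arith f i j l\<close>: $R_i := f(R_j, R_l)$\<close>
  | Load nat nat            \<comment> \<open>\<open>Load i j\<close>: $R_i := M_{R_j}$\<close>
  | Store nat nat           \<comment> \<open>\<open>Store i j\<close>: $M_{R_i} := R_j$\<close>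
  | Toss nat                \<comment> \<open>\<open>Toss i\<close>: $R_i :=$ a random bit\<close>
  | Seq prog prog
  | Cond nat prog prog      \<comment> \<open>branch on $R_i \neq 0$\<close>
  | While nat prog          \<comment> \<open>loop as long as $R_i \neq 0$\<close>

fun binop_val :: "binop \<Rightarrow> nat \<Rightarrow> nat \<Rightarrow> nat" where
  "binop_val Add x y = x + y"
| "binop_val Sub x y = x - y"
| "binop_val Mul x y = x * y"
| "binop_val Div x y = x div y"
| "binop_val Mod x y = x mod y"
| "binop_val Band x y = and x y"
| "binop_val Bxor x y = xor x y"

type_synonym state = "(nat \<Rightarrow> nat) \<times> (nat \<Rightarrow> nat)"

abbreviation len :: "nat \<Rightarrow> nat" where
  "len x \<equiv> floorlog 2 x"

text \<open>
  \<open>exec c (s, \<omega>) t (s', \<omega>')\<close>: started in state \<open>s\<close> with the infinite sequence \<open>\<omega>\<close> of future coin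
  tosses, \<open>c\<close> halts at cost \<open>t\<close> in state \<open>s'\<close>, and \<open>\<omega>'\<close> is the part of \<open>\<omega>\<close> that was not consumed.
  Every step is charged for the binary lengths of the numbers (including addresses) it touches;
  arithmetic is charged at the rate of schoolbook multiplication.
\<close>

inductive exec :: "prog \<Rightarrow> state \<times> bool stream \<Rightarrow> nat \<Rightarrow> state \<times> bool stream \<Rightarrow> bool" where
  Imm: "exec (Imm i c) ((R, M), \<omega>) (1 + len c) ((R(i := c), M), \<omega>)"
| Arith: "exec (Arith f i j l) ((R, M), \<omega>) ((1 + len (R j)) * (1 + len (R l)))
           ((R(i := binop_val f (R j) (R l)), M), \<omega>)"
| Load: "exec (Load i j) ((R, M), \<omega>) (1 + len (R j) + len (M (R j))) ((R(i := M (R j)), M), \<omega>)"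
| Store: "exec (Store i j) ((R, M), \<omega>) (1 + len (R i) + len (R j)) ((R, M(R i := R j)), \<omega>)"
| Toss: "exec (Toss i) ((R, M), b ## \<omega>) 1 ((R(i := of_bool b), M), \<omega>)"
| Seq: "exec c1 x t1 y \<Longrightarrow> exec c2 y t2 z \<Longrightarrow> exec (Seq c1 c2) x (t1 + t2) z"
| CondTrue: "R i \<noteq> 0 \<Longrightarrow> exec c1 ((R, M), \<omega>) t y \<Longrightarrow>
    exec (Cond i c1 c2) ((R, M), \<omega>) (1 + len (R i) + t) y"
| CondFalse: "R i = 0 \<Longrightarrow> exec c2 ((R, M), \<omega>) t y \<Longrightarrow>
    exec (Cond i c1 c2) ((R, M), \<omega>) (1 + len (R i) + t) y"
| WhileFalse: "R i = 0 \<Longrightarrow> exec (While i c) ((R, M), \<omega>) (1 + len (R i)) ((R, M), \<omega>)"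
| WhileTrue: "R i \<noteq> 0 \<Longrightarrow> exec c ((R, M), \<omega>) t1 y \<Longrightarrow> exec (While i c) y t2 z \<Longrightarrow>
    exec (While i c) ((R, M), \<omega>) (1 + len (R i) + t1 + t2) z"

inductive_cases exec_elims:
  "exec (Imm i c) x t y" "exec (Arith f i j l) x t y" "exec (Load i j) x t y"
  "exec (Store i j) x t y" "exec (Toss i) x t y" "exec (Seq c1 c2) x t y"
  "exec (Cond i c1 c2) x t y" "exec (While i c) x t y"

lemma exec_deterministic:
  "exec c x t y \<Longrightarrow> exec c x t' y' \<Longrightarrow> t' = t \<and> y' = y"
proof (induction arbitrary: t' y' rule: exec.induct)
  case (Seq c1 x t1 y c2 t2 z)
  from Seq.prems obtain u1 u2 w where u: "exec c1 x u1 w" "exec c2 w u2 y'" "t' = u1 + u2"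
    by (rule exec_elims(6))
  from Seq.IH(1)[OF u(1)] have "u1 = t1" "w = y" by simp_all
  with Seq.IH(2) u show ?case by simp
next
  case (WhileTrue R i c M \<omega> t1 y t2 z)
  from WhileTrue.prems obtain u1 u2 w where
    u: "exec c ((R, M), \<omega>) u1 w" "exec (While i c) w u2 y'" "t' = 1 + len (R i) + u1 + u2"
    by (rule exec_elims(8)) (use WhileTrue.hyps(1) in auto)
  from WhileTrue.IH(1)[OF u(1)] have "u1 = t1" "w = y" by simp_all
  with WhileTrue.IH(2) u show ?case by simp
next
  case (CondTrue R i c1 M \<omega> t y c2)
  from CondTrue.prems obtain u where
    "exec c1 ((R, M), \<omega>) u y'" "t' = 1 + len (R i) + u"
    by (rule exec_elims(7)) (use CondTrue.hyps(1) in auto)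
  with CondTrue.IH show ?case by simp
next
  case (CondFalse R i c2 M \<omega> t y c1)
  from CondFalse.prems obtain u where
    "exec c2 ((R, M), \<omega>) u y'" "t' = 1 + len (R i) + u"
    by (rule exec_elims(7)) (use CondFalse.hyps(1) in auto)
  with CondFalse.IH show ?case by simp
next
  case WhileFalse
  from WhileFalse.prems show ?case by (rule exec_elims(8)) (use WhileFalse.hyps in auto)
qed (auto elim: exec_elims(1-5))

definition halts_within :: "prog \<Rightarrow> state \<Rightarrow> nat \<Rightarrow> bool" where
  "halts_within c s T \<longleftrightarrow> (\<forall>\<omega>. \<exists>t y. exec c (s, \<omega>) t y \<and> t \<le> T)"

text \<open>The answer is read off register 0 upon halting: nonzero means YES, zero means NO.\<close>

definition answers_no :: "prog \<Rightarrow> state \<Rightarrow> bool stream \<Rightarrow> bool" where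
  "answers_no c s \<omega> \<longleftrightarrow> (\<exists>t R M \<omega>'. exec c (s, \<omega>) t ((R, M), \<omega>') \<and> R 0 = 0)"

definition coin_space :: "bool stream measure" where
  "coin_space = stream_space (measure_pmf (bernoulli_pmf (1/2)))"

lemma exec_prefix:
  "exec c x t y \<Longrightarrow>
   \<exists>bs. snd x = bs @- snd y \<and> (\<forall>\<omega>. exec c (fst x, bs @- \<omega>) t (fst y, \<omega>))"
proof (induction rule: exec.induct)
  case (Imm i c R M \<omega>)
  show ?case by (rule exI[of _ "[]"]) (use exec.Imm[of i c R M] in simp)
next
  case (Arith f i j l R M \<omega>)
  show ?case by (rule exI[of _ "[]"]) (use exec.Arith[of f i j l R M] in simp)
next
  case (Load i j R M \<omega>)
  show ?case by (rule exI[of _ "[]"]) (use exec.Load[of i j R M] in simp)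
next
  case (Store i j R M \<omega>)
  show ?case by (rule exI[of _ "[]"]) (use exec.Store[of i j R M] in simp)
next
  case (Toss i R M b \<omega>)
  show ?case by (rule exI[of _ "[b]"]) (use exec.Toss[of i R M b] in simp)
next
  case (Seq c1 x t1 y c2 t2 z)
  then obtain bs1 bs2 where
    *: "snd x = bs1 @- snd y" "\<And>\<omega>. exec c1 (fst x, bs1 @- \<omega>) t1 (fst y, \<omega>)"
    "snd y = bs2 @- snd z" "\<And>\<omega>. exec c2 (fst y, bs2 @- \<omega>) t2 (fst z, \<omega>)" by metis
  from exec.Seq[OF *(2) *(4)] *(1,3) show ?case by (intro exI[of _ "bs1 @ bs2"]) simp
next
  case (CondTrue R i c1 M \<omega> t y c2)
  then obtain bs where
    *: "\<omega> = bs @- snd y" "\<And>\<omega>. exec c1 ((R, M), bs @- \<omega>) t (fst y, \<omega>)" by auto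
  from exec.CondTrue[where R = R and i = i, OF CondTrue.hyps(1) *(2)] *(1)
  show ?case by (intro exI[of _ bs]) simp
next
  case (CondFalse R i c2 M \<omega> t y c1)
  then obtain bs where
    *: "\<omega> = bs @- snd y" "\<And>\<omega>. exec c2 ((R, M), bs @- \<omega>) t (fst y, \<omega>)" by auto
  from exec.CondFalse[where R = R and i = i, OF CondFalse.hyps(1) *(2)] *(1)
  show ?case by (intro exI[of _ bs]) simp
next
  case (WhileFalse R i c M \<omega>)
  then show ?case
    by (intro exI[of _ "[]"]) (use exec.WhileFalse[where R = R and i = i, OF WhileFalse] in simp)
next
  case (WhileTrue R i c M \<omega> t1 y t2 z)
  then obtain bs1 bs2 where
    *: "\<omega> = bs1 @- snd y" "\<And>\<omega>. exec c ((R, M), bs1 @- \<omega>) t1 (fst y, \<omega>)"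
    "snd y = bs2 @- snd z" "\<And>\<omega>. exec (While i c) (fst y, bs2 @- \<omega>) t2 (fst z, \<omega>)" by auto
  from exec.WhileTrue[where R = R and i = i, OF WhileTrue.hyps(1) *(2) *(4)] *(1,3)
  show ?case by (intro exI[of _ "bs1 @ bs2"]) simp
qed

lemma prefix_event_measurable: "{\<omega>. \<exists>\<omega>'. \<omega> = bs @- \<omega>'} \<in> sets coin_space"
proof -
  have eq: "{\<omega>. \<exists>\<omega>'. \<omega> = bs @- \<omega>'} =
    stake (length bs) -` {bs} \<inter> space coin_space"
    by (auto simp: coin_space_def space_stream_space stake_shift) (metis stake_sdrop)
  have "stake (length bs) \<in> measurable coin_space (count_space UNIV)"
    using measurable_stake[where i = "length bs" and 'a = bool]
    unfolding coin_space_def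
    by (simp cong: measurable_cong_sets sets_stream_space_cong)
  then show ?thesis unfolding eq by (rule measurable_sets) simp
qed

lemma answers_no_measurable: "{\<omega>. answers_no c s \<omega>} \<in> sets coin_space"
proof -
  let ?B = "{bs. \<exists>t R M. R 0 = 0 \<and> (\<forall>\<omega>. exec c (s, bs @- \<omega>) t ((R, M), \<omega>))}"
  have "{\<omega>. answers_no c s \<omega>} = (\<Union>bs \<in> ?B. {\<omega>. \<exists>\<omega>'. \<omega> = bs @- \<omega>'})"
  proof (intro equalityI subsetI)
    fix \<omega> assume "\<omega> \<in> {\<omega>. answers_no c s \<omega>}"
    then obtain t R M \<omega>' where e: "exec c (s, \<omega>) t ((R, M), \<omega>')" "R 0 = 0"
      by (auto simp: answers_no_def)
    from exec_prefix[OF e(1)] obtain bs where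
      "\<omega> = bs @- \<omega>'" "\<forall>\<omega>. exec c (s, bs @- \<omega>) t ((R, M), \<omega>)" by auto
    with e(2) show "\<omega> \<in> (\<Union>bs \<in> ?B. {\<omega>. \<exists>\<omega>'. \<omega> = bs @- \<omega>'})" by blast
  next
    fix \<omega> assume "\<omega> \<in> (\<Union>bs \<in> ?B. {\<omega>. \<exists>\<omega>'. \<omega> = bs @- \<omega>'})"
    then show "\<omega> \<in> {\<omega>. answers_no c s \<omega>}" unfolding answers_no_def by blast
  qed
  also have "\<dots> \<in> sets coin_space"
    by (rule sets.countable_UN') (auto intro: prefix_event_measurable)
  finally show ?thesis .
qed


section \<open>Input encoding\<close>

text \<open>
  The instance $(G, k)$ with vertex set $\{0, \ldots, n - 1\}$: $R_0 = n$, $R_1 = k$, and the adjacency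
  matrix of $G$ is stored row by row in $M_0, \ldots, M_{n^2 - 1}$. All other cells are $0$ (note that
  \<open>a div n \<ge> n\<close> for \<open>a \<ge> n\<^sup>2\<close>, and that there are no arcs if \<open>n = 0\<close>).
\<close>

definition encode :: "nat pair_pre_digraph \<Rightarrow> nat \<Rightarrow> state" where
  "encode G k = (let n = card (pverts G) in
     ((\<lambda>_. 0)(0 := n, 1 := k), \<lambda>a. of_bool ((a div n, a mod n) \<in> parcs G)))"

definition input_size :: "nat pair_pre_digraph \<Rightarrow> nat \<Rightarrow> nat" where
  "input_size G k = (let n = card (pverts G) in n\<^sup>2 + len n + len k)"

end

theory Submission
  imports
    Defs
    "HOL-Combinatorics.Transposition"
    "HOL-Computational_Algebra.Polynomial_FPS"
    "HOL-Library.Z2"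
    "Jordan_Normal_Form.Determinant"
begin

text \<open>
  Work in characteristic 2. Give every arc $uv$ the weight
  $x_{uv} = X^{D} z_{uv} + X^{Dn} w_{uv} \sum_{j \in A} a_{uj}$, where $A \subseteq \{0, \ldots, k - 1\}$ and
  $z$, $w$, $a$ are random polynomials over the field with two elements. By the matrix-tree theorem the determinant of the
  identity plus the weighted Laplacian enumerates the spanning out-forests, with one factor per arc.
  Expanding each factor marks some arcs (those that contribute $w$ instead of $z$), and $D$ exceeds the
  degree of every product of the $z$, $w$, $a$ that can occur, so a window of $D$ coefficients isolates the
  forests with $n - 1$ arcs, $k$ of them marked, i.e. the out-branchings with $k$ marked arcs. Summing over all $A$ leaves only
  bijective labellings of the marked arcs by $0, \ldots, k - 1$, and labellings of marked arcs
  with a common tail cancel in pairs. The surviving monomials are multilinear and pairwise distinct, so the sum is a nonzero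
  polynomial in the $z$, $w$, $a$ exactly if some out-branching has $k$ internal vertices, and the
  Schwartz-Zippel lemma bounds the error.

  Polynomials modulo $X^N$ are stored as natural numbers. Modulo $X$ the matrix is the identity, hence
  Gaussian elimination needs no pivoting and all the inverses exist as power series.
\<close>


section \<open>The matrix-tree theorem in characteristic 2\<close>

text \<open>The identity summand plays a virtual root, so one determinant serves all choices of the
  root; the price is forests with several roots, which the exponents filter out. In units of
  \<open>D\<close> an unmarked arc weighs 1 and a marked one \<open>n\<close>. A forest has fewer
  than \<open>n\<close> arcs, so the total is a two-digit number in base \<open>n\<close> that
  reveals both counts. Weights attach to single arcs and cannot count internal vertices directly;
  but at least \<open>k\<close> vertices are internal iff \<open>k\<close> arcs with distinct tails
  can be marked. Characteristic 2 spares the signs of inclusion-exclusion, but could also destroy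
  wanted terms. Hence the separate variables \<open>z\<close> and \<open>w\<close>: a monomial
  displays the tree, the marked arcs and the labels. Random polynomials of degree below
  \<open>n\<close> stand in for a field with \<open>2 ^ n\<close> elements. They form an integral
  domain, which is all that Schwartz-Zippel asks for, and no such field has to be constructed. With
  \<open>3 * n^2\<close> variables the error is at most \<open>3 * n^2 / 2 ^ n\<close>. Only the sum
  over the label sets is exponential; each determinant uses series with \<open>2 * n ^ 4\<close>
  coefficients.\<close>

declare add_bit_eq_xor [simp del] mult_bit_eq_and [simp del]

lemma bit_double: "(a :: bit) + a = 0"
  by (cases a) simp_all

lemma bit_add_eq_0_iff: "(a :: bit) + b = 0 \<longleftrightarrow> a = b"
  by (cases a; cases b) simp_all

lemma bit_fps_double [simp]: "(f :: bit fps) + f = 0"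
  by (rule fps_ext) (simp only: fps_add_nth fps_zero_nth bit_double)

lemma bit_poly_double [simp]: "(f :: bit poly) + f = 0"
  by (rule poly_eqI) (simp only: coeff_add coeff_0 bit_double)

text \<open>
  A spanning out-forest is given by its parent function; the value $n$ stands for a virtual parent of
  the roots.
\<close>

definition rooted :: "nat \<Rightarrow> (nat \<Rightarrow> nat) \<Rightarrow> bool" where
  "rooted n f \<longleftrightarrow> (\<forall>v<n. \<exists>j. (f ^^ j) v = n)"

text \<open>In characteristic 2 this is the Laplacian of the graph of \<open>f\<close> with the
  virtual root deleted: for \<open>f v = n\<close> the second indicator is 0 throughout the
  row.\<close>

definition parent_mat :: "nat \<Rightarrow> (nat \<Rightarrow> nat) \<Rightarrow> 'a :: comm_ring_1 mat" where
  "parent_mat n f = Matrix.mat n n (\<lambda>(v, i). of_bool (i = v) + of_bool (i = f v))"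

lemma parent_mat_carrier [simp]: "parent_mat n f \<in> carrier_mat n n"
  unfolding parent_mat_def by (rule mat_carrier)

lemma parent_mat_kernel:
  assumes c: "c \<in> carrier_vec n"
  shows "parent_mat n f *\<^sub>v (c :: 'a :: comm_ring_1 vec) = 0\<^sub>v n \<longleftrightarrow>
    (\<forall>v<n. vec_index c v + (if f v < n then vec_index c (f v) else 0) = 0)"
proof -
  have "(parent_mat n f *\<^sub>v c) $ v = vec_index c v + (if f v < n then vec_index c (f v) else 0)" if "v < n" for v
  proof -
    have "(parent_mat n f *\<^sub>v c) $ v
        = (\<Sum>i = 0..<n. (of_bool (i = v) + of_bool (i = f v)) * vec_index c i)"
      using that c by (simp add: parent_mat_def scalar_prod_def)
    also have "\<dots> = (\<Sum>i = 0..<n. of_bool (i = v) * vec_index c i) + (\<Sum>i = 0..<n. of_bool (i = f v) * vec_index c i)"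
      by (simp add: distrib_right sum.distrib)
    also have "(\<Sum>i = 0..<n. of_bool (i = v) * vec_index c i) = vec_index c v"
      using that by (simp add: of_bool_def if_distrib[of "\<lambda>x. x * _"] sum.delta cong: if_cong)
    also have "(\<Sum>i = 0..<n. of_bool (i = f v) * vec_index c i) = (if f v < n then vec_index c (f v) else 0)"
      by (simp add: of_bool_def if_distrib[of "\<lambda>x. x * _"] sum.delta cong: if_cong)
    finally show ?thesis .
  qed
  then show ?thesis using c
    by (auto simp: vec_eq_iff parent_mat_def)
qed

text \<open>
  A kernel vector is a labelling that is constant along parents and $0$ at the virtual root. A nonzero
  one exists iff some vertex never reaches the virtual root.
\<close>

lemma det_parent_mat_bit:
  assumes f: "\<And>v. v < n \<Longrightarrow> f v \<le> n"
  shows "Determinant.det (parent_mat n f :: bit mat) = of_bool (rooted n f)"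
proof -
  let ?C = "parent_mat n f :: bit mat"
  have C: "?C \<in> carrier_mat n n" by (rule parent_mat_carrier)
  have "Determinant.det ?C = 0 \<longleftrightarrow> \<not> rooted n f"
  proof
    assume "Determinant.det ?C = 0"
    then obtain c where c: "c \<in> carrier_vec n" "c \<noteq> 0\<^sub>v n" "?C *\<^sub>v c = 0\<^sub>v n"
      using det_0_iff_vec_prod_zero_field[OF C] by auto
    from c(3) have "\<forall>v<n. vec_index c v + (if f v < n then vec_index c (f v) else 0) = 0"
      using parent_mat_kernel[OF c(1)] by blast
    then have step: "vec_index c v = (if f v < n then vec_index c (f v) else 0)" if "v < n" for v
      using that bit_add_eq_0_iff by blast
    have "vec_index c v = 0" if "(f ^^ j) v = n" "v < n" for j v
      using that
    proof (induction j arbitrary: v)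
      case (Suc j)
      have "(f ^^ j) (f v) = n" using Suc.prems(1) by (simp add: funpow_swap1)
      with Suc.IH Suc.prems(2) show ?case by (subst step) auto
    qed simp
    moreover from c(1,2) obtain v where "v < n" "vec_index c v \<noteq> 0" by (auto simp: vec_eq_iff)
    ultimately show "\<not> rooted n f" unfolding rooted_def by metis
  next
    assume "\<not> rooted n f"
    then obtain w where w: "w < n" "\<And>j. (f ^^ j) w \<noteq> n" by (auto simp: rooted_def)
    define c :: "bit vec" where "c = Matrix.vec n (\<lambda>v. of_bool (\<forall>j. (f ^^ j) v \<noteq> n))"
    have c: "c \<in> carrier_vec n" "vec_index c w = 1" using w by (simp_all add: c_def)
    have "(\<forall>j. (f ^^ j) (f v) \<noteq> n) \<longleftrightarrow> (\<forall>j. (f ^^ j) v \<noteq> n)" if "v < n" for v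
    proof
      assume *: "\<forall>j. (f ^^ j) (f v) \<noteq> n"
      show "\<forall>j. (f ^^ j) v \<noteq> n"
      proof
        fix j show "(f ^^ j) v \<noteq> n" using * that by (cases j) (auto simp: funpow_swap1)
      qed
    next
      assume *: "\<forall>j. (f ^^ j) v \<noteq> n"
      show "\<forall>j. (f ^^ j) (f v) \<noteq> n"
      proof
        fix j show "(f ^^ j) (f v) \<noteq> n" using *[THEN spec, of "Suc j"] by (simp add: funpow_swap1)
      qed
    qed
    note reach = this
    have "vec_index c v = (if f v < n then vec_index c (f v) else 0)" if "v < n" for v
    proof (cases "f v = n")
      case True
      then have "\<not> (\<forall>j. (f ^^ j) v \<noteq> n)" by (auto intro: exI[of _ 1])
      with True show ?thesis using that by (simp add: c_def)
    next
      case False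
      then show ?thesis using reach[OF that] f[OF that] that by (simp add: c_def)
    qed
    then have "?C *\<^sub>v c = 0\<^sub>v n"
      using bit_add_eq_0_iff by (subst parent_mat_kernel[OF c(1)]) blast
    moreover have "c \<noteq> 0\<^sub>v n" using c w by auto
    ultimately show "Determinant.det ?C = 0"
      using det_0_iff_vec_prod_zero_field[OF C] c by auto
  qed
  then show ?thesis by (cases "rooted n f") auto
qed

interpretation fps_const_bit: comm_ring_hom "fps_const :: bit \<Rightarrow> bit fps"
  by unfold_locales simp_all

text \<open>The kernel criterion behind the version over \<open>bit\<close> needs a field. All
  entries are constants, so the determinant passes through the embedding into power series.\<close>

lemma det_parent_mat:
  assumes f: "\<And>v. v < n \<Longrightarrow> f v \<le> n"
  shows "Determinant.det (parent_mat n f :: bit fps mat) = of_bool (rooted n f)"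
proof -
  have "(parent_mat n f :: bit fps mat) = map_mat fps_const (parent_mat n f)"
    by (rule eq_matI) (auto simp: parent_mat_def fps_const_add[symmetric] simp del: fps_const_add)
  then show ?thesis by (simp add: det_parent_mat_bit[OF f])
qed

section \<open>Expansion of the determinant over out-forests\<close>

text \<open>The determinant is linear in every row; \<open>f\<close> records which summand is taken
  from row \<open>v\<close>.\<close>

lemma det_sum_rows:
  fixes g :: "nat \<Rightarrow> nat \<Rightarrow> nat \<Rightarrow> 'a :: comm_ring_1"
  assumes "finite U"
  shows "Determinant.det (Matrix.mat n n (\<lambda>(v, i). \<Sum>u\<in>U. x u v * g u v i)) =
    (\<Sum>f\<in>{..<n} \<rightarrow>\<^sub>E U. (\<Prod>v<n. x (f v) v) * Determinant.det (Matrix.mat n n (\<lambda>(v, i). g (f v) v i)))"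
proof -
  have "Determinant.det (Matrix.mat n n (\<lambda>(v, i). \<Sum>u\<in>U. x u v * g u v i)) =
     (\<Sum>p | p permutes {0..<n}. signof p * (\<Prod>v<n. \<Sum>u\<in>U. x u v * g u v (p v)))"
    by (subst det_def') (auto intro!: sum.cong prod.cong arg_cong2[where f = "(*)"]
      simp: lessThan_atLeast0 permutes_in_image)
  also have "\<dots> = (\<Sum>p | p permutes {0..<n}. \<Sum>f\<in>{..<n} \<rightarrow>\<^sub>E U.
      signof p * ((\<Prod>v<n. x (f v) v) * (\<Prod>v<n. g (f v) v (p v))))"
    using assms by (subst prod_sum_PiE) (simp_all add: prod.distrib sum_distrib_left)
  also have "\<dots> = (\<Sum>f\<in>{..<n} \<rightarrow>\<^sub>E U. (\<Prod>v<n. x (f v) v) *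
      (\<Sum>p | p permutes {0..<n}. signof p * (\<Prod>v<n. g (f v) v (p v))))"
    by (subst sum.swap) (simp add: sum_distrib_left mult_ac)
  also have "\<dots> = (\<Sum>f\<in>{..<n} \<rightarrow>\<^sub>E U. (\<Prod>v<n. x (f v) v) * Determinant.det (Matrix.mat n n (\<lambda>(v, i). g (f v) v i)))"
    by (rule sum.cong[OF refl], subst det_def')
      (auto intro!: sum.cong prod.cong arg_cong2[where f = "(*)"]
      simp: lessThan_atLeast0 permutes_in_image)
  finally show ?thesis .
qed

text \<open>Row \<open>v\<close> is the sum of \<open>x u v * (e_v + e_u)\<close> over all candidate
  parents \<open>u\<close>, where \<open>u = n\<close> is the virtual root, with weight 1 and
  \<open>e_n = 0\<close>. The determinant thus splits into those of parent matrices, which are 1 for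
  forests and 0 otherwise. The 1 on the diagonal is the weight of the virtual arc.\<close>

lemma forest_expansion:
  fixes x :: "nat \<Rightarrow> nat \<Rightarrow> bit fps"
  assumes "\<And>v. x n v = 1"
  shows "Determinant.det (Matrix.mat n n (\<lambda>(v, i). x i v + of_bool (i = v) * (1 + (\<Sum>u<n. x u v)))) =
    (\<Sum>f | f \<in> {..<n} \<rightarrow>\<^sub>E {..n} \<and> rooted n f. \<Prod>v<n. x (f v) v)"
proof -
  have "Matrix.mat n n (\<lambda>(v, i). x i v + of_bool (i = v) * (1 + (\<Sum>u<n. x u v))) =
    Matrix.mat n n (\<lambda>(v, i). \<Sum>u\<le>n. x u v * (of_bool (i = v) + of_bool (i = u)))"
  proof (rule eq_matI, goal_cases)
    case (1 v i)
    have "(\<Sum>u\<le>n. x u v * (of_bool (i = v) + of_bool (i = u))) =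
       (\<Sum>u\<le>n. x u v) * of_bool (i = v) + (\<Sum>u\<le>n. x u v * of_bool (i = u))"
      by (simp add: distrib_left sum.distrib sum_distrib_right)
    also have "(\<Sum>u\<le>n. x u v * of_bool (i = u)) = x i v"
      using 1 by (simp add: of_bool_def if_distrib[of "\<lambda>y. _ * y"] sum.delta cong: if_cong)
    also have "(\<Sum>u\<le>n. x u v) = 1 + (\<Sum>u<n. x u v)"
      using assms by (simp add: lessThan_Suc_atMost[symmetric])
    finally show ?case using 1 by (simp add: algebra_simps)
  qed auto
  then have "Determinant.det (Matrix.mat n n (\<lambda>(v, i). x i v + of_bool (i = v) * (1 + (\<Sum>u<n. x u v)))) =
    (\<Sum>f\<in>{..<n} \<rightarrow>\<^sub>E {..n}. (\<Prod>v<n. x (f v) v) * Determinant.det (parent_mat n f))"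
    by (simp only: det_sum_rows[OF finite_atMost] parent_mat_def)
  also have "\<dots> = (\<Sum>f\<in>{..<n} \<rightarrow>\<^sub>E {..n}. if rooted n f then \<Prod>v<n. x (f v) v else 0)"
    by (intro sum.cong refl, subst det_parent_mat) (auto simp: PiE_def Pi_def)
  also have "\<dots> = (\<Sum>f | f \<in> {..<n} \<rightarrow>\<^sub>E {..n} \<and> rooted n f. \<Prod>v<n. x (f v) v)"
    by (subst sum.inter_filter) (auto intro!: finite_PiE)
  finally show ?thesis .
qed

text \<open>
  Gaussian elimination starting from the last row, so that the remaining matrix is always a leading block.
\<close>

fun pdet :: "nat \<Rightarrow> (nat \<Rightarrow> nat \<Rightarrow> bit fps) \<Rightarrow> bit fps" where
  "pdet 0 F = 1"
| "pdet (Suc p) F = F p p * pdet p (\<lambda>i j. F i j + F i p * inverse (F p p) * F p j)"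

text \<open>Block elimination with pivot \<open>F p p\<close>: the matrix is a unit upper triangular
  \<open>?U\<close> times a matrix \<open>W\<close> whose last column vanishes above the pivot. The
  usual minus sign of the Schur complement is a plus here.\<close>

lemma det_schur:
  fixes F :: "nat \<Rightarrow> nat \<Rightarrow> bit fps"
  assumes "fps_nth (F p p) 0 = 1"
  shows "Determinant.det (Matrix.mat (Suc p) (Suc p) (\<lambda>(i, j). F i j)) =
    F p p * Determinant.det (Matrix.mat p p (\<lambda>(i, j). F i j + F i p * inverse (F p p) * F p j))"
proof -
  let ?I = "inverse (F p p)"
  have inv: "?I * F p p = 1" using assms by (simp add: inverse_mult_eq_1)
  let ?U = "Matrix.mat (Suc p) (Suc p) (\<lambda>(i, j). if i = j then 1 else if j = p then F i p * ?I else 0)"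
  let ?A1 = "Matrix.mat p p (\<lambda>(i, j). F i j + F i p * ?I * F p j)"
  define W where "W = four_block_mat ?A1 (0\<^sub>m p 1) (Matrix.mat 1 p (\<lambda>(i, j). F p j)) (Matrix.mat 1 1 (\<lambda>_. F p p))"
  have W: "W \<in> carrier_mat (Suc p) (Suc p)"
    using four_block_carrier_mat[of ?A1 p p "Matrix.mat 1 1 (\<lambda>_. F p p)" 1 1] by (simp add: W_def)
  have Wi: "W $$ (k, j) = (if k < p then (if j < p then F k j + F k p * ?I * F p j else 0) else F p j)"
    if "k < Suc p" "j < Suc p" for k j using that by (auto simp: W_def less_Suc_eq)
  have "Matrix.mat (Suc p) (Suc p) (\<lambda>(i, j). F i j) = ?U * W"
  proof (rule eq_matI, goal_cases)
    case (1 i j)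
    then have ij: "i < Suc p" "j < Suc p" using W by auto
    have "(?U * W) $$ (i, j) = (\<Sum>k = 0..<Suc p. ?U $$ (i, k) * W $$ (k, j))"
      using ij W by (simp add: scalar_prod_def)
    also have "\<dots> = (\<Sum>k = 0..<p. ?U $$ (i, k) * W $$ (k, j)) + ?U $$ (i, p) * F p j"
      using ij Wi[of p j] by simp
    also have "(\<Sum>k = 0..<p. ?U $$ (i, k) * W $$ (k, j)) = (\<Sum>k = 0..<p. if k = i then W $$ (k, j) else 0)"
      using ij by (intro sum.cong refl) auto
    also have "\<dots> = (if i < p then W $$ (i, j) else 0)"
      by (simp add: sum.delta)
    also have "\<dots> + ?U $$ (i, p) * F p j = F i j"
    proof (cases "i < p")
      case True
      have eq: "F i p = F i p * ?I * F p p" by (simp only: mult.assoc inv mult_1_right)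
      show ?thesis
      proof (cases "j < p")
        case True
        then show ?thesis using ij \<open>i < p\<close> by (simp only: Wi) (simp add: add.assoc)
      next
        case False
        then have "j = p" using ij by simp
        then show ?thesis using ij \<open>i < p\<close> eq by (simp only: Wi) simp
      qed
    next
      case False
      then show ?thesis using ij by (simp add: less_Suc_eq)
    qed
    finally show ?case using ij by simp
  qed (use W in auto)
  moreover have "Determinant.det ?U = 1"
  proof -
    have "diag_mat ?U = map (\<lambda>_. 1) [0..<Suc p]" by (auto simp: diag_mat_def)
    moreover have "upper_triangular ?U" by auto
    ultimately show ?thesis
      by (subst det_upper_triangular[where n = "Suc p"]) (simp_all add: map_replicate_const del: upt_Suc)
  qed
  moreover have "Determinant.det W = Determinant.det ?A1 * F p p"
    unfolding W_def
    by (subst det_four_block_mat_upper_right_zero_col[where n = p]) (auto simp: det_single)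
  ultimately show ?thesis
    using det_mult[of ?U "Suc p" W] W by (simp add: mult.commute)
qed

text \<open>The hypothesis is an invariant of the recursion: the correction to entry
  \<open>(i, j)\<close> contains the factor \<open>F i p\<close>, whose constant term is 0. So every
  pivot has constant term 1 and is invertible.\<close>

lemma pdet_eq_det:
  assumes "\<And>i j. i < n \<Longrightarrow> j < n \<Longrightarrow> fps_nth (F i j) 0 = of_bool (i = j)"
  shows "pdet n F = Determinant.det (Matrix.mat n n (\<lambda>(i, j). F i j))"
  using assms
proof (induction n arbitrary: F)
  case (Suc n)
  then show ?case
    by (subst det_schur) (simp_all add: fps_mult_nth Suc.IH)
qed (simp add: Determinant.det_def)


section \<open>The sieve\<close>

lemma sum_if_filter:
  assumes "finite A" "{x \<in> A. P x} = B"
  shows "(\<Sum>x\<in>A. if P x then g x else 0) = sum g B"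
  using sum.inter_filter[OF assms(1), of g P] assms(2) by simp

lemma sum_Sigma3:
  assumes "finite A" "\<And>x. x \<in> A \<Longrightarrow> finite (B x)" "\<And>x y. x \<in> A \<Longrightarrow> y \<in> B x \<Longrightarrow> finite (C x y)"
  shows "(\<Sum>x\<in>A. \<Sum>y\<in>B x. \<Sum>z\<in>C x y. g x y z) =
    (\<Sum>(x, y, z)\<in>(SIGMA x:A. SIGMA y:B x. C x y). g x y z)"
proof -
  have "(\<Sum>x\<in>A. \<Sum>y\<in>B x. \<Sum>z\<in>C x y. g x y z) = (\<Sum>x\<in>A. \<Sum>(y, z)\<in>(SIGMA y:B x. C x y). g x y z)"
    using assms by (intro sum.cong refl sum.Sigma) auto
  also have "\<dots> = (\<Sum>(x, y, z)\<in>(SIGMA x:A. SIGMA y:B x. C x y). g x y z)"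
    using assms by (intro sum.Sigma) (auto intro!: finite_SigmaI)
  finally show ?thesis .
qed

text \<open>The terms at \<open>x\<close> and \<open>g x\<close> are equal and cancel, so the orbits
  can be removed one pair at a time.\<close>

lemma sum_involution_bit_poly:
  fixes h :: "'b \<Rightarrow> bit poly"
  assumes "finite A" "\<And>x. x \<in> A \<Longrightarrow> g x \<in> A" "\<And>x. x \<in> A \<Longrightarrow> g (g x) = x"
    "\<And>x. x \<in> A \<Longrightarrow> g x \<noteq> x" "\<And>x. x \<in> A \<Longrightarrow> h (g x) = h x"
  shows "sum h A = 0"
  using assms
proof (induction "card A" arbitrary: A rule: less_induct)
  case less
  show ?case
  proof (cases "A = {}")
    case False
    then obtain x where x: "x \<in> A" by auto
    let ?B = "A - {x, g x}"
    have gx: "g x \<in> A" "g x \<noteq> x" "g (g x) = x" "h (g x) = h x" using x less.prems by auto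
    have "g y \<noteq> x \<and> g y \<noteq> g x" if "y \<in> ?B" for y using that gx less.prems(3) by (metis DiffE insertCI)
    then have "sum h ?B = 0"
      using less.prems x gx by (intro less.hyps) (auto intro!: psubset_card_mono)
    moreover have "sum h A = sum h ?B + (h x + h (g x))"
      using sum.subset_diff[of "{x, g x}" A h] x gx less.prems(1) by simp
    ultimately show ?thesis using gx by simp
  qed simp
qed

text \<open>The sieve counts label sets by powers of two; only the count 1 survives.\<close>

lemma bit_poly_of_nat_pow2: "(of_nat (2 ^ j) :: bit poly) = of_bool (j = 0)"
proof (cases j)
  case (Suc i)
  have "(2 :: bit poly) = 0" by (metis bit_poly_double one_add_one)
  then show ?thesis using Suc by simp
qed simp

lemma card_supersets:
  assumes "finite K" "I \<subseteq> K"
  shows "card {S \<in> Pow K. I \<subseteq> S} = 2 ^ (card K - card I)"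
proof -
  have "bij_betw (\<lambda>S. S - I) {S \<in> Pow K. I \<subseteq> S} (Pow (K - I))"
    by (rule bij_betwI[of _ _ _ "\<lambda>S. S \<union> I"]) (use assms in auto)
  then have "card {S \<in> Pow K. I \<subseteq> S} = card (Pow (K - I))" by (rule bij_betw_same_card)
  then show ?thesis using assms by (simp add: card_Pow card_Diff_subset finite_subset)
qed

lemma sieve_bijections:
  fixes a :: "nat \<Rightarrow> nat \<Rightarrow> bit poly"
  assumes F: "finite F" "card F = k"
  shows "(\<Sum>S\<in>Pow {..<k}. \<Prod>v\<in>F. \<Sum>j\<in>S. a (f v) j) =
    (\<Sum>\<sigma> | \<sigma> \<in> F \<rightarrow>\<^sub>E {..<k} \<and> bij_betw \<sigma> F {..<k}. \<Prod>v\<in>F. a (f v) (\<sigma> v))"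
proof -
  have fin: "finite (F \<rightarrow>\<^sub>E {..<k})" using F by (intro finite_PiE) auto
  have "(\<Sum>S\<in>Pow {..<k}. \<Prod>v\<in>F. \<Sum>j\<in>S. a (f v) j) =
     (\<Sum>S\<in>Pow {..<k}. \<Sum>\<sigma>\<in>F \<rightarrow>\<^sub>E S. \<Prod>v\<in>F. a (f v) (\<sigma> v))"
    using F finite_subset by (intro sum.cong refl prod_sum_PiE) auto
  also have "\<dots> = (\<Sum>S\<in>Pow {..<k}. \<Sum>\<sigma> | \<sigma> \<in> F \<rightarrow>\<^sub>E {..<k} \<and> \<sigma> ` F \<subseteq> S. \<Prod>v\<in>F. a (f v) (\<sigma> v))"
    by (intro sum.cong refl) (auto simp: PiE_def Pi_def image_subset_iff)
  also have "\<dots> = (\<Sum>\<sigma>\<in>F \<rightarrow>\<^sub>E {..<k}. \<Sum>S | S \<in> Pow {..<k} \<and> \<sigma> ` F \<subseteq> S. \<Prod>v\<in>F. a (f v) (\<sigma> v))"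
    by (rule sum.swap_restrict) (use fin in auto)
  also have "\<dots> = (\<Sum>\<sigma>\<in>F \<rightarrow>\<^sub>E {..<k}. if bij_betw \<sigma> F {..<k} then \<Prod>v\<in>F. a (f v) (\<sigma> v) else 0)"
  proof (rule sum.cong[OF refl])
    fix \<sigma> assume s: "\<sigma> \<in> F \<rightarrow>\<^sub>E {..<k}"
    then have sub: "\<sigma> ` F \<subseteq> {..<k}" by auto
    have "bij_betw \<sigma> F {..<k} \<longleftrightarrow> k - card (\<sigma> ` F) = 0"
    proof
      assume "k - card (\<sigma> ` F) = 0"
      moreover have "card (\<sigma> ` F) \<le> k" using F card_image_le by blast
      ultimately have "card (\<sigma> ` F) = k" by simp
      then show "bij_betw \<sigma> F {..<k}"
        using F sub eq_card_imp_inj_on[of F \<sigma>] card_subset_eq[of "{..<k}" "\<sigma> ` F"]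
        by (auto simp: bij_betw_def)
    qed (auto simp: bij_betw_def)
    then show "(\<Sum>S | S \<in> Pow {..<k} \<and> \<sigma> ` F \<subseteq> S. \<Prod>v\<in>F. a (f v) (\<sigma> v)) =
      (if bij_betw \<sigma> F {..<k} then \<Prod>v\<in>F. a (f v) (\<sigma> v) else 0)"
      using card_supersets[OF _ sub] by (simp add: bit_poly_of_nat_pow2[simplified])
  qed
  also have "\<dots> = (\<Sum>\<sigma> | \<sigma> \<in> F \<rightarrow>\<^sub>E {..<k} \<and> bij_betw \<sigma> F {..<k}. \<Prod>v\<in>F. a (f v) (\<sigma> v))"
    by (subst sum.inter_filter) (use fin in auto)
  finally show ?thesis .
qed

text \<open>Exchanging the labels of two elements with the same value of \<open>f\<close> leaves the
  product unchanged, but changes the labelling because it is injective.\<close>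

lemma sum_bijections_eq_0:
  fixes a :: "nat \<Rightarrow> nat \<Rightarrow> bit poly"
  assumes F: "finite F" and ninj: "\<not> inj_on f F"
  shows "(\<Sum>\<sigma> | \<sigma> \<in> F \<rightarrow>\<^sub>E {..<k} \<and> bij_betw \<sigma> F {..<k}. \<Prod>v\<in>F. a (f v) (\<sigma> v)) = 0"
proof -
  from ninj obtain p q where pq: "p \<in> F" "q \<in> F" "f p = f q" "p \<noteq> q" by (auto simp: inj_on_def)
  let ?t = "Transposition.transpose p q"
  have t: "bij_betw ?t F F" using pq by (intro bij_betw_transpose_iff) auto
  have tF: "?t v \<in> F" if "v \<in> F" for v using t that by (auto simp: bij_betw_def)
  have ft: "f (?t v) = f v" for v using pq by (auto simp: Transposition.transpose_def)
  show ?thesis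
  proof (rule sum_involution_bit_poly[where g = "\<lambda>\<sigma>. restrict (\<sigma> \<circ> ?t) F"])
    show "finite {\<sigma> \<in> F \<rightarrow>\<^sub>E {..<k}. bij_betw \<sigma> F {..<k}}"
      by (rule finite_subset[of _ "F \<rightarrow>\<^sub>E {..<k}"]) (use F in \<open>auto intro: finite_PiE\<close>)
    fix \<sigma> assume s: "\<sigma> \<in> {\<sigma> \<in> F \<rightarrow>\<^sub>E {..<k}. bij_betw \<sigma> F {..<k}}"
    have "bij_betw (\<sigma> \<circ> ?t) F {..<k}" using t s by (auto intro: bij_betw_trans)
    then have b: "bij_betw (restrict (\<sigma> \<circ> ?t) F) F {..<k}"
      by (subst bij_betw_cong[where g = "\<sigma> \<circ> ?t"]) auto
    moreover have "restrict (\<sigma> \<circ> ?t) F \<in> F \<rightarrow>\<^sub>E {..<k}" using s tF by (auto simp: PiE_iff)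
    ultimately show "restrict (\<sigma> \<circ> ?t) F \<in> {\<sigma> \<in> F \<rightarrow>\<^sub>E {..<k}. bij_betw \<sigma> F {..<k}}" by simp
    show "restrict (restrict (\<sigma> \<circ> ?t) F \<circ> ?t) F = \<sigma>"
      using s tF by (auto simp: fun_eq_iff PiE_iff extensional_def)
    show "restrict (\<sigma> \<circ> ?t) F \<noteq> \<sigma>"
    proof
      assume "restrict (\<sigma> \<circ> ?t) F = \<sigma>"
      from fun_cong[OF this, of p] pq have "\<sigma> q = \<sigma> p" by simp
      with s pq show False by (auto simp: bij_betw_def inj_on_def)
    qed
    have "(\<Prod>v\<in>F. a (f v) (restrict (\<sigma> \<circ> ?t) F v)) = (\<Prod>v\<in>F. a (f (?t v)) (\<sigma> (?t v)))"
      by (intro prod.cong refl) (simp add: ft)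
    also have "\<dots> = (\<Prod>v\<in>F. a (f v) (\<sigma> v))"
      by (rule prod.reindex_bij_betw[OF t])
    finally show "(\<Prod>v\<in>F. a (f v) (restrict (\<sigma> \<circ> ?t) F v)) = (\<Prod>v\<in>F. a (f v) (\<sigma> v))" .
  qed
qed

section \<open>Isolating marked out-branchings by coefficient windows\<close>

definition window :: "nat \<Rightarrow> nat \<Rightarrow> bit poly \<Rightarrow> bit poly" where
  "window D b p = (\<Sum>i<D. monom (coeff p (b + i)) i)"

lemma coeff_window: "coeff (window D b p) i = (if i < D then coeff p (b + i) else 0)"
  by (simp add: window_def coeff_sum sum.delta)

lemma window_sum: "window D b (\<Sum>x\<in>A. g x) = (\<Sum>x\<in>A. window D b (g x))"
  by (rule poly_eqI) (simp add: coeff_window coeff_sum)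

text \<open>A polynomial of degree below \<open>D\<close> fits into one block of \<open>D\<close>
  coefficients, and different blocks do not overlap.\<close>

lemma window_monom_mult:
  assumes "degree g < D"
  shows "window D (D * c) (monom 1 (D * c') * g) = (if c = c' then g else 0)"
proof (rule poly_eqI)
  fix i
  have g: "coeff g j = 0" if "j \<ge> D" for j using assms that by (intro coeff_eq_0) simp
  show "coeff (window D (D * c) (monom 1 (D * c') * g)) i = coeff (if c = c' then g else 0) i"
  proof (cases "c = c'")
    case False
    have "coeff (monom 1 (D * c') * g) (D * c + i) = 0" if "i < D"
    proof (cases "D * c + i < D * c'")
      case ge: False
      have "c' < c"
      proof (rule ccontr)
        assume "\<not> c' < c"
        then have "Suc c \<le> c'" using False by simp
        then have "D * Suc c \<le> D * c'" by (rule mult_le_mono2)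
        then show False using that ge by simp
      qed
      then have "D * Suc c' \<le> D * c" by (intro mult_le_mono2) simp
      then show ?thesis using ge by (simp add: coeff_monom_mult g)
    qed (simp add: coeff_monom_mult)
    then show ?thesis using False by (simp add: coeff_window)
  qed (simp add: coeff_window coeff_monom_mult g)
qed

text \<open>The case \<open>u = n\<close> is the virtual root, with the weight that
  \<open>forest_expansion\<close> demands. The parameter \<open>y u\<close> will be the sum of the
  label variables of the tail \<open>u\<close>.\<close>

definition arc_weight :: "(nat \<times> nat) set \<Rightarrow> nat \<Rightarrow> nat \<Rightarrow> (nat \<Rightarrow> nat \<Rightarrow> bit poly) \<Rightarrow>
    (nat \<Rightarrow> nat \<Rightarrow> bit poly) \<Rightarrow> (nat \<Rightarrow> bit poly) \<Rightarrow> nat \<Rightarrow> nat \<Rightarrow> bit poly" where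
  "arc_weight Ar D n z w y u v = (if u = n then 1 else if (u, v) \<in> Ar
     then monom 1 D * z u v + monom 1 (D * n) * (w u v * y u) else 0)"

definition nonroots :: "nat \<Rightarrow> (nat \<Rightarrow> nat) \<Rightarrow> nat set" where
  "nonroots n f = {v. v < n \<and> f v < n}"

text \<open>Having \<open>n - 1\<close> vertices with a real parent leaves, for positive
  \<open>n\<close>, exactly one root.\<close>

definition parent_trees :: "nat \<Rightarrow> (nat \<times> nat) set \<Rightarrow> (nat \<Rightarrow> nat) set" where
  "parent_trees n Ar = {f \<in> {..<n} \<rightarrow>\<^sub>E {..n}. rooted n f \<and>
     (\<forall>v\<in>nonroots n f. (f v, v) \<in> Ar) \<and> card (nonroots n f) = n - 1}"

text \<open>
  Marked vertices represent the arcs from their parents.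
\<close>

definition marked_trees :: "nat \<Rightarrow> (nat \<times> nat) set \<Rightarrow> nat \<Rightarrow> ((nat \<Rightarrow> nat) \<times> nat set \<times> (nat \<Rightarrow> nat)) set" where
  "marked_trees n Ar k = (SIGMA f:parent_trees n Ar. SIGMA F:{F. F \<subseteq> nonroots n f \<and> card F = k \<and> inj_on f F}.
     {\<sigma> \<in> F \<rightarrow>\<^sub>E {..<k}. bij_betw \<sigma> F {..<k}})"

lemma finite_nonroots [simp]: "finite (nonroots n f)"
  by (simp add: nonroots_def)

text \<open>If no vertex were a root, iterating \<open>f\<close> from 0 would stay below
  \<open>n\<close> forever.\<close>

lemma rooted_card_nonroots:
  assumes "rooted n f" "0 < n"
  shows "card (nonroots n f) < n"
proof -
  have "nonroots n f \<subset> {..<n}"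
  proof (rule psubsetI)
    show "nonroots n f \<noteq> {..<n}"
    proof
      assume *: "nonroots n f = {..<n}"
      have "(f ^^ j) 0 < n" for j
      proof (induction j)
        case (Suc j)
        then have "(f ^^ j) 0 \<in> nonroots n f" using * by simp
        then show ?case by (simp add: nonroots_def)
      qed (use assms in simp)
      moreover from assms obtain j where "(f ^^ j) 0 = n" by (auto simp: rooted_def)
      ultimately show False by (metis nat_neq_iff)
    qed
  qed (auto simp: nonroots_def)
  then have "card (nonroots n f) < card {..<n}" by (intro psubset_card_mono) auto
  then show ?thesis by simp
qed

text \<open>Roots contribute the factor 1. In the expansion of the remaining binomials,
  \<open>F\<close> collects the vertices whose arc contributes its marked term.\<close>

lemma prod_arc_weight:
  assumes f: "f \<in> {..<n} \<rightarrow>\<^sub>E {..n}"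
  shows "(\<Prod>v<n. arc_weight Ar D n z w y (f v) v) =
    (if \<forall>v\<in>nonroots n f. (f v, v) \<in> Ar then
      (\<Sum>F\<in>Pow (nonroots n f). monom 1 (D * (n * card F + card (nonroots n f - F))) *
        ((\<Prod>v\<in>nonroots n f - F. z (f v) v) * (\<Prod>v\<in>F. w (f v) v) * (\<Prod>v\<in>F. y (f v)))) else 0)"
proof -
  let ?N = "nonroots n f"
  have "f v \<le> n" if "v < n" for v using f that by (auto simp: PiE_iff)
  then have "f v = n" if "v \<in> {..<n} - ?N" for v using that by (fastforce simp: nonroots_def)
  then have "(\<Prod>v<n. arc_weight Ar D n z w y (f v) v) = (\<Prod>v\<in>?N. arc_weight Ar D n z w y (f v) v)"
    by (intro prod.mono_neutral_right) (auto simp: nonroots_def arc_weight_def)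
  also have "\<dots> = (if \<forall>v\<in>?N. (f v, v) \<in> Ar then
      (\<Prod>v\<in>?N. monom 1 (D * n) * (w (f v) v * y (f v)) + monom 1 D * z (f v) v) else 0)"
  proof (cases "\<forall>v\<in>?N. (f v, v) \<in> Ar")
    case True
    then show ?thesis
      by (auto intro!: prod.cong simp: arc_weight_def nonroots_def add.commute)
  next
    case False
    then obtain v where "v \<in> ?N" "(f v, v) \<notin> Ar" by auto
    then have "arc_weight Ar D n z w y (f v) v = 0" by (auto simp: arc_weight_def nonroots_def)
    with \<open>v \<in> ?N\<close> False show ?thesis by (subst prod_zero) auto
  qed
  also have "(\<Prod>v\<in>?N. monom 1 (D * n) * (w (f v) v * y (f v)) + monom 1 D * z (f v) v) =
     (\<Sum>F\<in>Pow ?N. (\<Prod>v\<in>F. monom 1 (D * n) * (w (f v) v * y (f v))) * (\<Prod>v\<in>?N - F. monom 1 D * z (f v) v))"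
    by (rule prod_add) simp
  also have "\<dots> = (\<Sum>F\<in>Pow ?N. monom 1 (D * (n * card F + card (?N - F))) *
        ((\<Prod>v\<in>?N - F. z (f v) v) * (\<Prod>v\<in>F. w (f v) v) * (\<Prod>v\<in>F. y (f v))))"
  proof (rule sum.cong[OF refl])
    fix F
    have m: "(monom 1 (D * (n * card F + card (?N - F))) :: bit poly) = monom 1 (D * n) ^ card F * monom 1 D ^ card (?N - F)"
      by (simp add: monom_power mult_monom algebra_simps)
    show "(\<Prod>v\<in>F. monom 1 (D * n) * (w (f v) v * y (f v))) * (\<Prod>v\<in>?N - F. monom 1 D * z (f v) v) =
       monom 1 (D * (n * card F + card (?N - F))) *
        ((\<Prod>v\<in>?N - F. z (f v) v) * (\<Prod>v\<in>F. w (f v) v) * (\<Prod>v\<in>F. y (f v)))"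
      unfolding m by (simp add: prod.distrib mult_ac)
  qed
  finally show ?thesis .
qed

definition sieve_poly :: "(nat \<times> nat) set \<Rightarrow> nat \<Rightarrow> nat \<Rightarrow> nat \<Rightarrow> (nat \<Rightarrow> nat \<Rightarrow> bit poly) \<Rightarrow>
    (nat \<Rightarrow> nat \<Rightarrow> bit poly) \<Rightarrow> (nat \<Rightarrow> nat \<Rightarrow> bit poly) \<Rightarrow> bit poly" where
  "sieve_poly Ar D n k z w a = (\<Sum>S\<in>Pow {..<k}. \<Sum>f | f \<in> {..<n} \<rightarrow>\<^sub>E {..n} \<and> rooted n f.
     \<Prod>v<n. arc_weight Ar D n z w (\<lambda>u. \<Sum>j\<in>S. a u j) (f v) v)"

lemma degree_prod_le_card:
  assumes "\<And>x. x \<in> A \<Longrightarrow> degree (p x) \<le> d"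
  shows "degree (\<Prod>x\<in>A. p x :: bit poly) \<le> card A * d"
proof (cases "finite A")
  case True
  have "degree (\<Prod>x\<in>A. p x) \<le> (\<Sum>x\<in>A. degree (p x))"
    using degree_prod_sum_le[OF True, of p] by (simp add: o_def)
  also have "\<dots> \<le> card A * d" using sum_bounded_above[of A "\<lambda>x. degree (p x)" d] assms by simp
  finally show ?thesis .
qed simp

text \<open>The window sits at the exponent of \<open>k\<close> marked and \<open>n - 1 - k\<close>
  unmarked arcs, and it is linear, so it can be pushed through all sums. For a fixed tree and a
  fixed marked set, the sum over \<open>S\<close> is then the sieve, which leaves bijective
  labellings of arcs with distinct tails.\<close>

lemma window_sieve_poly:
  assumes k: "k < n" and d: "2 * d * n < D"
    and deg: "\<And>u v. degree (z u v) \<le> d" "\<And>u v. degree (w u v) \<le> d" "\<And>u j. degree (a u j) \<le> d"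
  shows "window D (D * (n * k + (n - 1 - k))) (sieve_poly Ar D n k z w a) =
    (\<Sum>(f, F, \<sigma>)\<in>marked_trees n Ar k.
      (\<Prod>v\<in>nonroots n f - F. z (f v) v) * (\<Prod>v\<in>F. w (f v) v) * (\<Prod>v\<in>F. a (f v) (\<sigma> v)))"
proof -
  let ?U = "{f. f \<in> {..<n} \<rightarrow>\<^sub>E {..n} \<and> rooted n f}"
  have finU: "finite ?U" by (rule finite_subset[of _ "{..<n} \<rightarrow>\<^sub>E {..n}"]) (auto intro: finite_PiE)
  let ?y = "\<lambda>S u. \<Sum>j\<in>S. a u j"
  let ?m = "\<lambda>S f F. (\<Prod>v\<in>nonroots n f - F. z (f v) v) * (\<Prod>v\<in>F. w (f v) v) * (\<Prod>v\<in>F. ?y S (f v))"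
  let ?win = "window D (D * (n * k + (n - 1 - k)))"
  have win: "?win (\<Prod>v<n. arc_weight Ar D n z w (?y S) (f v) v) =
      (if f \<in> parent_trees n Ar then \<Sum>F | F \<subseteq> nonroots n f \<and> card F = k. ?m S f F else 0)"
    if f: "f \<in> ?U" and S: "S \<in> Pow {..<k}" for f S
  proof (cases "\<forall>v\<in>nonroots n f. (f v, v) \<in> Ar")
    case True
    let ?N = "nonroots n f"
    have N: "card ?N < n" using f k by (intro rooted_card_nonroots) auto
    have "?win (\<Prod>v<n. arc_weight Ar D n z w (?y S) (f v) v) =
      (\<Sum>F\<in>Pow ?N. ?win (monom 1 (D * (n * card F + card (?N - F))) * ?m S f F))"
      using f True by (subst prod_arc_weight) (auto simp: window_sum)
    also have "\<dots> = (\<Sum>F\<in>Pow ?N. if card ?N = n - 1 \<and> card F = k then ?m S f F else 0)"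
    proof (rule sum.cong[OF refl])
      fix F assume "F \<in> Pow ?N"
      then have F: "F \<subseteq> ?N" by simp
      then have cF: "card F + card (?N - F) = card ?N"
        by (metis card_Diff_subset card_mono finite_nonroots finite_subset le_add_diff_inverse)
      have "degree (?y S u) \<le> d" for u using deg(3) by (intro degree_sum_le) (use S finite_subset[of S "{..<k}"] in auto)
      \<comment> \<open>A marked arc contributes two factors, \<open>w\<close> and the label sum,
        hence twice \<open>d\<close> per arc in the worst case.\<close>
      then have "degree (?m S f F) \<le> card (?N - F) * d + card F * d + card F * d"
        by (intro order.trans[OF degree_mult_le] add_mono degree_prod_le_card deg)
      also have "\<dots> \<le> (card F + card (?N - F)) * d + (card F + card (?N - F)) * d"
        by (simp add: algebra_simps)
      also have "\<dots> = 2 * d * card ?N" unfolding cF by simp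
      also have "\<dots> < D" using N d by (meson le_less_trans less_imp_le_nat mult_le_mono2)
      finally have dm: "degree (?m S f F) < D" .
      have "n * k + (n - 1 - k) = n * card F + card (?N - F) \<longleftrightarrow> card ?N = n - 1 \<and> card F = k"
      proof
        assume *: "n * k + (n - 1 - k) = n * card F + card (?N - F)"
        \<comment> \<open>Both low digits are below \<open>n\<close>, so division by
          \<open>n\<close> recovers the number of marked arcs; the number of unmarked ones
          follows.\<close>
        have q: "(n * c + r) div n = c" if "r < n" for c r using that by simp
        have "k = card F"
          using q[of "n - 1 - k" k] q[of "card (?N - F)" "card F"] k N cF unfolding * by linarith
        with * cF k show "card ?N = n - 1 \<and> card F = k" by simp
      qed (use cF k in auto)
      then show "?win (monom 1 (D * (n * card F + card (?N - F))) * ?m S f F) =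
          (if card ?N = n - 1 \<and> card F = k then ?m S f F else 0)"
        by (simp add: window_monom_mult[OF dm])
    qed
    also have "\<dots> = (if f \<in> parent_trees n Ar then \<Sum>F\<in>Pow ?N. if card F = k then ?m S f F else 0 else 0)"
      using True f by (auto simp: parent_trees_def intro!: sum.neutral)
    also have "(\<Sum>F\<in>Pow ?N. if card F = k then ?m S f F else 0) = (\<Sum>F | F \<subseteq> ?N \<and> card F = k. ?m S f F)"
      by (subst sum.inter_filter[symmetric]) (auto intro!: sum.cong)
    finally show ?thesis .
  next
    case False
    then have "f \<notin> parent_trees n Ar" by (auto simp: parent_trees_def)
    with False f show ?thesis by (subst prod_arc_weight) (auto simp: window_def)
  qed
  have "?win (sieve_poly Ar D n k z w a) =
      (\<Sum>S\<in>Pow {..<k}. \<Sum>f\<in>?U. if f \<in> parent_trees n Ar then \<Sum>F | F \<subseteq> nonroots n f \<and> card F = k. ?m S f F else 0)"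
    unfolding sieve_poly_def window_sum by (intro sum.cong refl win) auto
  also have "\<dots> = (\<Sum>S\<in>Pow {..<k}. \<Sum>f\<in>parent_trees n Ar. \<Sum>F | F \<subseteq> nonroots n f \<and> card F = k. ?m S f F)"
  proof (rule sum.cong[OF refl])
    fix S
    have "{f \<in> ?U. f \<in> parent_trees n Ar} = parent_trees n Ar" by (auto simp: parent_trees_def)
    then show "(\<Sum>f\<in>?U. if f \<in> parent_trees n Ar then \<Sum>F | F \<subseteq> nonroots n f \<and> card F = k. ?m S f F else 0) =
      (\<Sum>f\<in>parent_trees n Ar. \<Sum>F | F \<subseteq> nonroots n f \<and> card F = k. ?m S f F)"
      by (subst sum.inter_filter[OF finU, symmetric]) simp
  qed
  \<comment> \<open>The sum over \<open>S\<close> moves inwards, where tree and marked set are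
    fixed.\<close>
  also have "\<dots> = (\<Sum>f\<in>parent_trees n Ar. \<Sum>S\<in>Pow {..<k}. \<Sum>F | F \<subseteq> nonroots n f \<and> card F = k. ?m S f F)"
    by (rule sum.swap)
  also have "\<dots> = (\<Sum>f\<in>parent_trees n Ar. \<Sum>F | F \<subseteq> nonroots n f \<and> card F = k. \<Sum>S\<in>Pow {..<k}. ?m S f F)"
    by (rule sum.cong[OF refl]) (rule sum.swap)
  also have "\<dots> = (\<Sum>f\<in>parent_trees n Ar. \<Sum>F | F \<subseteq> nonroots n f \<and> card F = k.
      if inj_on f F then \<Sum>\<sigma> | \<sigma> \<in> F \<rightarrow>\<^sub>E {..<k} \<and> bij_betw \<sigma> F {..<k}.
        (\<Prod>v\<in>nonroots n f - F. z (f v) v) * (\<Prod>v\<in>F. w (f v) v) * (\<Prod>v\<in>F. a (f v) (\<sigma> v)) else 0)"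
  proof (intro sum.cong refl)
    fix f F assume "F \<in> {F. F \<subseteq> nonroots n f \<and> card F = k}"
    then have F: "finite F" "card F = k" using finite_subset[OF _ finite_nonroots] by auto
    show "(\<Sum>S\<in>Pow {..<k}. ?m S f F) = (if inj_on f F then \<Sum>\<sigma> | \<sigma> \<in> F \<rightarrow>\<^sub>E {..<k} \<and> bij_betw \<sigma> F {..<k}.
        (\<Prod>v\<in>nonroots n f - F. z (f v) v) * (\<Prod>v\<in>F. w (f v) v) * (\<Prod>v\<in>F. a (f v) (\<sigma> v)) else 0)"
      using sieve_bijections[OF F, of a f] sum_bijections_eq_0[OF F(1), of f a k]
      by (simp flip: sum_distrib_left)
  qed
  also have "\<dots> = (\<Sum>f\<in>parent_trees n Ar. \<Sum>F\<in>{F. F \<subseteq> nonroots n f \<and> card F = k \<and> inj_on f F}.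
      \<Sum>\<sigma> | \<sigma> \<in> F \<rightarrow>\<^sub>E {..<k} \<and> bij_betw \<sigma> F {..<k}.
        (\<Prod>v\<in>nonroots n f - F. z (f v) v) * (\<Prod>v\<in>F. w (f v) v) * (\<Prod>v\<in>F. a (f v) (\<sigma> v)))"
    by (rule sum.cong[OF refl], rule sum_if_filter)
      (auto intro: finite_subset[of _ "Pow (nonroots n _)"])
  also have "\<dots> = (\<Sum>(f, F, \<sigma>)\<in>marked_trees n Ar k.
      (\<Prod>v\<in>nonroots n f - F. z (f v) v) * (\<Prod>v\<in>F. w (f v) v) * (\<Prod>v\<in>F. a (f v) (\<sigma> v)))"
  proof -
    have "finite (parent_trees n Ar)" using finU by (rule rev_finite_subset) (auto simp: parent_trees_def)
    moreover have "finite {F. F \<subseteq> nonroots n f \<and> card F = k \<and> inj_on f F}" for f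
      by (rule finite_subset[of _ "Pow (nonroots n f)"]) auto
    moreover have "finite {\<sigma> \<in> F \<rightarrow>\<^sub>E {..<k}. bij_betw \<sigma> F {..<k}}" if "F \<subseteq> nonroots n f" for F f
      by (rule finite_subset[of _ "F \<rightarrow>\<^sub>E {..<k}"]) (use finite_subset[OF that] in \<open>auto intro: finite_PiE\<close>)
    ultimately show ?thesis unfolding marked_trees_def
      by (intro sum_Sigma3) auto
  qed
  finally show ?thesis .
qed

text \<open>
  Positions of the random values $z_{uv}$ ($c = 0$), $w_{uv}$ ($c = 1$) and $a_{uv}$ ($c = 2$) in one array.
\<close>

definition idx :: "nat \<Rightarrow> nat \<Rightarrow> nat \<Rightarrow> nat \<Rightarrow> nat" where
  "idx n c u v = c * (n * n) + u * n + v"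

text \<open>In Horner form the index is \<open>(c * n + u) * n + v\<close>, with digits
  \<open>u\<close> and \<open>v\<close> in base \<open>n\<close> below a leading part
  \<open>c\<close>.\<close>

lemma idx_eq_iff:
  assumes "u < n" "v < n" "u' < n" "v' < n"
  shows "idx n c u v = idx n c' u' v' \<longleftrightarrow> c = c' \<and> u = u' \<and> v = v'"
proof
  assume eq: "idx n c u v = idx n c' u' v'"
  have i: "idx n c u v = (c * n + u) * n + v" for c u v by (simp add: idx_def algebra_simps)
  have cu: "(c * n + u) = (c' * n + u')" and v: "v = v'"
    using arg_cong[OF eq, of "\<lambda>x. x div n"] arg_cong[OF eq, of "\<lambda>x. x mod n"] assms by (simp_all add: i)
  have "c = c'" "u = u'"
    using arg_cong[OF cu, of "\<lambda>x. x div n"] arg_cong[OF cu, of "\<lambda>x. x mod n"] assms by simp_all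
  with v show "c = c' \<and> u = u' \<and> v = v'" by simp
qed simp

lemma idx_less:
  assumes "u < n" "v < n" "c < C"
  shows "idx n c u v < C * (n * n)"
proof -
  have "u * n + v < Suc u * n" using assms by simp
  also have "\<dots> \<le> n * n" using assms by (intro mult_le_mono) auto
  finally have "idx n c u v < Suc c * (n * n)" by (simp add: idx_def)
  also have "\<dots> \<le> C * (n * n)" using assms by (intro mult_le_mono) auto
  finally show ?thesis .
qed

section \<open>The surviving monomials are distinct\<close>

text \<open>The monomials are multilinear, so a set of variable positions describes each of
  them.\<close>

definition mono_of :: "nat \<Rightarrow> (nat \<Rightarrow> nat) \<times> nat set \<times> (nat \<Rightarrow> nat) \<Rightarrow> nat set" where
  "mono_of n = (\<lambda>(f, F, \<sigma>). (\<lambda>v. idx n 0 (f v) v) ` (nonroots n f - F) \<union>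
     (\<lambda>v. idx n 1 (f v) v) ` F \<union> (\<lambda>v. idx n 2 (f v) (\<sigma> v)) ` F)"

lemma marked_treesD:
  assumes "(f, F, \<sigma>) \<in> marked_trees n Ar k"
  shows "f \<in> parent_trees n Ar" "F \<subseteq> nonroots n f" "card F = k" "inj_on f F" "finite F"
    "\<sigma> \<in> F \<rightarrow>\<^sub>E {..<k}" "bij_betw \<sigma> F {..<k}"
  using assms finite_subset[of F "nonroots n f"] by (auto simp: marked_trees_def)

lemma mem_mono_of:
  assumes t: "(f, F, \<sigma>) \<in> marked_trees n Ar k" and "k \<le> n" and u: "u < n" "v < n"
  shows "idx n 0 u v \<in> mono_of n (f, F, \<sigma>) \<longleftrightarrow> v \<in> nonroots n f - F \<and> f v = u"
    "idx n 1 u v \<in> mono_of n (f, F, \<sigma>) \<longleftrightarrow> v \<in> F \<and> f v = u"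
    "idx n 2 u v \<in> mono_of n (f, F, \<sigma>) \<longleftrightarrow> (\<exists>x\<in>F. f x = u \<and> \<sigma> x = v)"
proof -
  note T = marked_treesD[OF t]
  have N: "x < n \<and> f x < n" if "x \<in> nonroots n f" for x using that by (simp add: nonroots_def)
  have s: "\<sigma> x < n" if "x \<in> F" for x using that T(6) \<open>k \<le> n\<close> by (fastforce simp: PiE_iff)
  show "idx n 0 u v \<in> mono_of n (f, F, \<sigma>) \<longleftrightarrow> v \<in> nonroots n f - F \<and> f v = u"
    "idx n 1 u v \<in> mono_of n (f, F, \<sigma>) \<longleftrightarrow> v \<in> F \<and> f v = u"
    "idx n 2 u v \<in> mono_of n (f, F, \<sigma>) \<longleftrightarrow> (\<exists>x\<in>F. f x = u \<and> \<sigma> x = v)"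
    using T(2) N s u by (auto simp: mono_of_def image_iff idx_eq_iff subset_iff)
qed

text \<open>The \<open>w\<close>-variables show \<open>F\<close> and the parents on
  \<open>F\<close>, the \<open>z\<close>-variables the other non-roots with their parents, and
  whatever remains has parent \<open>n\<close>. The label variables show pairs of tail and label,
  from which \<open>\<sigma>\<close> is recovered.\<close>

lemma inj_on_mono_of:
  assumes "k \<le> n"
  shows "inj_on (mono_of n) (marked_trees n Ar k)"
proof (rule inj_onI)
  fix t t' assume t: "t \<in> marked_trees n Ar k" "t' \<in> marked_trees n Ar k" and eq: "mono_of n t = mono_of n t'"
  obtain f F \<sigma> f' F' \<sigma>' where tt: "t = (f, F, \<sigma>)" "t' = (f', F', \<sigma>')" by (metis prod_cases3)
  note m = mem_mono_of[OF t(1)[unfolded tt] assms]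
  note m' = mem_mono_of[OF t(2)[unfolded tt] assms, folded eq[unfolded tt]]
  note T = marked_treesD[OF t(1)[unfolded tt]]
  note T' = marked_treesD[OF t(2)[unfolded tt]]
  have e0: "v \<in> nonroots n f - F \<and> f v = u \<longleftrightarrow> v \<in> nonroots n f' - F' \<and> f' v = u" if "u < n" "v < n" for u v
    using m(1)[OF that] m'(1)[OF that] by simp
  have e1: "v \<in> F \<and> f v = u \<longleftrightarrow> v \<in> F' \<and> f' v = u" if "u < n" "v < n" for u v
    using m(2)[OF that] m'(2)[OF that] by simp
  have e2: "(\<exists>x\<in>F. f x = u \<and> \<sigma> x = v) \<longleftrightarrow> (\<exists>x\<in>F'. f' x = u \<and> \<sigma>' x = v)" if "u < n" "v < n" for u v
    using m(3)[OF that] m'(3)[OF that] by simp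
  have FF: "F = F'"
  proof (intro equalityI subsetI)
    fix v assume "v \<in> F"
    then show "v \<in> F'" using e1[of "f v" v] T(2) by (auto simp: nonroots_def)
  next
    fix v assume "v \<in> F'"
    then show "v \<in> F" using e1[of "f' v" v] T'(2) by (auto simp: nonroots_def)
  qed
  have ff: "f v = f' v" if "v \<in> nonroots n f \<union> nonroots n f'" for v
    using that e0[of "f v" v] e0[of "f' v" v] e1[of "f v" v] e1[of "f' v" v]
    by (auto simp: nonroots_def FF)
  have "f v = f' v" for v
  proof (cases "v \<in> nonroots n f \<union> nonroots n f'")
    case False
    show ?thesis
    proof (cases "v < n")
      case True
      then have "f v \<le> n" "f' v \<le> n" using T(1) T'(1) by (auto simp: parent_trees_def PiE_iff)
      with False True show ?thesis by (auto simp: nonroots_def)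
    next
      case False
      then show ?thesis using T(1) T'(1) by (auto simp: parent_trees_def PiE_iff extensional_def)
    qed
  qed (rule ff)
  then have f: "f = f'" by auto
  have "\<sigma> v = \<sigma>' v" for v
  proof (cases "v \<in> F")
    case True
    then have v: "v < n" "f v < n" using T(2) by (auto simp: nonroots_def)
    have "\<sigma> v < n" using True T(6) assms by (fastforce simp: PiE_iff)
    then obtain x where "x \<in> F'" "f' x = f v" "\<sigma>' x = \<sigma> v" using e2[of "f v" "\<sigma> v"] True v by auto
    \<comment> \<open>A label variable shows only the tail of its arc; as marked arcs have distinct
      tails, this identifies the arc.\<close>
    moreover from this have "x = v" using inj_onD[OF T(4), of x v] True FF f by simp
    ultimately show ?thesis by simp
  next
    case False
    then show ?thesis using T(6) T'(6) FF by (auto simp: PiE_iff extensional_def)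
  qed
  then show "t = t'" using tt f FF by auto
qed

lemma mono_of_subset:
  assumes "t \<in> marked_trees n Ar k" "k \<le> n"
  shows "mono_of n t \<subseteq> {..<3 * (n * n)}"
proof -
  obtain f F \<sigma> where t: "t = (f, F, \<sigma>)" by (metis prod_cases3)
  note T = marked_treesD[OF assms(1)[unfolded t]]
  have "\<sigma> x < n" if "x \<in> F" for x using that T(6) assms(2) by (fastforce simp: PiE_iff)
  then show ?thesis using T(2)
    by (auto simp: t mono_of_def nonroots_def subset_iff intro!: idx_less)
qed

text \<open>The reindexing is injective: no two terms give the same monomial, so none cancel in
  characteristic 2.\<close>

lemma sum_marked_trees:
  fixes \<rho> :: "nat \<Rightarrow> bit poly"
  assumes k: "k \<le> n"
  shows "(\<Sum>(f, F, \<sigma>)\<in>marked_trees n Ar k. (\<Prod>v\<in>nonroots n f - F. \<rho> (idx n 0 (f v) v)) *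
      (\<Prod>v\<in>F. \<rho> (idx n 1 (f v) v)) * (\<Prod>v\<in>F. \<rho> (idx n 2 (f v) (\<sigma> v)))) =
    (\<Sum>S\<in>mono_of n ` marked_trees n Ar k. \<Prod>i\<in>S. \<rho> i)"
proof -
  have "(\<Prod>v\<in>nonroots n f - F. \<rho> (idx n 0 (f v) v)) *
      (\<Prod>v\<in>F. \<rho> (idx n 1 (f v) v)) * (\<Prod>v\<in>F. \<rho> (idx n 2 (f v) (\<sigma> v))) = (\<Prod>i\<in>mono_of n (f, F, \<sigma>). \<rho> i)"
    if t: "(f, F, \<sigma>) \<in> marked_trees n Ar k" for f F \<sigma>
  proof -
    note T = marked_treesD[OF t]
    have N: "x < n \<and> f x < n" if "x \<in> nonroots n f" for x using that by (simp add: nonroots_def)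
    have FN: "x < n \<and> f x < n" if "x \<in> F" for x using that T(2) N by auto
    have s: "\<sigma> x < n" if "x \<in> F" for x using that T(6) k by (fastforce simp: PiE_iff)
    have i0: "inj_on (\<lambda>v. idx n 0 (f v) v) (nonroots n f - F)"
      and i1: "inj_on (\<lambda>v. idx n 1 (f v) v) F"
      and i2: "inj_on (\<lambda>v. idx n 2 (f v) (\<sigma> v)) F"
      using N FN s T(4) by (auto intro!: inj_onI simp: idx_eq_iff dest: inj_onD)
    have "(\<Prod>i\<in>mono_of n (f, F, \<sigma>). \<rho> i) =
       (\<Prod>i\<in>(\<lambda>v. idx n 0 (f v) v) ` (nonroots n f - F). \<rho> i) *
       (\<Prod>i\<in>(\<lambda>v. idx n 1 (f v) v) ` F. \<rho> i) * (\<Prod>i\<in>(\<lambda>v. idx n 2 (f v) (\<sigma> v)) ` F. \<rho> i)"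
      unfolding mono_of_def prod.case using T(5) N FN s
      by (subst prod.union_disjoint; (subst prod.union_disjoint)?) (auto simp: idx_eq_iff)
    then show ?thesis by (simp only: prod.reindex[OF i0] prod.reindex[OF i1] prod.reindex[OF i2] o_def)
  qed
  note eq = this
  show ?thesis unfolding sum.reindex[OF inj_on_mono_of[OF k]] o_def
  proof (rule sum.cong[OF refl])
    fix t assume t: "t \<in> marked_trees n Ar k"
    obtain f F \<sigma> where tt: "t = (f, F, \<sigma>)" by (metis prod_cases3)
    show "(case t of (f, F, \<sigma>) \<Rightarrow> (\<Prod>v\<in>nonroots n f - F. \<rho> (idx n 0 (f v) v)) *
      (\<Prod>v\<in>F. \<rho> (idx n 1 (f v) v)) * (\<Prod>v\<in>F. \<rho> (idx n 2 (f v) (\<sigma> v)))) = (\<Prod>i\<in>mono_of n t. \<rho> i)"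
      using eq[OF t[unfolded tt]] unfolding tt prod.case .
  qed
qed


section \<open>Out-branchings as parent functions\<close>

lemma parent_treesD:
  assumes "f \<in> parent_trees n Ar"
  shows "\<And>v. v < n \<Longrightarrow> f v \<le> n" "rooted n f" "\<And>v. v \<in> nonroots n f \<Longrightarrow> (f v, v) \<in> Ar"
    "card (nonroots n f) = n - 1"
  using assms by (auto simp: parent_trees_def PiE_iff)

text \<open>The arcs from parents to children form the branching. Walking up from any vertex ends at
  the only root, which connects all vertices through it; the internal vertices are the values of
  \<open>f\<close> on the non-roots.\<close>

lemma parent_tree_imp_has_internal:
  assumes G: "pair_digraph G" "pverts G = {..<n}" and n: "0 < n"
    and f: "f \<in> parent_trees n (parcs G)" and k: "k \<le> card (f ` nonroots n f)"
  shows "has_internal_out_branching (with_proj G) k"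
proof -
  interpret pair_digraph G by (rule G)
  let ?N = "nonroots n f"
  note F = parent_treesD[OF f]
  let ?A = "(\<lambda>v. (f v, v)) ` ?N"
  define H where "H = \<lparr>pverts = {..<n}, parcs = ?A\<rparr>"
  let ?T = "with_proj H"
  have N: "v < n" "f v < n" if "v \<in> ?N" for v using that by (simp_all add: nonroots_def)
  have T: "pverts H = {..<n}" "parcs H = ?A" by (simp_all add: H_def)
  have wf: "wf_digraph ?T" by unfold_locales (auto simp: H_def N)
  have "spanning ?T (with_proj G)" unfolding spanning_def subgraph_def compatible_def
    using F(3) wf G(2) by (auto simp: T wf_digraph_axioms)
  moreover have "card ({..<n} - ?N) = 1"
    using F(4) n by (subst card_Diff_subset) (auto simp: nonroots_def)
  then obtain r where r: "{..<n} - ?N = {r}" by (rule card_1_singletonE)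
  then have rn: "r < n" "r \<notin> ?N" by auto
  have nr: "v \<in> ?N" if "v < n" "v \<noteq> r" for v using r that by blast
  have "in_arcs ?T v = (if v \<in> ?N then {(f v, v)} else {})" for v
    by (auto simp: in_arcs_def T)
  then have deg: "in_degree ?T v = (if v \<in> ?N then 1 else 0)" for v by (simp add: in_degree_def)
  have "out_branching ?T"
    unfolding out_branching_def Digraph_Component.connected_def strongly_connected_def
  proof (intro conjI ballI)
    interpret S: pair_wf_digraph "mk_symmetric ?T" by (rule wf_digraph.wellformed_mk_symmetric[OF wf])
    let ?S = "with_proj (mk_symmetric ?T)"
    have vS: "verts ?S = {..<n}" by (simp add: T)
    then show "verts ?S \<noteq> {}" using n by auto
    have e: "(f v, v) \<in> parcs (mk_symmetric ?T)" "(v, f v) \<in> parcs (mk_symmetric ?T)" if "v \<in> ?N" for v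
      using that by (auto simp: mk_symmetric_def T)
    \<comment> \<open>Induction on the number of parent steps to the virtual root; the last real
      vertex on the way is \<open>r\<close>.\<close>
    have reach: "v \<rightarrow>\<^sup>*\<^bsub>?S\<^esub> r \<and> r \<rightarrow>\<^sup>*\<^bsub>?S\<^esub> v" if "(f ^^ j) v = n" "v < n" for j v
      using that
    proof (induction j arbitrary: v)
      case (Suc j)
      show ?case
      proof (cases "v = r")
        case False
        then have v: "v \<in> ?N" using nr Suc.prems by simp
        have "(f ^^ j) (f v) = n" using Suc.prems(1) by (simp add: funpow_swap1)
        note h = Suc.IH[OF this N(2)[OF v]]
        show ?thesis
          by (rule conjI[OF S.adj_reachable_trans[OF e(2)[OF v] conjunct1[OF h]]
            S.reachable_adj_trans[OF conjunct2[OF h] e(1)[OF v]]])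
      qed (use rn vS in auto)
    qed simp
    fix u v assume "u \<in> verts ?S" "v \<in> verts ?S"
    then have "u < n" "v < n" using vS by auto
    moreover from this obtain i j where "(f ^^ i) u = n" "(f ^^ j) v = n"
      using F(2) unfolding rooted_def by blast
    ultimately show "u \<rightarrow>\<^sup>*\<^bsub>?S\<^esub> v"
      by (intro S.reachable_trans[OF conjunct1[OF reach] conjunct2[OF reach]])
  next
    show "\<exists>r\<in>verts ?T. in_degree ?T r = 0 \<and> (\<forall>v\<in>verts ?T - {r}. in_degree ?T v = 1)"
      using rn nr by (intro bexI[of _ r]) (auto simp: T deg)
  qed
  moreover have "internal_vertices ?T = f ` ?N"
  proof -
    have oa: "out_arcs ?T u = {(f v, v) | v. v \<in> ?N \<and> f v = u}" for u
      by (auto simp: out_arcs_def T)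
    have "finite (out_arcs ?T u)" for u by (rule finite_subset[of _ ?A]) (auto simp: oa)
    then have "out_degree ?T u \<ge> 1 \<longleftrightarrow> out_arcs ?T u \<noteq> {}" for u
      by (simp add: out_degree_def Suc_le_eq card_gt_0_iff)
    then show ?thesis using N by (auto simp: internal_vertices_def oa T)
  qed
  ultimately show ?thesis using k unfolding has_internal_out_branching_def by auto
qed

lemma has_internal_imp_parent_tree:
  assumes G: "pair_digraph G" "pverts G = {..<n}"
    and "has_internal_out_branching (with_proj G) k"
  obtains f where "0 < n" "f \<in> parent_trees n (parcs G)" "k \<le> card (f ` nonroots n f)"
proof -
  interpret pair_digraph G by (rule G)
  from assms(3) obtain T where sp: "spanning T (with_proj G)" and ob: "out_branching T"
    and k: "k \<le> card (internal_vertices T)" unfolding has_internal_out_branching_def by auto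
  have T: "verts T = {..<n}" "arcs T \<subseteq> parcs G" "tail T = fst" "head T = snd" "wf_digraph T"
    using sp G(2) by (auto simp: spanning_def subgraph_def compatible_def)
  interpret T: wf_digraph T by (rule T)
  have finT: "finite (arcs T)" using T(2) pair_finite_arcs by (rule finite_subset)
  from ob obtain r where r: "r < n" "in_degree T r = 0" "\<And>v. v < n \<Longrightarrow> v \<noteq> r \<Longrightarrow> in_degree T v = 1"
    and con: "strongly_connected (with_proj (mk_symmetric T))"
    unfolding out_branching_def Digraph_Component.connected_def T(1) by auto
  have ia: "in_arcs T v = {e \<in> arcs T. snd e = v}" for v by (simp add: in_arcs_def T)
  have "\<exists>u. in_arcs T v = {(u, v)}" if "v < n" "v \<noteq> r" for v
  proof -
    from r(3)[OF that] obtain e where e: "in_arcs T v = {e}" unfolding in_degree_def by (rule card_1_singletonE)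
    then have "snd e = v" using ia[of v] by auto
    then show ?thesis using e by (metis prod.collapse)
  qed
  then obtain p where p: "\<And>v. v < n \<Longrightarrow> v \<noteq> r \<Longrightarrow> in_arcs T v = {(p v, v)}" by metis
  \<comment> \<open>The real root becomes a child of the virtual root \<open>n\<close>;
    \<open>undefined\<close> elsewhere puts \<open>f\<close> into the extensional function
    space.\<close>
  define f where "f = (\<lambda>v. if v < n then if v = r then n else p v else undefined)"
  have pa: "(p v, v) \<in> arcs T" if "v < n" "v \<noteq> r" for v using p[OF that] ia[of v] by auto
  have pn: "p v < n" if "v < n" "v \<noteq> r" for v
    using T.tail_in_verts[OF pa[OF that]] T by auto
  have fN: "f v = p v" if "v < n" "v \<noteq> r" for v using that by (simp add: f_def)
  have N: "nonroots n f = {..<n} - {r}" using pn by (auto simp: nonroots_def f_def)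
  have arc: "snd e < n \<and> snd e \<noteq> r \<and> fst e = f (snd e)" if "e \<in> arcs T" for e
  proof -
    have s: "snd e < n" using T.head_in_verts[OF that] T by auto
    have e: "e \<in> in_arcs T (snd e)" using that ia by simp
    have "finite (in_arcs T r)" by (rule finite_subset[OF _ finT]) (simp add: ia)
    then have "in_arcs T r = {}" using r(2) by (simp add: in_degree_def)
    then have "snd e \<noteq> r" using e by (metis empty_iff)
    moreover from this s have "e = (p (snd e), snd e)" using p[of "snd e"] e by simp
    ultimately show ?thesis using s fN by (metis fst_conv)
  qed
  \<comment> \<open>Never reaching \<open>n\<close> is inherited along arcs in both directions,
    since the tail of each arc is the parent of its head. By connectedness it would carry over to
    \<open>r\<close>, whose parent is \<open>n\<close>.\<close>
  have "rooted n f"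
  proof (rule ccontr)
    assume "\<not> rooted n f"
    then obtain v where v: "v < n" "\<And>j. (f ^^ j) v \<noteq> n" by (auto simp: rooted_def)
    let ?S = "with_proj (mk_symmetric T)"
    interpret S: pair_wf_digraph "mk_symmetric T" by (rule T.wellformed_mk_symmetric)
    have "v \<rightarrow>\<^sup>*\<^bsub>?S\<^esub> r" using con v r T(1) by (auto simp: strongly_connected_def)
    then have "r < n \<and> (\<forall>j. (f ^^ j) r \<noteq> n)"
    proof (induction rule: S.reachable_induct)
      case (step x y)
      from step.hyps(2) obtain e where e: "e \<in> arcs T" "(x, y) = (fst e, snd e) \<or> (x, y) = (snd e, fst e)"
        by (auto simp: mk_symmetric_def T)
      note a = arc[OF e(1)]
      from e(2) show ?case
      proof
        assume xy: "(x, y) = (fst e, snd e)"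
        then have "x = f y" "y < n" using a by auto
        have "(f ^^ j) y \<noteq> n" for j
        proof (cases j)
          case (Suc i)
          then show ?thesis using step.IH \<open>x = f y\<close> by (simp add: funpow_swap1)
        qed (use \<open>y < n\<close> in simp)
        then show ?thesis using \<open>y < n\<close> by simp
      next
        assume xy: "(x, y) = (snd e, fst e)"
        then have y: "y = f x" using a by auto
        have "(f ^^ j) y \<noteq> n" for j
          using step.IH[THEN conjunct2, THEN spec, of "Suc j"] y by (simp add: funpow_swap1)
        moreover have "y < n" using xy T.tail_in_verts[OF e(1)] T by auto
        ultimately show ?thesis by simp
      qed
    qed (use v in auto)
    moreover have "(f ^^ 1) r = n" using r by (simp add: f_def)
    ultimately show False by blast
  qed
  moreover have "f \<in> {..<n} \<rightarrow>\<^sub>E {..n}"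
  proof (rule PiE_I)
    fix v assume "v \<in> {..<n}"
    then show "f v \<in> {..n}" using pn[of v] by (cases "v = r") (simp_all add: f_def less_imp_le)
  qed (simp add: f_def)
  moreover have "\<forall>v\<in>nonroots n f. (f v, v) \<in> parcs G"
  proof
    fix v assume "v \<in> nonroots n f"
    then have "v \<in> {..<n} - {r}" unfolding N .
    then have v: "v < n" "v \<noteq> r" by auto
    show "(f v, v) \<in> parcs G" unfolding fN[OF v] by (rule subsetD[OF T(2) pa[OF v]])
  qed
  moreover have "card (nonroots n f) = n - 1" using r(1) unfolding N by simp
  ultimately have "f \<in> parent_trees n (parcs G)" by (simp add: parent_trees_def)
  moreover have "internal_vertices T \<subseteq> f ` nonroots n f"
  proof
    fix u assume "u \<in> internal_vertices T"
    then have "out_arcs T u \<noteq> {}" by (auto simp: internal_vertices_def out_degree_def)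
    then obtain e where "e \<in> arcs T" "fst e = u" by (auto simp: out_arcs_def T)
    then show "u \<in> f ` nonroots n f" using arc[of e] N by auto
  qed
  then have "card (internal_vertices T) \<le> card (f ` nonroots n f)" by (intro card_mono) auto
  ultimately show ?thesis using that k r(1) by simp
qed

text \<open>Marked arcs have distinct tails, so they witness \<open>k\<close> internal vertices;
  conversely one outgoing arc can be marked at each of \<open>k\<close> internal vertices.\<close>

lemma marked_trees_ne_iff:
  "marked_trees n Ar k \<noteq> {} \<longleftrightarrow> (\<exists>f\<in>parent_trees n Ar. k \<le> card (f ` nonroots n f))"
proof
  assume "marked_trees n Ar k \<noteq> {}"
  then obtain f F \<sigma> where "(f, F, \<sigma>) \<in> marked_trees n Ar k" by auto
  note T = marked_treesD[OF this]
  have "k = card (f ` F)" using T(3,4) by (simp add: card_image)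
  also have "\<dots> \<le> card (f ` nonroots n f)" using T(2) by (intro card_mono) auto
  finally show "\<exists>f\<in>parent_trees n Ar. k \<le> card (f ` nonroots n f)" using T(1) by auto
next
  assume "\<exists>f\<in>parent_trees n Ar. k \<le> card (f ` nonroots n f)"
  then obtain f where f: "f \<in> parent_trees n Ar" "k \<le> card (f ` nonroots n f)" by auto
  from obtain_subset_with_card_n[OF f(2)] obtain U where U: "U \<subseteq> f ` nonroots n f" "card U = k" by auto
  \<comment> \<open>One child is chosen for each of the \<open>k\<close> internal vertices.\<close>
  from U(1) obtain F where F: "F \<subseteq> nonroots n f" "inj_on f F" "U = f ` F" by (auto simp: subset_image_inj)
  have cF: "card F = k" using F U(2) by (simp add: card_image)
  have "finite F" using F(1) by (rule finite_subset) simp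
  from ex_bij_betw_finite_nat[OF this] obtain h where "bij_betw h F {..<k}"
    by (auto simp: cF atLeast0LessThan)
  then have "bij_betw (restrict h F) F {..<k}" by (subst bij_betw_cong[where g = h]) auto
  moreover from this have "restrict h F \<in> F \<rightarrow>\<^sub>E {..<k}" by (auto simp: bij_betw_def PiE_iff)
  ultimately have "(f, F, restrict h F) \<in> marked_trees n Ar k"
    using f(1) F cF by (auto simp: marked_trees_def)
  then show "marked_trees n Ar k \<noteq> {}" by blast
qed

lemma has_internal_iff_marked_trees:
  assumes "pair_digraph G" "pverts G = {..<n}" "0 < n"
  shows "has_internal_out_branching (with_proj G) k \<longleftrightarrow> marked_trees n (parcs G) k \<noteq> {}"
  unfolding marked_trees_ne_iff
  using parent_tree_imp_has_internal[OF assms] has_internal_imp_parent_tree[OF assms(1,2)] by metis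

text \<open>The \<open>n - 1\<close> arcs have at most \<open>n - 1\<close> tails. This justifies
  answering NO at once when \<open>n \<le> k\<close>.\<close>

lemma has_internal_less:
  assumes "pair_digraph G" "pverts G = {..<n}" "has_internal_out_branching (with_proj G) k"
  shows "k < n"
proof -
  from has_internal_imp_parent_tree[OF assms] obtain f where
    "0 < n" "f \<in> parent_trees n (parcs G)" "k \<le> card (f ` nonroots n f)" .
  then show ?thesis using card_image_le[of "nonroots n f" f] parent_treesD(4)[of f n "parcs G"] by simp
qed


section \<open>The Schwartz-Zippel lemma for coin tosses\<close>

text \<open>
  The \<open>V\<close> blocks of \<open>m\<close> tosses are drawn for \<open>i = V - 1\<close> down to \<open>i = 0\<close>.
\<close>

definition chunk :: "nat \<Rightarrow> nat \<Rightarrow> bool list \<Rightarrow> nat \<Rightarrow> bool list" where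
  "chunk m V bs i = take m (drop ((V - 1 - i) * m) bs)"

lemma card_lists_length_eq_bool: "card {bs :: bool list. length bs = T} = 2 ^ T"
  using card_lists_length_eq[of "UNIV :: bool set" T] by simp

lemma finite_lists_length_eq_bool: "finite {bs :: bool list. length bs = T \<and> P bs}"
  by (rule finite_subset[OF _ finite_lists_length_eq[of "UNIV :: bool set" T]]) auto

text \<open>Here \<open>M\<close> counts the values of one block and \<open>W\<close> those of all
  earlier ones. Each of the \<open>y\<close> zeros of the cofactor of the new variable may extend by
  all \<open>M\<close> values, each of the \<open>c\<close> other points by at most one.\<close>

lemma schwartz_zippel_step:
  fixes z y c M V W :: nat
  assumes "y * M \<le> V * W" "c \<le> W" "z \<le> M * y + c"
  shows "z * M \<le> Suc V * (W * M)"
proof -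
  have "z * M \<le> (M * y + c) * M" using assms(3) by (rule mult_le_mono1)
  also have "\<dots> = M * (y * M) + c * M" by (simp add: algebra_simps)
  also have "\<dots> \<le> M * (V * W) + W * M" using assms(1,2) by (intro add_mono mult_le_mono1 mult_le_mono2)
  finally show ?thesis by (simp add: algebra_simps)
qed

text \<open>All coefficients are 1, so nonemptiness of the family already makes the polynomial
  nonzero. It is linear in its newest variable; at points where the cofactor of that variable does
  not vanish, injectivity of \<open>h\<close> in an integral domain leaves at most one block that
  gives zero.\<close>

lemma schwartz_zippel_multilinear:
  fixes h :: "bool list \<Rightarrow> 'a :: idom"
  assumes inj: "inj_on h {bs. length bs = m}"
    and \<F>: "\<F> \<noteq> {}" "\<F> \<subseteq> Pow {..<V}"
  shows "card {bs. length bs = V * m \<and> (\<Sum>S\<in>\<F>. \<Prod>i\<in>S. h (chunk m V bs i)) = 0} * 2 ^ m \<le> V * 2 ^ (V * m)"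
  using \<F>
proof (induction V arbitrary: \<F>)
  case 0
  then have "\<F> = {{}}" by auto
  then show ?case by simp
next
  case (Suc V)
  \<comment> \<open>The monomials without the newest variable, and the cofactors of those that
    contain it.\<close>
  let ?A = "{S \<in> \<F>. V \<notin> S}" and ?B = "(\<lambda>S. S - {V}) ` {S \<in> \<F>. V \<in> S}"
  let ?p = "\<lambda>\<G> bs. \<Sum>S\<in>\<G>. \<Prod>i\<in>S. h (chunk m V bs i)"
  let ?P = "\<lambda>bs. \<Sum>S\<in>\<F>. \<Prod>i\<in>S. h (chunk m (Suc V) bs i)"
  have fin: "finite \<F>" using Suc.prems by (auto intro: finite_subset)
  have finS: "finite S" if "S \<in> \<F>" for S using that Suc.prems by (auto intro: finite_subset)
  have A: "?A \<subseteq> Pow {..<V}" and B: "?B \<subseteq> Pow {..<V}"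
    using Suc.prems(2) by (auto simp: less_Suc_eq subset_iff)
  have ch: "chunk m (Suc V) (b @ bs) i = chunk m V bs i" if "length b = m" "i < V" for b bs i
  proof -
    have "V - i = Suc (V - 1 - i)" using that by simp
    then show ?thesis using that by (simp add: chunk_def)
  qed
  have chV: "chunk m (Suc V) (b @ bs) V = b" if "length b = m" for b bs
    using that by (simp add: chunk_def)
  have split: "?P (b @ bs) = ?p ?A bs + h b * ?p ?B bs" if b: "length b = m" for b bs
  proof -
    have "?P (b @ bs) = (\<Sum>S\<in>?A. \<Prod>i\<in>S. h (chunk m (Suc V) (b @ bs) i)) +
        (\<Sum>S\<in>{S \<in> \<F>. V \<in> S}. \<Prod>i\<in>S. h (chunk m (Suc V) (b @ bs) i))"
      by (subst sum.union_disjoint[symmetric]) (use fin in \<open>auto intro!: sum.cong\<close>)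
    also have "(\<Sum>S\<in>?A. \<Prod>i\<in>S. h (chunk m (Suc V) (b @ bs) i)) = ?p ?A bs"
      using A by (intro sum.cong prod.cong refl) (simp add: ch[OF b] subset_iff Pow_def)
    also have "(\<Sum>S\<in>{S \<in> \<F>. V \<in> S}. \<Prod>i\<in>S. h (chunk m (Suc V) (b @ bs) i)) =
        (\<Sum>S\<in>{S \<in> \<F>. V \<in> S}. h b * (\<Prod>i\<in>S - {V}. h (chunk m V bs i)))"
    proof (rule sum.cong[OF refl])
      fix S assume S: "S \<in> {S \<in> \<F>. V \<in> S}"
      then have "(\<Prod>i\<in>S. h (chunk m (Suc V) (b @ bs) i)) =
          h b * (\<Prod>i\<in>S - {V}. h (chunk m (Suc V) (b @ bs) i))"
        using finS by (subst prod.remove[of S V]) (auto simp: chV[OF b])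
      also have "(\<Prod>i\<in>S - {V}. h (chunk m (Suc V) (b @ bs) i)) = (\<Prod>i\<in>S - {V}. h (chunk m V bs i))"
      proof (intro prod.cong refl)
        fix i assume "i \<in> S - {V}"
        then have "i < V" using S Suc.prems(2) by (fastforce simp: less_Suc_eq)
        then show "h (chunk m (Suc V) (b @ bs) i) = h (chunk m V bs i)" by (simp add: ch[OF b])
      qed
      finally show "(\<Prod>i\<in>S. h (chunk m (Suc V) (b @ bs) i)) = h b * (\<Prod>i\<in>S - {V}. h (chunk m V bs i))" .
    qed
    also have "\<dots> = h b * ?p ?B bs"
      by (subst sum.reindex) (auto simp: inj_on_def sum_distrib_left)
    finally show ?thesis .
  qed
  let ?Z = "{bs. length bs = Suc V * m \<and> ?P bs = 0}"
  let ?Y = "{bs. length bs = V * m \<and> ?p ?B bs = 0}"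
  let ?N = "{bs. length bs = V * m \<and> ?p ?B bs \<noteq> 0}"
  have eq: "?Z = (\<lambda>(b, bs). b @ bs) ` {(b, bs). length b = m \<and> length bs = V * m \<and> ?P (b @ bs) = 0}"
  proof (intro equalityI subsetI)
    fix x assume "x \<in> ?Z"
    then show "x \<in> (\<lambda>(b, bs). b @ bs) ` {(b, bs). length b = m \<and> length bs = V * m \<and> ?P (b @ bs) = 0}"
      by (intro image_eqI[of _ _ "(take m x, drop m x)"]) auto
  qed auto
  let ?Q = "{(b, bs). length b = m \<and> length bs = V * m \<and> ?P (b @ bs) = 0}"
  \<comment> \<open>Zeros of the cofactor \<open>?p ?B\<close> allow every block \<open>b\<close>;
    elsewhere the choice operator names the only bad one.\<close>
  have "?Q \<subseteq> ({b. length b = m} \<times> ?Y) \<union>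
      (\<lambda>bs. (SOME b. length b = m \<and> ?P (b @ bs) = 0, bs)) ` ?N"
  proof (rule subsetI)
    fix t assume "t \<in> ?Q"
    then obtain b bs where t: "t = (b, bs)" "length b = m" "length bs = V * m" "?P (b @ bs) = 0" by auto
    show "t \<in> ({b. length b = m} \<times> ?Y) \<union>
      (\<lambda>bs. (SOME b. length b = m \<and> ?P (b @ bs) = 0, bs)) ` ?N"
    proof (cases "?p ?B bs = 0")
      case False
      let ?c = "SOME b. length b = m \<and> ?P (b @ bs) = 0"
      have "length b = m \<and> ?P (b @ bs) = 0" by (rule conjI[OF t(2) t(4)])
      from someI[of "\<lambda>b. length b = m \<and> ?P (b @ bs) = 0", OF this]
      have c: "length ?c = m" "?P (?c @ bs) = 0" by (rule conjunct1, rule conjunct2)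
      have "?p ?A bs + h ?c * ?p ?B bs = ?p ?A bs + h b * ?p ?B bs"
        unfolding split[OF c(1), symmetric] split[OF t(2), symmetric] by (rule trans[OF c(2) t(4)[symmetric]])
      then have "h ?c * ?p ?B bs = h b * ?p ?B bs" by (rule add_left_imp_eq)
      then have "h ?c = h b" by (rule mult_right_cancel[OF False, THEN iffD1])
      then have "b = ?c" by (intro inj_onD[OF inj]) (use c(1) t(2) in simp_all)
      moreover have "bs \<in> ?N" by (rule CollectI) (rule conjI[OF t(3) False])
      ultimately show ?thesis unfolding t(1)
        by (intro UnI2 image_eqI[of _ _ bs]) (rule arg_cong[where f = "\<lambda>b. (b, bs)"])
    next
      case True
      then show ?thesis unfolding t(1) by (intro UnI1 SigmaI CollectI conjI t(2,3))
    qed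
  qed
  then have "card ?Q \<le> card (({b :: bool list. length b = m} \<times> ?Y) \<union>
      (\<lambda>bs. (SOME b. length b = m \<and> ?P (b @ bs) = 0, bs)) ` ?N)"
    by (rule card_mono[rotated]) (auto intro!: finite_cartesian_product finite_lists_length_eq_bool
       finite_lists_length_eq_bool[where P = "\<lambda>_. True", simplified])
  also have "\<dots> \<le> card ({b :: bool list. length b = m} \<times> ?Y) +
      card ((\<lambda>bs. (SOME b. length b = m \<and> ?P (b @ bs) = 0, bs)) ` ?N)"
    by (rule card_Un_le)
  also have "card ({b :: bool list. length b = m} \<times> ?Y) = 2 ^ m * card ?Y"
    by (simp add: card_cartesian_product card_lists_length_eq_bool)
  also have "card ((\<lambda>bs. (SOME b. length b = m \<and> ?P (b @ bs) = 0, bs)) ` ?N) \<le> card ?N"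
    by (rule card_image_le) (rule finite_lists_length_eq_bool)
  finally have Q: "card ?Q \<le> 2 ^ m * card ?Y + card ?N" by simp
  have "card ?Z \<le> card ?Q" unfolding eq
    by (rule card_image_le) (rule finite_subset[of _ "{b. length b = m} \<times> {bs. length bs = V * m}"],
      auto intro!: finite_cartesian_product finite_lists_length_eq_bool[where P = "\<lambda>_. True", simplified])
  with Q have Z: "card ?Z \<le> 2 ^ m * card ?Y + card ?N" by simp
  have tot: "card ?N \<le> 2 ^ (V * m)" "card ?Y \<le> 2 ^ (V * m)"
    unfolding card_lists_length_eq_bool[symmetric]
    by (rule card_mono; use finite_lists_length_eq_bool[where P = "\<lambda>_. True"] in auto)+
  have "card ?Z * 2 ^ m \<le> Suc V * 2 ^ (Suc V * m)"
  proof (cases "?B = {}")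
    case False
    have "card ?Z * 2 ^ m \<le> Suc V * (2 ^ (V * m) * 2 ^ m)"
      by (rule schwartz_zippel_step[OF Suc.IH[OF False B] tot(1) Z])
    also have "2 ^ (V * m) * 2 ^ m = (2 :: nat) ^ (Suc V * m)" by (simp add: power_add)
    finally show ?thesis .
  next
    \<comment> \<open>The newest variable does not occur: its block is arbitrary, and the induction
      hypothesis applies to the same family.\<close>
    case True
    then have "{S \<in> \<F>. V \<in> S} = {}" by (simp only: image_is_empty)
    then have eA: "?A = \<F>" by blast
    have split': "?P (b @ bs) = ?p \<F> bs" if "length b = m" for b bs
      unfolding split[OF that] True eA by simp
    have "?Z \<subseteq> (\<lambda>(b, bs). b @ bs) ` ({b. length b = m} \<times> {bs. length bs = V * m \<and> ?p \<F> bs = 0})"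
    proof (unfold eq, rule image_mono, rule subsetI)
      fix t assume "t \<in> ?Q"
      then obtain b bs where t: "t = (b, bs)" "length b = m" "length bs = V * m" "?P (b @ bs) = 0" by auto
      show "t \<in> {b. length b = m} \<times> {bs. length bs = V * m \<and> ?p \<F> bs = 0}"
        unfolding t(1) using t(4)[unfolded split'[OF t(2)]] by (intro SigmaI CollectI conjI t(2,3))
    qed
    then have "card ?Z \<le> card ((\<lambda>(b, bs). b @ bs) ` ({b. length b = m} \<times> {bs. length bs = V * m \<and> ?p \<F> bs = 0}))"
      by (rule card_mono[rotated]) (intro finite_imageI finite_cartesian_product finite_lists_length_eq_bool
       finite_lists_length_eq_bool[where P = "\<lambda>_. True", simplified])
    also have "\<dots> \<le> card ({b :: bool list. length b = m} \<times> {bs. length bs = V * m \<and> ?p \<F> bs = 0})"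
      by (rule card_image_le) (intro finite_cartesian_product finite_lists_length_eq_bool
       finite_lists_length_eq_bool[where P = "\<lambda>_. True", simplified])
    also have "\<dots> = 2 ^ m * card {bs. length bs = V * m \<and> ?p \<F> bs = 0}"
      by (simp add: card_cartesian_product card_lists_length_eq_bool)
    finally have Z': "card ?Z \<le> 2 ^ m * card {bs. length bs = V * m \<and> ?p \<F> bs = 0} + 0"
      by (simp only: add_0_right)
    have "\<F> \<subseteq> Pow {..<V}" using A unfolding eA .
    from schwartz_zippel_step[OF Suc.IH[OF Suc.prems(1) this] le0 Z']
    have "card ?Z * 2 ^ m \<le> Suc V * (2 ^ (V * m) * 2 ^ m)" .
    also have "2 ^ (V * m) * 2 ^ m = (2 :: nat) ^ (Suc V * m)" by (simp add: power_add)
    finally show ?thesis .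
  qed
  then show ?case .
qed

section \<open>Probabilities of events that depend on finitely many tosses\<close>

lemma prob_space_coin_space: "prob_space coin_space"
  unfolding coin_space_def by (rule prob_space.prob_space_stream_space) (rule measure_pmf.prob_space_axioms)

lemma space_coin_space [simp]: "space coin_space = UNIV"
  by (simp add: coin_space_def space_stream_space)

lemma stake_event_measurable: "{\<omega>. P (stake T \<omega>)} \<in> sets coin_space"
proof -
  have "stake T \<in> measurable coin_space (count_space UNIV)"
    using measurable_stake[where i = T and 'a = bool] unfolding coin_space_def
    by (simp cong: measurable_cong_sets sets_stream_space_cong)
  from measurable_sets[OF this, of "{bs. P bs}"] show ?thesis by (simp add: vimage_def)
qed

lemma emeasure_stake_eq: "emeasure coin_space {\<omega>. stake (length bs) \<omega> = bs} = ennreal ((1 / 2) ^ length bs)"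
proof (induction bs)
  case Nil
  then show ?case using prob_space.emeasure_space_1[OF prob_space_coin_space] by simp
next
  case (Cons b bs)
  let ?M = "measure_pmf (bernoulli_pmf (1 / 2))"
  have "emeasure coin_space {\<omega>. stake (length (b # bs)) \<omega> = b # bs} =
     (\<integral>\<^sup>+c. emeasure coin_space {\<omega>. stake (length (b # bs)) (c ## \<omega>) = b # bs} \<partial>?M)"
    using stake_event_measurable[of "\<lambda>x. x = b # bs" "length (b # bs)"] unfolding coin_space_def
    by (subst prob_space.emeasure_stream_space) (auto simp: measure_pmf.prob_space_axioms space_stream_space)
  also have "\<dots> = (\<integral>\<^sup>+c. ennreal ((1 / 2) ^ length bs) * indicator {b} c \<partial>?M)"
    by (intro nn_integral_cong) (auto simp: Cons.IH split: split_indicator)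
  also have "\<dots> = ennreal ((1 / 2) ^ length bs) * emeasure ?M {b}"
    by (subst nn_integral_cmult_indicator) auto
  also have "emeasure ?M {b} = ennreal (1 / 2)"
    by (cases b) (simp_all add: emeasure_pmf_single)
  also have "ennreal ((1 / 2) ^ length bs) * ennreal (1 / 2) = ennreal ((1 / 2) ^ length (b # bs))"
    by (subst ennreal_mult[symmetric]) (simp_all add: mult.commute)
  finally show ?case .
qed

lemma measure_stake_event:
  "measure coin_space {\<omega>. P (stake T \<omega>)} = card {bs. length bs = T \<and> P bs} / 2 ^ T"
proof -
  interpret prob_space coin_space by (rule prob_space_coin_space)
  let ?B = "{bs. length bs = T \<and> P bs}"
  have "{\<omega>. P (stake T \<omega>)} = (\<Union>bs\<in>?B. {\<omega>. stake T \<omega> = bs})" by auto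
  then have "measure coin_space {\<omega>. P (stake T \<omega>)} = (\<Sum>bs\<in>?B. measure coin_space {\<omega>. stake T \<omega> = bs})"
    by (simp only:) (rule finite_measure_finite_Union,
      auto simp: finite_lists_length_eq_bool disjoint_family_on_def stake_event_measurable[of "\<lambda>x. x = _"])
  also have "\<dots> = (\<Sum>bs\<in>?B. (1 / 2) ^ T)"
    using emeasure_stake_eq by (intro sum.cong refl) (auto simp: measure_def)
  finally show ?thesis by (simp add: power_one_over)
qed

corollary prob_multilinear_eq_0:
  fixes h :: "bool list \<Rightarrow> 'a :: idom"
  assumes "inj_on h {bs. length bs = m}" "\<F> \<noteq> {}" "\<F> \<subseteq> Pow {..<V}"
  shows "measure coin_space {\<omega>. (\<Sum>S\<in>\<F>. \<Prod>i\<in>S. h (chunk m V (stake (V * m) \<omega>) i)) = 0} \<le> V / 2 ^ m"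
proof -
  let ?c = "card {bs. length bs = V * m \<and> (\<Sum>S\<in>\<F>. \<Prod>i\<in>S. h (chunk m V bs i)) = 0}"
  have "real (?c * 2 ^ m) \<le> real (V * 2 ^ (V * m))"
    using schwartz_zippel_multilinear[OF assms] by (rule of_nat_mono)
  then have "real ?c / 2 ^ (V * m) \<le> V / 2 ^ m"
    by (simp add: field_simps)
  then show ?thesis
    by (simp only: measure_stake_event[of "\<lambda>bs. (\<Sum>S\<in>\<F>. \<Prod>i\<in>S. h (chunk m V bs i)) = 0"])
qed


section \<open>Power series over the two-element field as natural numbers\<close>

definition enc :: "nat \<Rightarrow> bit fps \<Rightarrow> nat" where
  "enc N f = horner_sum of_bool 2 (map (\<lambda>i. fps_nth f i = 1) [0..<N])"

lemma bit_enc: "bit (enc N f) i \<longleftrightarrow> i < N \<and> fps_nth f i = 1"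
  by (auto simp: enc_def bit_horner_sum_bit_iff)

lemma enc_less: "enc N f < 2 ^ N"
  using horner_sum_of_bool_2_less[of "map (\<lambda>i. fps_nth f i = 1) [0..<N]"] by (simp add: enc_def)

lemma enc_cong:
  assumes "\<And>i. i < N \<Longrightarrow> fps_nth f i = fps_nth g i"
  shows "enc N f = enc N g"
  by (rule bit_eqI) (use assms in \<open>auto simp: bit_enc\<close>)

lemma bit_add_eq_1_iff: "(a :: bit) + b = 1 \<longleftrightarrow> (a = 1) \<noteq> (b = 1)"
  by (cases a; cases b) simp_all

lemma enc_add: "xor (enc N f) (enc N g) = enc N (f + g)"
  by (rule bit_eqI) (auto simp: bit_enc bit_xor_iff bit_add_eq_1_iff)

lemma enc_0: "enc N 0 = 0"
  by (rule bit_eqI) (auto simp: bit_enc)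

lemma enc_1: "0 < N \<Longrightarrow> enc N 1 = 1"
  by (rule bit_eqI) (auto simp: bit_enc bit_1_iff simp del: One_nat_def)

lemma enc_shift: "enc N (fps_X ^ j * f) = enc N f * 2 ^ j mod 2 ^ N"
  unfolding push_bit_eq_mult[symmetric] take_bit_eq_mod[symmetric]
  by (rule bit_eqI) (auto simp: bit_enc bit_take_bit_iff bit_push_bit_iff fps_X_power_mult_nth)

lemma enc_cutoff_mult: "enc N (fps_cutoff N f * g) = enc N (f * g)"
  by (rule enc_cong) (auto simp: fps_mult_nth intro!: sum.cong)

lemma enc_eq_0_of_prefix: "(\<And>i. i < N \<Longrightarrow> fps_nth f i = 0) \<Longrightarrow> enc N f = 0"
  using enc_cong[of N f 0] by (simp add: enc_0)

text \<open>Horner's scheme for \<open>1 + g + ... + g ^ j\<close>.\<close>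

definition geom :: "bit fps \<Rightarrow> nat \<Rightarrow> bit fps" where
  "geom g j = ((\<lambda>y. 1 + g * y) ^^ j) 1"

lemma geom_0 [simp]: "geom g 0 = 1" and geom_Suc: "geom g (Suc j) = 1 + g * geom g j"
  by (simp_all add: geom_def)

text \<open>With \<open>g = p + 1\<close>, characteristic 2 gives \<open>p = 1 - g\<close>, so the
  inverse is the geometric series in \<open>g\<close>. As \<open>g\<close> has constant term 0, the
  remainder \<open>g ^ Suc N * inverse p\<close> is invisible modulo \<open>X^N\<close>.\<close>

lemma enc_geom:
  assumes p: "fps_nth p 0 = 1"
  shows "enc N (geom (p + 1) N) = enc N (inverse p)"
proof -
  let ?g = "p + 1" and ?I = "inverse p"
  have I: "p * ?I = 1" using assms inverse_mult_eq_1'[of p] by simp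
  have "geom ?g j + ?g ^ Suc j * ?I = ?I" for j
  proof (induction j)
    case 0
    have "1 + (p + 1) * ?I = 1 + 1 + ?I" using I by (simp add: distrib_right)
    then show ?case by (simp only: geom_0 power_Suc0_right bit_fps_double add_0)
  next
    case (Suc j)
    have "geom ?g (Suc j) + ?g ^ Suc (Suc j) * ?I = 1 + ?g * (geom ?g j + ?g ^ Suc j * ?I)"
      by (simp add: geom_Suc algebra_simps)
    also have "\<dots> = 1 + (p + 1) * ?I" by (simp only: Suc.IH)
    also have "\<dots> = (1 + 1) + ?I" using I by (simp add: distrib_right)
    also have "\<dots> = ?I" by (simp only: bit_fps_double add_0)
    finally show ?case .
  qed
  then have e: "?I = geom ?g N + ?g ^ Suc N * ?I" by metis
  have "fps_nth ?g 0 = 0" using p by simp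
  then have "\<forall>n<Suc N. fps_nth (?g ^ Suc N) n = 0" by (rule startsby_zero_power_prefix)
  then have "fps_nth (?g ^ Suc N * ?I) i = 0" if "i < N" for i
    unfolding fps_mult_nth using that by (intro sum.neutral) auto
  then have z: "enc N (?g ^ Suc N * ?I) = 0" by (rule enc_eq_0_of_prefix)
  have "enc N ?I = enc N (geom ?g N + ?g ^ Suc N * ?I)" by (rule arg_cong[OF e])
  also have "\<dots> = xor (enc N (geom ?g N)) (enc N (?g ^ Suc N * ?I))" by (rule enc_add[symmetric])
  also have "\<dots> = enc N (geom ?g N)" by (simp only: z xor.right_neutral)
  finally show ?thesis ..
qed

definition bpoly :: "bool list \<Rightarrow> bit poly" where
  "bpoly bs = Poly (map of_bool bs)"

lemma coeff_bpoly: "coeff (bpoly bs) i = of_bool (i < length bs \<and> bs ! i)"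
  by (simp add: bpoly_def nth_default_def)

lemma degree_bpoly: "degree (bpoly bs) \<le> length bs - 1"
  by (rule degree_le) (auto simp: coeff_bpoly)

lemma inj_on_bpoly: "inj_on bpoly {bs. length bs = m}"
proof (rule inj_onI)
  fix xs ys assume l: "xs \<in> {bs. length bs = m}" "ys \<in> {bs. length bs = m}" and e: "bpoly xs = bpoly ys"
  show "xs = ys"
  proof (rule nth_equalityI)
    fix i assume "i < length xs"
    then show "xs ! i = ys ! i" using arg_cong[OF e, of "\<lambda>p. coeff p i"] l
      by (auto simp: coeff_bpoly split: if_splits)
  qed (use l in simp)
qed

lemma enc_bpoly: "length bs \<le> N \<Longrightarrow> enc N (fps_of_poly (bpoly bs)) = horner_sum of_bool 2 bs"
  by (rule bit_eqI) (auto simp: bit_enc bit_horner_sum_bit_iff coeff_bpoly)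


section \<open>A total-correctness calculus with running times\<close>

text \<open>The condition \<open>0 < L\<close> makes room for the outcome 1 of a coin toss.\<close>

definition bnd :: "nat \<Rightarrow> (nat \<Rightarrow> nat) \<Rightarrow> (nat \<Rightarrow> nat) \<Rightarrow> bool" where
  "bnd L R M \<longleftrightarrow> 0 < L \<and> (\<forall>i. R i < 2 ^ L) \<and> (\<forall>a. M a < 2 ^ L)"

text \<open>
  If all cells stay below $2^L$, no single instruction costs more than $(1 + L)^2$; the time \<open>t\<close>
  is measured in this unit. The bound on the cells is part of the judgement, so that it has to be
  checked only where a value can grow: at \<open>Imm\<close>, \<open>Add\<close> and \<open>Mul\<close>.
\<close>

definition wp :: "nat \<Rightarrow> prog \<Rightarrow> nat \<Rightarrow> ((nat \<Rightarrow> nat) \<Rightarrow> (nat \<Rightarrow> nat) \<Rightarrow> bool stream \<Rightarrow> bool) \<Rightarrow>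
    (nat \<Rightarrow> nat) \<Rightarrow> (nat \<Rightarrow> nat) \<Rightarrow> bool stream \<Rightarrow> bool" where
  "wp L c t Q R M \<omega> \<longleftrightarrow> (bnd L R M \<longrightarrow> (\<exists>t' R' M' \<omega>'. exec c ((R, M), \<omega>) t' ((R', M'), \<omega>') \<and>
     t' \<le> t * (1 + L)\<^sup>2 \<and> bnd L R' M' \<and> Q R' M' \<omega>'))"

lemma len_le: "x < 2 ^ L \<Longrightarrow> len x \<le> L"
proof -
  assume "x < 2 ^ L"
  then show ?thesis by (simp add: floorlog_le_iff)
qed

lemma wp_mono:
  assumes "wp L c t Q R M \<omega>" "\<And>R M \<omega>. bnd L R M \<Longrightarrow> Q R M \<omega> \<Longrightarrow> Q' R M \<omega>" "t \<le> t'"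
  shows "wp L c t' Q' R M \<omega>"
  using assms mult_le_mono1[OF assms(3), of "(1 + L)\<^sup>2"] unfolding wp_def by (meson order.trans)

lemma wp_seq:
  assumes "wp L c1 t1 (wp L c2 t2 Q) R M \<omega>" "t1 + t2 \<le> t"
  shows "wp L (Seq c1 c2) t Q R M \<omega>"
  unfolding wp_def
proof
  assume "bnd L R M"
  with assms(1) obtain t1' R1 M1 \<omega>1 where 1: "exec c1 ((R, M), \<omega>) t1' ((R1, M1), \<omega>1)"
    "t1' \<le> t1 * (1 + L)\<^sup>2" "bnd L R1 M1" "wp L c2 t2 Q R1 M1 \<omega>1" unfolding wp_def[of L c1] by blast
  then obtain t2' R2 M2 \<omega>2 where 2: "exec c2 ((R1, M1), \<omega>1) t2' ((R2, M2), \<omega>2)"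
    "t2' \<le> t2 * (1 + L)\<^sup>2" "bnd L R2 M2" "Q R2 M2 \<omega>2" unfolding wp_def by blast
  have "t1' + t2' \<le> (t1 + t2) * (1 + L)\<^sup>2" unfolding distrib_right using 1(2) 2(2) by (rule add_mono)
  also have "\<dots> \<le> t * (1 + L)\<^sup>2" using assms(2) by (rule mult_le_mono1)
  finally show "\<exists>t' R' M' \<omega>'. exec (Seq c1 c2) ((R, M), \<omega>) t' ((R', M'), \<omega>') \<and>
     t' \<le> t * (1 + L)\<^sup>2 \<and> bnd L R' M' \<and> Q R' M' \<omega>'"
    using exec.Seq[OF 1(1) 2(1)] 2(3,4) by blast
qed

text \<open>A weakest precondition for straight-line code that simplification evaluates like a
  symbolic execution. Control structures yield \<open>False\<close>, as they have rules of their
  own.\<close>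

fun straight :: "nat \<Rightarrow> prog list \<Rightarrow> ((nat \<Rightarrow> nat) \<Rightarrow> (nat \<Rightarrow> nat) \<Rightarrow> bool stream \<Rightarrow> bool) \<Rightarrow>
    (nat \<Rightarrow> nat) \<Rightarrow> (nat \<Rightarrow> nat) \<Rightarrow> bool stream \<Rightarrow> bool" where
  "straight L [] Q R M \<omega> = Q R M \<omega>"
| "straight L (Imm i c # p) Q R M \<omega> = (c < 2 ^ L \<and> straight L p Q (R(i := c)) M \<omega>)"
| "straight L (Arith f i j l # p) Q R M \<omega> = ((f = Add \<or> f = Mul \<longrightarrow> binop_val f (R j) (R l) < 2 ^ L) \<and>
     straight L p Q (R(i := binop_val f (R j) (R l))) M \<omega>)"
| "straight L (Load i j # p) Q R M \<omega> = straight L p Q (R(i := M (R j))) M \<omega>"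
| "straight L (Store i j # p) Q R M \<omega> = straight L p Q R (M(R i := R j)) \<omega>"
| "straight L (Toss i # p) Q R M \<omega> = straight L p Q (R(i := of_bool (shd \<omega>))) M (stl \<omega>)"
| "straight L _ Q R M \<omega> = False"

fun block :: "prog list \<Rightarrow> prog" where
  "block [] = Imm 50 0"
| "block [c] = c"
| "block (c # cs) = Seq c (block cs)"

lemma binop_val_bound:
  assumes "x < 2 ^ L" "y < 2 ^ L" "\<not> (f = Add \<or> f = Mul)"
  shows "binop_val f x y < 2 ^ L"
proof (cases f)
  case Bxor
  have "take_bit L (xor x y) = xor x y" using assms by (simp add: take_bit_nat_eq_self)
  then show ?thesis using Bxor by (metis binop_val.simps(7) take_bit_nat_less_exp)
next
  case Band
  have "take_bit L (and x y) = and x y" using assms by (simp add: take_bit_nat_eq_self)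
  then show ?thesis using Band by (metis binop_val.simps(6) take_bit_nat_less_exp)
next
  case Div
  then show ?thesis using assms by (simp add: le_less_trans[OF div_le_dividend])
next
  case Mod
  then show ?thesis using assms by (simp add: le_less_trans[OF mod_less_eq_dividend])
qed (use assms in auto)

lemma wp_single:
  assumes "straight L [c] Q R M \<omega>"
  shows "wp L c 1 Q R M \<omega>"
  unfolding wp_def
proof
  assume b: "bnd L R M"
  have sq: "(1 + x) * (1 + y) \<le> (1 + L)\<^sup>2" if "x \<le> L" "y \<le> L" for x y
    using that unfolding power2_eq_square by (intro mult_le_mono) auto
  have sq': "1 + x + y \<le> (1 + L)\<^sup>2" if "x \<le> L" "y \<le> L" for x y
    using sq[OF that] by (simp add: algebra_simps)
  have R: "R i < 2 ^ L" "len (R i) \<le> L" and M: "M i < 2 ^ L" "len (M i) \<le> L" for i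
    using b len_le by (auto simp: bnd_def)
  show "\<exists>t' R' M' \<omega>'. exec c ((R, M), \<omega>) t' ((R', M'), \<omega>') \<and>
     t' \<le> 1 * (1 + L)\<^sup>2 \<and> bnd L R' M' \<and> Q R' M' \<omega>'"
  proof (cases c)
    case (Imm i x)
    show ?thesis using assms b len_le[of x L] sq'[of "len x" 0] unfolding Imm
      by (intro exI conjI) (rule exec.Imm, auto simp: bnd_def)
  next
    case (Arith f i j l)
    have "binop_val f (R j) (R l) < 2 ^ L"
      using assms R binop_val_bound[of "R j" L "R l" f] Arith by (cases "f = Add \<or> f = Mul") auto
    then show ?thesis using assms b sq[OF R(2)[of j] R(2)[of l]] unfolding Arith
      by (intro exI conjI) (rule exec.Arith, auto simp: bnd_def)
  next
    case (Load i j)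
    show ?thesis using assms b sq'[OF R(2)[of j] M(2)[of "R j"]] unfolding Load
      by (intro exI conjI) (rule exec.Load, auto simp: bnd_def)
  next
    case (Store i j)
    show ?thesis using assms b sq'[OF R(2)[of i] R(2)[of j]] unfolding Store
      by (intro exI conjI) (rule exec.Store, auto simp: bnd_def)
  next
    case (Toss i)
    have "1 < (2 :: nat) ^ L" by (rule one_less_power) (use b in \<open>auto simp: bnd_def\<close>)
    then have "of_bool x < (2 :: nat) ^ L" for x by (cases x) auto
    then show ?thesis using assms b sq[of 0 0] exec.Toss[of i R M "shd \<omega>" "stl \<omega>"] unfolding Toss
      by (intro exI conjI) (simp, auto simp: bnd_def)
  qed (use assms in auto)
qed

lemma wp_block:
  assumes "straight L p Q R M \<omega>" "p \<noteq> []" "length p \<le> t"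
  shows "wp L (block p) t Q R M \<omega>"
  using assms
proof (induction p arbitrary: R M \<omega> t rule: block.induct)
  case (2 c)
  then show ?case using wp_mono[OF wp_single] by fastforce
next
  case (3 c d cs)
  have "straight L [c] (straight L (d # cs) Q) R M \<omega>" using "3.prems"(1) by (cases c) auto
  then have "wp L c 1 (straight L (d # cs) Q) R M \<omega>" by (rule wp_single)
  then have "wp L c 1 (wp L (block (d # cs)) (length (d # cs)) Q) R M \<omega>"
    by (rule wp_mono) (use "3.IH" in auto)
  then show ?case unfolding block.simps by (rule wp_seq) (use "3.prems"(3) in simp)
qed simp

lemma wp_block_seq:
  assumes "straight L p (wp L c t Q) R M \<omega>" "p \<noteq> []" "length p + t \<le> t'"
  shows "wp L (Seq (block p) c) t' Q R M \<omega>"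
  using wp_seq[OF wp_block[OF assms(1,2) order.refl] assms(3)] .

declare block.simps [simp del]

text \<open>
  Loops count down and rely on the convention that register 2 holds the constant 1.
\<close>

definition For :: "nat \<Rightarrow> prog \<Rightarrow> prog" where
  "For i c = While i (Seq (Arith Sub i i 2) c)"

text \<open>\<open>I m\<close> is the invariant with \<open>m\<close> rounds left. Each round pays
  one unit for the test and one for the decrement; the final failing test costs one more.\<close>

lemma wp_For:
  assumes "R i = b" "I b R M \<omega>"
    and step: "\<And>m R M \<omega>. m < b \<Longrightarrow> R i = Suc m \<Longrightarrow> I (Suc m) R M \<omega> \<Longrightarrow>
      R 2 = 1 \<and> wp L c t (\<lambda>R M \<omega>. R i = m \<and> I m R M \<omega>) (R(i := m)) M \<omega>"
    and post: "\<And>R M \<omega>. bnd L R M \<Longrightarrow> R i = 0 \<Longrightarrow> I 0 R M \<omega> \<Longrightarrow> Q R M \<omega>"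
    and T: "b * (t + 2) + 1 \<le> T"
  shows "wp L (For i c) T Q R M \<omega>"
proof -
  have "wp L (For i c) (b * (t + 2) + 1) Q R M \<omega>"
    using assms(1,2) step
  proof (induction b arbitrary: R M \<omega>)
    case 0
    show ?case unfolding wp_def
    proof
      assume b: "bnd L R M"
      have "exec (While i (Seq (Arith Sub i i 2) c)) ((R, M), \<omega>) (1 + len (R i)) ((R, M), \<omega>)"
        using 0 by (intro exec.WhileFalse) simp
      moreover have "1 + len (R i) \<le> (0 * (t + 2) + 1) * (1 + L)\<^sup>2" using 0 by (simp add: floorlog_def)
      ultimately show "\<exists>t' R' M' \<omega>'. exec (For i c) ((R, M), \<omega>) t' ((R', M'), \<omega>') \<and>
        t' \<le> (0 * (t + 2) + 1) * (1 + L)\<^sup>2 \<and> bnd L R' M' \<and> Q R' M' \<omega>'"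
        unfolding For_def using b post[OF b] 0 by blast
    qed
  next
    case (Suc b)
    show ?case unfolding wp_def
    proof
      assume b: "bnd L R M"
      note * = Suc.prems(3)[OF lessI Suc.prems(1,2)]
      have R2: "R 2 = 1" and w: "wp L c t (\<lambda>R M \<omega>. R i = b \<and> I b R M \<omega>) (R(i := b)) M \<omega>"
        by (rule conjunct1[OF *], rule conjunct2[OF *])
      have "straight L [Arith Sub i i 2] (wp L c t (\<lambda>R M \<omega>. R i = b \<and> I b R M \<omega>)) R M \<omega>"
        using w R2 Suc.prems(1) by (simp add: fun_upd_def)
      then have "wp L (Seq (Arith Sub i i 2) c) (1 + t) (\<lambda>R M \<omega>. R i = b \<and> I b R M \<omega>) R M \<omega>"
        by (intro wp_seq[OF wp_single]) auto
      then obtain t1 R1 M1 \<omega>1 where 1: "exec (Seq (Arith Sub i i 2) c) ((R, M), \<omega>) t1 ((R1, M1), \<omega>1)"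
        "t1 \<le> (1 + t) * (1 + L)\<^sup>2" "bnd L R1 M1" "R1 i = b" "I b R1 M1 \<omega>1"
        using b unfolding wp_def by blast
      have "wp L (For i c) (b * (t + 2) + 1) Q R1 M1 \<omega>1"
        by (rule Suc.IH[OF 1(4,5)], rule Suc.prems(3)[OF less_SucI])
      then obtain t2 R2 M2 \<omega>2 where 2: "exec (For i c) ((R1, M1), \<omega>1) t2 ((R2, M2), \<omega>2)"
        "t2 \<le> (b * (t + 2) + 1) * (1 + L)\<^sup>2" "bnd L R2 M2" "Q R2 M2 \<omega>2"
        using 1(3) unfolding wp_def by blast
      have "1 + len (R i) \<le> 1 + L" using b by (simp add: len_le bnd_def)
      also have "\<dots> \<le> 1 * (1 + L)\<^sup>2" by (simp add: power2_eq_square)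
      finally have "1 + len (R i) + t1 + t2 \<le> 1 * (1 + L)\<^sup>2 + (1 + t) * (1 + L)\<^sup>2 + (b * (t + 2) + 1) * (1 + L)\<^sup>2"
        using 1(2) 2(2) by (intro add_mono)
      also have "\<dots> = (Suc b * (t + 2) + 1) * (1 + L)\<^sup>2" by (simp add: algebra_simps)
      finally have "1 + len (R i) + t1 + t2 \<le> (Suc b * (t + 2) + 1) * (1 + L)\<^sup>2" .
      moreover have "exec (For i c) ((R, M), \<omega>) (1 + len (R i) + t1 + t2) ((R2, M2), \<omega>2)"
        unfolding For_def using Suc.prems(1) 1(1) 2(1)[unfolded For_def] by (intro exec.WhileTrue) auto
      ultimately show "\<exists>t' R' M' \<omega>'. exec (For i c) ((R, M), \<omega>) t' ((R', M'), \<omega>') \<and>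
        t' \<le> (Suc b * (t + 2) + 1) * (1 + L)\<^sup>2 \<and> bnd L R' M' \<and> Q R' M' \<omega>'"
        using 2(3,4) by blast
    qed
  qed
  then show ?thesis by (rule wp_mono) (use T in auto)
qed


section \<open>Truncated power series arithmetic on the machine\<close>

text \<open>Register 2 holds 1. Division never enlarges a value, so copying in this way leaves no
  size bound to prove.\<close>

definition "copy i j = Arith Div i j 2"

text \<open>
  Registers 2, 3, 9 and 10 hold $1$, $2$, $2^N$ and $N$ throughout. The product of registers 40 and 41
  is left in register 42; only registers from 40 on are changed.
\<close>

definition clmul :: prog where
  "clmul = Seq (block [Imm 42 0, Arith Div 43 10 2])
    (For 43 (block [Arith Mod 44 40 3, Arith Mul 44 44 41, Arith Bxor 42 42 44, Arith Div 40 40 3,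
       Arith Add 41 41 41, Arith Mod 41 41 9]))"

lemma enc_div_mod: "j < N \<Longrightarrow> enc N f div 2 ^ j mod 2 = of_bool (fps_nth f j = 1)"
  using bit_enc[of N f j] by (simp add: bit_iff_odd of_bool_odd_eq_mod_2[symmetric])

text \<open>One round of shift-and-add multiplication, with the first factor truncated to the
  coefficients read so far.\<close>

lemma enc_cutoff_Suc:
  "enc N (fps_cutoff (Suc j) f * g) =
   xor (enc N (fps_cutoff j f * g)) (of_bool (fps_nth f j = 1) * enc N (fps_X ^ j * g))"
proof (cases "fps_nth f j = 1")
  case True
  have "fps_cutoff (Suc j) f = fps_cutoff j f + fps_X ^ j"
    by (rule fps_ext) (auto simp: fps_X_power_iff less_Suc_eq True)
  then show ?thesis using True by (simp add: distrib_right enc_add)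
next
  case False
  then have "fps_cutoff (Suc j) f = fps_cutoff j f"
    by (intro fps_ext) (auto simp: less_Suc_eq)
  then show ?thesis using False by simp
qed

lemma wp_clmul:
  assumes R: "R 2 = 1" "R 3 = 2" "R 9 = 2 ^ N" "R 10 = N" "R 40 = enc N f" "R 41 = enc N g"
    and L: "N < L"
    and Q: "\<And>R'. (\<And>i. i < 40 \<Longrightarrow> R' i = R i) \<Longrightarrow> R' 42 = enc N (f * g) \<Longrightarrow> Q R' M \<omega>"
    and t: "N * 8 + 3 \<le> t"
  shows "wp L clmul t Q R M \<omega>"
proof -
  \<comment> \<open>Register 41 is doubled before its reduction modulo \<open>2 ^ N\<close>, which
    takes one extra bit.\<close>
  have N: "2 ^ N < (2 :: nat) ^ L" "2 * 2 ^ N \<le> (2 :: nat) ^ L"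
    using L power_increasing[of "Suc N" L "2 :: nat"] by auto
  \<comment> \<open>With \<open>m\<close> rounds left, \<open>N - m\<close> coefficients of
    \<open>f\<close> are consumed: 40 holds the others, 41 the shifted \<open>g\<close>, 42 the
    partial product.\<close>
  let ?I = "\<lambda>m R' M' \<omega>'. (\<forall>i<40. R' i = R i) \<and> M' = M \<and> \<omega>' = \<omega> \<and> m \<le> N \<and>
    R' 40 = enc N f div 2 ^ (N - m) \<and> R' 41 = enc N (fps_X ^ (N - m) * g) \<and>
    R' 42 = enc N (fps_cutoff (N - m) f * g)"
  show ?thesis unfolding clmul_def
  proof (rule wp_block_seq[where t = "N * 8 + 1"], simp only: straight.simps, intro conjI)
    show "wp L (For 43 (block [Arith Mod 44 40 3, Arith Mul 44 44 41, Arith Bxor 42 42 44, Arith Div 40 40 3,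
       Arith Add 41 41 41, Arith Mod 41 41 9])) (N * 8 + 1) Q
       (R(42 := 0, 43 := binop_val Div ((R(42 := 0)) 10) ((R(42 := 0)) 2))) M \<omega>"
    proof (rule wp_For[where I = ?I and b = N and t = 6])
      fix m R' M' \<omega>' assume m: "m < N" "R' 43 = Suc m" "?I (Suc m) R' M' \<omega>'"
      let ?j = "N - Suc m"
      have j: "N - m = Suc ?j" "?j < N" using m(1) by auto
      have r: "R' 2 = 1" "R' 3 = 2" "R' 9 = 2 ^ N" using m(3) R by auto
      have b: "enc N f div 2 ^ ?j mod 2 = of_bool (fps_nth f ?j = 1)" by (rule enc_div_mod[OF j(2)])
      have d: "enc N f div 2 ^ ?j div 2 = enc N f div 2 ^ (N - m)"
        unfolding j(1) by (simp add: div_mult2_eq[symmetric] mult.commute)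
      have s: "(enc N (fps_X ^ ?j * g) + enc N (fps_X ^ ?j * g)) mod 2 ^ N = enc N (fps_X ^ (N - m) * g)"
        using enc_shift[of N 1 "fps_X ^ ?j * g"] unfolding j(1) by (simp add: mult_2_right mult.assoc)
      have e: "enc N (fps_X ^ ?j * g) < 2 ^ N" by (rule enc_less)
      have "of_bool (fps_nth f ?j = 1) * enc N (fps_X ^ ?j * g) < 2 ^ L"
        "enc N (fps_X ^ ?j * g) + enc N (fps_X ^ ?j * g) < 2 ^ L"
        using e N by (auto simp: of_bool_def intro: less_trans)
      then show "R' 2 = 1 \<and> wp L (block [Arith Mod 44 40 3, Arith Mul 44 44 41, Arith Bxor 42 42 44, Arith Div 40 40 3,
       Arith Add 41 41 41, Arith Mod 41 41 9]) 6 (\<lambda>R M \<omega>. R 43 = m \<and> ?I m R M \<omega>) (R'(43 := m)) M' \<omega>'"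
        using m r by (intro conjI wp_block) (simp_all add: b d s j(1)[symmetric] enc_cutoff_Suc[of N ?j f g, folded j(1), symmetric])
    qed (use R Q in \<open>auto simp: enc_cutoff_mult enc_0\<close>)
  qed (use t in \<open>auto\<close>)
qed

text \<open>
  $N$ rounds of $y := 1 + (p + 1) y$ turn $1$ into the inverse of $p$ modulo $X^N$. The argument is taken
  from register 36 and the result left in register 37.
\<close>

definition cinv :: prog where
  "cinv = Seq (block [Arith Bxor 38 36 2, Imm 37 1, copy 39 10])
    (For 39 (Seq (block [copy 40 38, copy 41 37]) (Seq clmul (block [Arith Bxor 37 42 2]))))"

lemma wp_cinv:
  assumes R: "R 2 = 1" "R 3 = 2" "R 9 = 2 ^ N" "R 10 = N" "R 36 = enc N p"
    and p: "fps_nth p 0 = 1" and L: "N < L" and N: "0 < N"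
    and Q: "\<And>R'. (\<And>i. i < 36 \<Longrightarrow> R' i = R i) \<Longrightarrow> R' 37 = enc N (inverse p) \<Longrightarrow> Q R' M \<omega>"
    and t: "N * (N * 8 + 8) + 4 \<le> t"
  shows "wp L cinv t Q R M \<omega>"
proof -
  have one: "xor (enc N f) 1 = enc N (1 + f)" for f using enc_add[of N f 1] N by (simp add: enc_1 add.commute)
  let ?I = "\<lambda>m R' M' \<omega>'. (\<forall>i<36. R' i = R i) \<and> M' = M \<and> \<omega>' = \<omega> \<and> m \<le> N \<and>
    R' 38 = enc N (p + 1) \<and> R' 37 = enc N (geom (p + 1) (N - m))"
  have L2: "(1 :: nat) < 2 ^ L" by (rule one_less_power) (use L in auto)
  show ?thesis unfolding cinv_def
  proof (rule wp_block_seq[where t = "N * (N * 8 + 8) + 1"], simp only: straight.simps copy_def, intro conjI)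
    show "wp L (For 39 (Seq (block [Arith Div 40 38 2, Arith Div 41 37 2]) (Seq clmul (block [Arith Bxor 37 42 2]))))
      (N * (N * 8 + 8) + 1) Q (R(38 := binop_val Bxor (R 36) (R 2), 37 := 1, 39 := binop_val Div
        ((R(38 := binop_val Bxor (R 36) (R 2), 37 := 1)) 10) ((R(38 := binop_val Bxor (R 36) (R 2), 37 := 1)) 2))) M \<omega>"
    proof (rule wp_For[where I = ?I and b = N and t = "N * 8 + 6"])
      fix m R' M' \<omega>' assume m: "m < N" "R' 39 = Suc m" "?I (Suc m) R' M' \<omega>'"
      let ?j = "N - Suc m"
      have j: "N - m = Suc ?j" using m(1) by auto
      have r: "R' 2 = 1" "R' 3 = 2" "R' 9 = 2 ^ N" "R' 10 = N" using m(3) R by auto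
      show "R' 2 = 1 \<and> wp L (Seq (block [Arith Div 40 38 2, Arith Div 41 37 2]) (Seq clmul (block [Arith Bxor 37 42 2])))
        (N * 8 + 6) (\<lambda>R M \<omega>. R 39 = m \<and> ?I m R M \<omega>) (R'(39 := m)) M' \<omega>'"
      proof (intro conjI r(1) wp_block_seq[where t = "N * 8 + 4"])
        show "straight L [Arith Div 40 38 2, Arith Div 41 37 2] (wp L (Seq clmul (block [Arith Bxor 37 42 2])) (N * 8 + 4)
          (\<lambda>R M \<omega>. R 39 = m \<and> ?I m R M \<omega>)) (R'(39 := m)) M' \<omega>'"
          using m r one
          by (simp, intro wp_seq[where ?t1.0 = "N * 8 + 3" and ?t2.0 = 1] wp_clmul[where N = N and f = "p + 1" and g = "geom (p + 1) ?j"] wp_block)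
            (simp_all add: j geom_Suc L)
      qed auto
    next
      fix R' M' \<omega>' assume "?I 0 R' M' \<omega>'"
      then show "Q R' M' \<omega>'" using Q[of R'] enc_geom[OF p, of N] by simp
    qed (use R one[of p] N in \<open>simp_all add: enc_1 add.commute[of p 1]\<close>)
  qed (use t L2 in \<open>auto simp: algebra_simps\<close>)
qed

lemma wp_Cond_true:
  assumes "R i \<noteq> 0" "wp L c1 t Q R M \<omega>"
  shows "wp L (Cond i c1 c2) (t + 1) Q R M \<omega>"
  unfolding wp_def
proof
  assume b: "bnd L R M"
  with assms(2) obtain t' R' M' \<omega>' where 1: "exec c1 ((R, M), \<omega>) t' ((R', M'), \<omega>')"
    "t' \<le> t * (1 + L)\<^sup>2" "bnd L R' M'" "Q R' M' \<omega>'" unfolding wp_def by blast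
  have "1 + len (R i) \<le> 1 * (1 + L)\<^sup>2"
    using b len_le[of "R i" L] by (simp add: bnd_def power2_eq_square)
  then have "1 + len (R i) + t' \<le> 1 * (1 + L)\<^sup>2 + t * (1 + L)\<^sup>2" using 1(2) by (rule add_mono)
  then have "1 + len (R i) + t' \<le> (t + 1) * (1 + L)\<^sup>2" by (simp add: algebra_simps)
  then show "\<exists>t' R' M' \<omega>'. exec (Cond i c1 c2) ((R, M), \<omega>) t' ((R', M'), \<omega>') \<and>
    t' \<le> (t + 1) * (1 + L)\<^sup>2 \<and> bnd L R' M' \<and> Q R' M' \<omega>'"
    using exec.CondTrue[where R = R and i = i, OF assms(1) 1(1)] 1(3,4) by blast
qed

lemma wp_Cond_false:
  assumes "R i = 0" "wp L c2 t Q R M \<omega>"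
  shows "wp L (Cond i c1 c2) (t + 1) Q R M \<omega>"
  unfolding wp_def
proof
  assume b: "bnd L R M"
  with assms(2) obtain t' R' M' \<omega>' where 1: "exec c2 ((R, M), \<omega>) t' ((R', M'), \<omega>')"
    "t' \<le> t * (1 + L)\<^sup>2" "bnd L R' M'" "Q R' M' \<omega>'" unfolding wp_def by blast
  have "1 + len (R i) \<le> 1 * (1 + L)\<^sup>2"
    using b len_le[of "R i" L] by (simp add: bnd_def power2_eq_square)
  then have "1 + len (R i) + t' \<le> 1 * (1 + L)\<^sup>2 + t * (1 + L)\<^sup>2" using 1(2) by (rule add_mono)
  then have "1 + len (R i) + t' \<le> (t + 1) * (1 + L)\<^sup>2" by (simp add: algebra_simps)
  then show "\<exists>t' R' M' \<omega>'. exec (Cond i c1 c2) ((R, M), \<omega>) t' ((R', M'), \<omega>') \<and>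
    t' \<le> (t + 1) * (1 + L)\<^sup>2 \<and> bnd L R' M' \<and> Q R' M' \<omega>'"
    using exec.CondFalse[where R = R and i = i, OF assms(1) 1(1)] 1(3,4) by blast
qed

definition pow_prog :: "nat \<Rightarrow> nat \<Rightarrow> nat \<Rightarrow> prog" where
  "pow_prog d b c = Seq (block [Imm d 1]) (For c (block [Arith Mul d d b]))"

lemma wp_pow:
  assumes "R 2 = 1 \<and> R c = e \<and> R b = x \<and> 1 \<le> x \<and> x ^ e < 2 ^ L \<and> distinct [2, b, c, d] \<and> e * 3 + 2 \<le> t"
    and Q: "\<And>R'. (\<And>i. i \<noteq> d \<Longrightarrow> i \<noteq> c \<Longrightarrow> R' i = R i) \<Longrightarrow> R' d = x ^ e \<Longrightarrow> Q R' M \<omega>"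
  shows "wp L (pow_prog d b c) t Q R M \<omega>"
proof -
  have p: "x ^ j < 2 ^ L" if "j \<le> e" for j
    using assms(1) that power_increasing[of j e x] by auto
  let ?I = "\<lambda>m R' M' \<omega>'. (\<forall>i. i \<noteq> d \<longrightarrow> i \<noteq> c \<longrightarrow> R' i = R i) \<and> M' = M \<and> \<omega>' = \<omega> \<and> m \<le> e \<and> R' d = x ^ (e - m)"
  show ?thesis unfolding pow_prog_def
  proof (rule wp_block_seq[where t = "e * 3 + 1"], simp only: straight.simps, intro conjI)
    show "1 < (2 :: nat) ^ L" using p[of 0] by simp
    show "wp L (For c (block [Arith Mul d d b])) (e * 3 + 1) Q (R(d := 1)) M \<omega>"
    proof (rule wp_For[where I = ?I and b = e and t = 1])
      fix m R' M' \<omega>' assume m: "m < e" "R' c = Suc m" "?I (Suc m) R' M' \<omega>'"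
      have j: "e - m = Suc (e - Suc m)" using m(1) by simp
      then have "x ^ (e - Suc m) * x < 2 ^ L" "x ^ (e - m) = x ^ (e - Suc m) * x" using p[of "e - m"] by (simp_all add: mult.commute)
      then show "R' 2 = 1 \<and> wp L (block [Arith Mul d d b]) 1 (\<lambda>R M \<omega>. R c = m \<and> ?I m R M \<omega>) (R'(c := m)) M' \<omega>'"
        using m assms(1) by (intro conjI wp_block) auto
    qed (use assms Q in auto)
  qed (use assms(1) in auto)
qed

lemma wp_pow_seq:
  assumes "R 2 = 1 \<and> R c = e \<and> R b = x \<and> 1 \<le> x \<and> x ^ e < 2 ^ L \<and> distinct [2, b, c, d] \<and> e * 3 + 2 \<le> t"
    and Q: "\<And>R'. (\<And>i. i \<noteq> d \<Longrightarrow> i \<noteq> c \<Longrightarrow> R' i = R i) \<Longrightarrow> R' d = x ^ e \<Longrightarrow> wp L c' (t - (e * 3 + 2)) Q R' M \<omega>"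
  shows "wp L (Seq (pow_prog d b c) c') t Q R M \<omega>"
proof -
  have "e * 3 + 2 \<le> t" using assms(1) by blast
  then have t: "e * 3 + 2 + (t - (e * 3 + 2)) \<le> t" by simp
  show ?thesis
  proof (rule wp_seq[where ?t1.0 = "e * 3 + 2" and ?t2.0 = "t - (e * 3 + 2)"])
    show "wp L (pow_prog d b c) (e * 3 + 2) (wp L c' (t - (e * 3 + 2)) Q) R M \<omega>"
      by (rule wp_pow[where x = x and e = e]) (use assms in auto)
  qed (rule t)
qed

lemma wp_blk_seq':
  assumes "p \<noteq> [] \<and> length p \<le> t" "straight L p (wp L c (t - length p) Q) R M \<omega>"
  shows "wp L (Seq (block p) c) t Q R M \<omega>"
  by (rule wp_block_seq[OF assms(2)]) (use assms(1) in auto)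

text \<open>Division drops the bits below the window and the remainder those above it; the window
  ends before the truncation at \<open>N\<close>.\<close>

lemma window_ne_0_iff:
  assumes "b + D \<le> N"
  shows "enc N (fps_of_poly p) div 2 ^ b mod 2 ^ D \<noteq> 0 \<longleftrightarrow> window D b p \<noteq> 0"
proof -
  let ?x = "enc N (fps_of_poly p) div 2 ^ b mod 2 ^ D"
  have bits: "bit ?x i \<longleftrightarrow> coeff (window D b p) i = 1" for i
    unfolding drop_bit_eq_div[symmetric] take_bit_eq_mod[symmetric]
    using assms by (auto simp: bit_take_bit_iff bit_drop_bit_eq bit_enc coeff_window)
  have "?x = 0 \<longleftrightarrow> (\<forall>i. \<not> bit ?x i)" by (auto intro: bit_eqI)
  also have "\<dots> \<longleftrightarrow> window D b p = 0" unfolding bits by (auto simp: poly_eq_iff)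
  finally show ?thesis by (rule arg_cong[where f = Not])
qed

text \<open>The bit order is reversed because the labelling loop counts \<open>j\<close> down while
  it consumes the low bits of \<open>A\<close> first.\<close>

lemma sum_bit_sets:
  "(\<Sum>A<2 ^ k. g {j. j < k \<and> bit (A :: nat) (k - Suc j)}) = (\<Sum>S\<in>Pow {..<k}. g S)"
proof -
  let ?S = "\<lambda>A :: nat. {j. j < k \<and> bit A (k - Suc j)}"
  have inj: "inj_on ?S {..<2 ^ k}"
  proof (rule inj_onI)
    fix A B :: nat assume AB: "A \<in> {..<2 ^ k}" "B \<in> {..<2 ^ k}" "?S A = ?S B"
    show "A = B"
    proof (rule bit_eqI)
      fix i
      show "bit A i \<longleftrightarrow> bit B i"
      proof (cases "i < k")
        case True
        then have "k - Suc i < k" "k - Suc (k - Suc i) = i" by auto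
        then show ?thesis using AB(3) by (auto simp: set_eq_iff dest!: spec[of _ "k - Suc i"])
      next
        case False
        have "take_bit k A = A" "take_bit k B = B" using AB by (simp_all add: take_bit_nat_eq_self)
        then show ?thesis using False by (metis bit_take_bit_iff)
      qed
    qed
  qed
  have "?S ` {..<2 ^ k} = Pow {..<k}"
    by (rule card_subset_eq) (use inj in \<open>auto simp: card_image card_Pow\<close>)
  with sum.reindex[OF inj, of g] show ?thesis by simp
qed


section \<open>The algorithm\<close>

declare One_nat_def [simp del]

lemma wp_clmul_seq:
  assumes "R 2 = 1" "R 3 = 2" "R 9 = 2 ^ N" "R 10 = N" "R 40 = enc N f" "R 41 = enc N g" "N < L"
    and "\<And>R'. (\<And>i. i < 40 \<Longrightarrow> R' i = R i) \<Longrightarrow> R' 42 = enc N (f * g) \<Longrightarrow> wp L c t2 Q R' M \<omega>"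
    and "N * 8 + 3 + t2 \<le> t"
  shows "wp L (Seq clmul c) t Q R M \<omega>"
proof (rule wp_seq[OF _ assms(9)])
  show "wp L clmul (N * 8 + 3) (wp L c t2 Q) R M \<omega>"
    by (rule wp_clmul[OF assms(1-7) _ order.refl]) (rule assms(8))
qed

text \<open>
  Registers: 0, 1 hold $n$, $k$; 4, 5, 6, 11 hold $4n^2$, $n^2$, $2n^2$, $3n^2$; 7, 8 hold $2^D$, $2^{Dn}$, by which
  multiplication is a shift; 12 accumulates the determinants; 13 is the power of two that shifts
  out everything below the window; 14 counts the subsets $A$, encoded by their bits. Inner loops use higher registers, so that
  the frame of a subprogram is an initial segment of the registers.

  Memory: the adjacency matrix in $[0, n^2)$, the random values in $[n^2, 4n^2)$, and from $4n^2$ on the matrix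
  whose row $v$ describes the arcs into $v$.
\<close>

definition addr :: "nat \<Rightarrow> nat \<Rightarrow> nat \<Rightarrow> nat \<Rightarrow> prog list" where
  "addr r b i j = [Arith Mul r i 0, Arith Add r r j, Arith Add r r b]"

text \<open>For the tail \<open>u\<close> in register 17 and the label set encoded in 14, the sum of
  the \<open>a\<close>-variables goes to 18.\<close>

definition label_prog :: prog where
  "label_prog = Seq (block [Imm 18 0, copy 19 14, copy 20 1])
    (For 20 (block (addr 21 11 17 20 @ [Load 22 21, Arith Mod 23 19 3, Arith Mul 22 22 23,
       Arith Bxor 18 18 22, Arith Div 19 19 3])))"

text \<open>Tail in 17, head in 15, weight left in 26. The final multiplication by the adjacency bit
  handles missing arcs without branching.\<close>

definition weight_prog :: prog where
  "weight_prog = Seq label_prog (Seq (block [Arith Mul 24 17 0, Arith Add 24 24 15, Load 25 24,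
       Arith Add 26 24 5, Load 26 26, Arith Add 40 24 6, Load 40 40, copy 41 18])
     (Seq clmul (block [Arith Mul 42 42 8, Arith Mod 42 42 9, Arith Mul 26 26 7, Arith Mod 26 26 9,
       Arith Bxor 26 26 42, Arith Mul 26 26 25])))"

text \<open>Register 16 accumulates 1 (the virtual arc) plus all weights into the vertex; the last
  block adds it to the diagonal.\<close>

definition row_prog :: prog where
  "row_prog = Seq (block [Imm 16 1, copy 17 0])
    (Seq (For 17 (Seq weight_prog (block (addr 27 4 15 17 @ [Store 27 26, Arith Bxor 16 16 26]))))
      (block (addr 27 4 15 15 @ [Load 28 27, Arith Bxor 28 28 16, Store 27 28])))"

definition build_prog :: prog where
  "build_prog = Seq (block [copy 15 0]) (For 15 row_prog)"

section \<open>Filling the weighted Laplacian\<close>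

text \<open>\<open>4 * n ^ 4\<close> equals \<open>2 * N\<close>, the length of an integer product
  of two truncated series. All memory addresses in use stay below \<open>5 * (n * n)\<close>, hence
  below \<open>2 ^ L\<close>; the 8 covers small constants.\<close>

locale sieve_machine =
  fixes n k L :: nat and Ar :: "(nat \<times> nat) set" and \<rho> :: "nat \<Rightarrow> bit poly"
  assumes k: "k < n" and L: "4 * n ^ 4 + 5 * (n * n) + 8 \<le> L"
begin

text \<open>At most \<open>n - 1\<close> arcs with two factors of degree at most
  \<open>n - 1\<close> each have total degree below \<open>2 * n^2\<close>. \<open>N\<close> then
  makes room for \<open>n^2\<close> windows, and the window that is read has index
  \<open>n * k + (n - 1 - k) < n^2\<close>.\<close>

definition D where "D = 2 * (n * n)"
definition N where "N = n * n * D"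

definition glob :: "(nat \<Rightarrow> nat) \<Rightarrow> bool" where
  "glob R \<longleftrightarrow> R 0 = n \<and> R 1 = k \<and> R 2 = 1 \<and> R 3 = 2 \<and> R 4 = 4 * (n * n) \<and> R 5 = n * n \<and>
    R 6 = 2 * (n * n) \<and> R 7 = 2 ^ D \<and> R 8 = 2 ^ (D * n) \<and> R 9 = 2 ^ N \<and> R 10 = N \<and> R 11 = 3 * (n * n)"

definition inp :: "(nat \<Rightarrow> nat) \<Rightarrow> bool" where
  "inp M \<longleftrightarrow> (\<forall>u<n. \<forall>v<n. M (u * n + v) = of_bool ((u, v) \<in> Ar)) \<and>
     (\<forall>i<3 * (n * n). M (n * n + i) = enc N (fps_of_poly (\<rho> i)))"

lemma n: "0 < n" using k by simp

lemma N_eq: "N = 2 * n ^ 4" by (simp add: N_def D_def power4_eq_xxxx)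

lemma N_less_L: "2 * N + 5 * (n * n) + 8 \<le> L" using L by (simp add: N_eq)

lemma N_lt_L [simp]: "N < L" using N_less_L by simp

lemma N_pos: "0 < N" using n by (simp add: N_eq)

lemma shift_le_N: "D * n \<le> N" "D \<le> N"
  using n by (simp_all add: N_def)

lemma addr_bound: "x < 5 * (n * n) \<Longrightarrow> x < 2 ^ L"
proof -
  assume "x < 5 * (n * n)"
  also have "\<dots> \<le> L" using N_less_L by simp
  also have "L < 2 ^ L" by (rule less_exp)
  finally show ?thesis .
qed

lemma prod_bound: "a \<le> 2 ^ N \<Longrightarrow> b \<le> 2 ^ N \<Longrightarrow> a * b < (2 :: nat) ^ L"
proof -
  assume "a \<le> 2 ^ N" "b \<le> 2 ^ N"
  then have "a * b \<le> 2 ^ N * 2 ^ N" by (rule mult_le_mono)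
  also have "\<dots> = (2 :: nat) ^ (2 * N)" by (simp flip: power_add)
  also have "\<dots> < 2 ^ L" using N_less_L by (intro power_strict_increasing) auto
  finally show ?thesis .
qed

lemma enc_le: "enc N f \<le> 2 ^ N" using enc_less[of N f] by simp

lemma pow_le: "2 ^ D \<le> (2 :: nat) ^ N" "2 ^ (D * n) \<le> (2 :: nat) ^ N" "(1 :: nat) \<le> 2 ^ N"
  using shift_le_N by (simp_all add: power_increasing)

lemma consts_less: "1 < (2 :: nat) ^ L" "2 < (2 :: nat) ^ L" "0 < (2 :: nat) ^ L"
proof -
  have "(2 :: nat) ^ 2 \<le> 2 ^ L" using N_less_L by (intro power_increasing) auto
  then show "1 < (2 :: nat) ^ L" "2 < (2 :: nat) ^ L" "0 < (2 :: nat) ^ L" by auto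
qed

lemma cell_less: "u < n \<Longrightarrow> v < n \<Longrightarrow> u * n + v < n * n"
  using idx_less[of u n v 0 1] by (simp add: idx_def)

lemma row_less: "u < n \<Longrightarrow> u * n < n * n"
  using n by simp

lemma glob_frame: "glob R \<Longrightarrow> (\<And>i. i < 12 \<Longrightarrow> R' i = R i) \<Longrightarrow> glob R'"
  by (simp add: glob_def)

lemma inp_frame: "inp M \<Longrightarrow> (\<And>a. a < 4 * (n * n) \<Longrightarrow> M' a = M a) \<Longrightarrow> inp M'"
proof -
  assume i: "inp M" and M': "\<And>a. a < 4 * (n * n) \<Longrightarrow> M' a = M a"
  have "M' (u * n + v) = M (u * n + v)" if "u < n" "v < n" for u v
    using cell_less[OF that] by (intro M') simp
  moreover have "M' (n * n + j) = M (n * n + j)" if "j < 3 * (n * n)" for j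
    using that by (intro M') simp
  ultimately show ?thesis using i by (simp add: inp_def)
qed

lemma inp_mem:
  assumes i: "inp M" and u: "u < n" "v < n"
  shows "M (u * n + v) = of_bool ((u, v) \<in> Ar)"
    "M (u * n + v + n * n) = enc N (fps_of_poly (\<rho> (idx n 0 u v)))"
    "M (u * n + v + 2 * (n * n)) = enc N (fps_of_poly (\<rho> (idx n 1 u v)))"
    "M (u * n + v + 3 * (n * n)) = enc N (fps_of_poly (\<rho> (idx n 2 u v)))"
proof -
  show "M (u * n + v) = of_bool ((u, v) \<in> Ar)" using i u by (simp add: inp_def)
  have *: "M (n * n + idx n c u v) = enc N (fps_of_poly (\<rho> (idx n c u v)))" if "c < 3" for c
    using i idx_less[OF u that] unfolding inp_def by blast
  have "n * n + idx n 0 u v = u * n + v + n * n" "n * n + idx n 1 u v = u * n + v + 2 * (n * n)"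
    "n * n + idx n 2 u v = u * n + v + 3 * (n * n)" by (simp_all add: idx_def)
  note eq = this
  show "M (u * n + v + n * n) = enc N (fps_of_poly (\<rho> (idx n 0 u v)))"
    "M (u * n + v + 2 * (n * n)) = enc N (fps_of_poly (\<rho> (idx n 1 u v)))"
    "M (u * n + v + 3 * (n * n)) = enc N (fps_of_poly (\<rho> (idx n 2 u v)))"
    using *[of 0] *[of 1] *[of 2] by (simp_all only: eq)
qed

lemma globD:
  assumes "glob R"
  shows "R 0 = n" "R 1 = k" "R 2 = 1" "R 3 = 2" "R 4 = 4 * (n * n)" "R 5 = n * n"
    "R 6 = 2 * (n * n)" "R 7 = 2 ^ D" "R 8 = 2 ^ (D * n)" "R 9 = 2 ^ N" "R 10 = N" "R 11 = 3 * (n * n)"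
  using assms by (auto simp: glob_def)

definition label :: "nat \<Rightarrow> nat \<Rightarrow> bit poly" where
  "label A u = (\<Sum>j\<in>{j. j < k \<and> bit A (k - Suc j)}. \<rho> (idx n 2 u j))"

definition wt :: "nat \<Rightarrow> nat \<Rightarrow> nat \<Rightarrow> bit fps" where
  "wt A u v = fps_of_poly (arc_weight Ar D n (\<lambda>u v. \<rho> (idx n 0 u v)) (\<lambda>u v. \<rho> (idx n 1 u v)) (label A) u v)"

definition entry :: "nat \<Rightarrow> nat \<Rightarrow> nat \<Rightarrow> bit fps" where
  "entry A v i = wt A i v + of_bool (i = v) * (1 + (\<Sum>u<n. wt A u v))"

lemma wp_label:
  assumes g: "glob R" and i: "inp M" and A: "R 14 = A" and u: "R 17 = u" "u < n"
    and Q: "\<And>R'. (\<And>i. i < 18 \<Longrightarrow> R' i = R i) \<Longrightarrow> R' 18 = enc N (fps_of_poly (label A u)) \<Longrightarrow> Q R' M \<omega>"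
    and t: "k * 11 + 4 \<le> t"
  shows "wp L label_prog t Q R M \<omega>"
proof -
  note G = globD[OF g]
  \<comment> \<open>The labels summed so far when \<open>m\<close> rounds remain.\<close>
  define S where "S m = {j. m \<le> j \<and> j < k \<and> bit A (k - Suc j)}" for m
  have S0: "S 0 = {j. j < k \<and> bit A (k - Suc j)}" and Sk: "S k = {}" by (auto simp: S_def)
  have SS: "S m = (if bit A (k - Suc m) then insert m (S (Suc m)) else S (Suc m))" if "m < k" for m
    using that by (auto simp: S_def Suc_le_eq le_less)
  have Sn: "m \<notin> S (Suc m)" "finite (S m)" for m by (auto simp: S_def)
  let ?e = "\<lambda>m. enc N (fps_of_poly (\<Sum>j\<in>S m. \<rho> (idx n 2 u j)))"
  have step: "?e m = xor (?e (Suc m)) (enc N (fps_of_poly (\<rho> (idx n 2 u m))) * (A div 2 ^ (k - Suc m) mod 2))"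
    if "m < k" for m
    using Sn SS[OF that] by (auto simp: bit_iff_odd odd_iff_mod_2_eq_one fps_of_poly_add enc_add add.commute)
  let ?I = "\<lambda>m R' M' \<omega>'. (\<forall>i<18. R' i = R i) \<and> M' = M \<and> \<omega>' = \<omega> \<and> m \<le> k \<and>
    R' 19 = A div 2 ^ (k - m) \<and> R' 18 = ?e m"
  show ?thesis unfolding label_prog_def
  proof (rule wp_block_seq[where t = "k * 11 + 1"])
    show "straight L [Imm 18 0, copy 19 14, copy 20 1] (wp L (For 20 (block (addr 21 11 17 20 @ [Load 22 21,
       Arith Mod 23 19 3, Arith Mul 22 22 23, Arith Bxor 18 18 22, Arith Div 19 19 3]))) (k * 11 + 1) Q) R M \<omega>"
      unfolding copy_def
    proof (simp add: G consts_less A, rule wp_For[where I = ?I and b = k and t = 9])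
      fix m R' M' \<omega>' assume m: "m < k" "R' 20 = Suc m" "?I (Suc m) R' M' \<omega>'"
      have r: "R' 0 = n" "R' 2 = 1" "R' 3 = 2" "R' 5 = n * n" "R' 6 = 2 * (n * n)" "R' 11 = 3 * (n * n)" "R' 17 = u"
        using m(3) G u by auto
      have mem: "M (u * n + m + 3 * (n * n)) = enc N (fps_of_poly (\<rho> (idx n 2 u m)))"
        using inp_mem(4)[OF i u(2), of m] m(1) k by simp
      have un: "u * n < n * n" "u * n + m < n * n" using u m(1) k cell_less[of u m] row_less by auto
      have ad: "u * n < 2 ^ L" "u * n + m < 2 ^ L" "u * n + m + 3 * (n * n) < 2 ^ L"
        by (rule addr_bound, use un in linarith)+
      have pb: "enc N (fps_of_poly (\<rho> (idx n 2 u m))) * (A div 2 ^ (k - Suc m) mod 2) < 2 ^ L"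
        using enc_le pow_le(3) by (intro prod_bound) (auto intro: order.trans[of _ 1])
      have dv: "A div 2 ^ (k - Suc m) div 2 = A div 2 ^ (k - m)"
        using m(1) by (simp add: div_mult2_eq[symmetric] Suc_diff_Suc flip: power_Suc2)
      show "R' 2 = 1 \<and> wp L (block (addr 21 11 17 20 @ [Load 22 21,
       Arith Mod 23 19 3, Arith Mul 22 22 23, Arith Bxor 18 18 22, Arith Div 19 19 3])) 9
         (\<lambda>R M \<omega>. R 20 = m \<and> ?I m R M \<omega>) (R'(20 := m)) M' \<omega>'"
        using m r by (intro conjI wp_block) (simp_all add: addr_def ad mem pb dv step)
    next
      fix R' M' \<omega>' assume "R' 20 = 0" "?I 0 R' M' \<omega>'"
      then show "Q R' M' \<omega>'" using Q[of R'] by (simp add: S0 label_def)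
    qed (use G in \<open>auto simp: Sk enc_0\<close>)
  qed (use t in auto)
qed

lemma wt_eq:
  assumes "u < n"
  shows "wt A u v = of_bool ((u, v) \<in> Ar) * (fps_X ^ D * fps_of_poly (\<rho> (idx n 0 u v)) +
    fps_X ^ (D * n) * (fps_of_poly (\<rho> (idx n 1 u v)) * fps_of_poly (label A u)))"
  using assms by (simp add: wt_def arc_weight_def fps_of_poly_add fps_of_poly_mult fps_of_poly_monom')

lemma wp_weight:
  assumes g: "glob R" and i: "inp M" and A: "R 14 = A" and u: "R 17 = u" "u < n" and v: "R 15 = v" "v < n"
    and Q: "\<And>R'. (\<And>i. i < 18 \<Longrightarrow> R' i = R i) \<Longrightarrow> R' 26 = enc N (wt A u v) \<Longrightarrow> Q R' M \<omega>"
    and t: "k * 11 + N * 8 + 21 \<le> t"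
  shows "wp L weight_prog t Q R M \<omega>"
  unfolding weight_prog_def
proof (rule wp_seq[where ?t1.0 = "k * 11 + 4" and ?t2.0 = "N * 8 + 17"], rule wp_label[OF g i A u])
  fix R' assume R': "\<And>i. i < 18 \<Longrightarrow> R' i = R i" "R' 18 = enc N (fps_of_poly (label A u))"
  have g': "glob R'" by (rule glob_frame[OF g]) (simp add: R')
  note G = globD[OF g']
  have un: "u * n < n * n" "u * n + v < n * n" using u v cell_less[of u v] row_less by auto
  have ad: "u * n < 2 ^ L" "u * n + v < 2 ^ L" "u * n + v + n * n < 2 ^ L" "u * n + v + 2 * (n * n) < 2 ^ L"
    by (rule addr_bound, use un in linarith)+
  define e :: nat where "e = of_bool ((u, v) \<in> Ar)"
  note mem = inp_mem[OF i u(2) v(2), folded e_def]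
  let ?c = "block [Arith Mul 42 42 8, Arith Mod 42 42 9, Arith Mul 26 26 7, Arith Mod 26 26 9,
       Arith Bxor 26 26 42, Arith Mul 26 26 25]"
  show "wp L (Seq (block [Arith Mul 24 17 0, Arith Add 24 24 15, Load 25 24,
       Arith Add 26 24 5, Load 26 26, Arith Add 40 24 6, Load 40 40, copy 41 18])
     (Seq clmul ?c)) (N * 8 + 17) Q R' M \<omega>"
  proof (rule wp_block_seq[where t = "N * 8 + 9"])
    show "straight L [Arith Mul 24 17 0, Arith Add 24 24 15, Load 25 24,
       Arith Add 26 24 5, Load 26 26, Arith Add 40 24 6, Load 40 40, copy 41 18] (wp L (Seq clmul ?c) (N * 8 + 9) Q) R' M \<omega>"
      unfolding copy_def
    proof (simp add: G R' u v ad mem, rule wp_clmul_seq[where N = N and f = "fps_of_poly (\<rho> (idx n 1 u v))"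
          and g = "fps_of_poly (label A u)" and ?t2.0 = 6])
      fix R'' assume R'': "\<And>i. i < 40 \<Longrightarrow> R'' i = (R'(24 := u * n + v, 25 := e,
        26 := enc N (fps_of_poly (\<rho> (idx n 0 u v))), 40 := enc N (fps_of_poly (\<rho> (idx n 1 u v))),
        41 := enc N (fps_of_poly (label A u)))) i"
        "R'' 42 = enc N (fps_of_poly (\<rho> (idx n 1 u v)) * fps_of_poly (label A u))"
      have pb: "enc N f * 2 ^ D < 2 ^ L" "enc N f * 2 ^ (D * n) < 2 ^ L" "enc N f < 2 ^ L" for f
        using prod_bound[OF enc_le[of f] pow_le(3)]
        by (auto intro: prod_bound enc_le pow_le)
      have eq: "xor (enc N (fps_X ^ D * fps_of_poly (\<rho> (idx n 0 u v))))
          (enc N (fps_X ^ (D * n) * (fps_of_poly (\<rho> (idx n 1 u v)) * fps_of_poly (label A u)))) * e =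
          enc N (wt A u v)"
        by (simp add: e_def enc_add enc_0 wt_eq[OF u(2)])
      show "wp L ?c 6 Q R'' M \<omega>"
        by (rule wp_block) (simp_all add: R'' G R' pb enc_shift[symmetric] eq Q)
    qed (simp_all add: G R')
  qed auto
qed (use t in auto)

lemma wp_row:
  assumes g: "glob R" and i: "inp M" and A: "R 14 = A" and v: "R 15 = v" "v < n"
    and Q: "\<And>R' M'. (\<And>i. i < 16 \<Longrightarrow> R' i = R i) \<Longrightarrow>
      (\<And>a. a < 4 * (n * n) + v * n \<or> 4 * (n * n) + v * n + n \<le> a \<Longrightarrow> M' a = M a) \<Longrightarrow>
      (\<And>i. i < n \<Longrightarrow> M' (4 * (n * n) + v * n + i) = enc N (entry A v i)) \<Longrightarrow> Q R' M' \<omega>"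
    and t: "n * (k * 11 + N * 8 + 28) + 9 \<le> t"
  shows "wp L row_prog t Q R M \<omega>"
proof -
  note G = globD[OF g]
  let ?b = "4 * (n * n) + v * n"
  let ?tw = "k * 11 + N * 8 + 21"
  let ?I = "\<lambda>m R' M' \<omega>'. (\<forall>i<16. R' i = R i) \<and> \<omega>' = \<omega> \<and> m \<le> n \<and>
    (\<forall>a. a < ?b \<or> ?b + n \<le> a \<longrightarrow> M' a = M a) \<and> (\<forall>i. m \<le> i \<and> i < n \<longrightarrow> M' (?b + i) = enc N (wt A i v)) \<and>
    R' 16 = enc N (1 + (\<Sum>u=m..<n. wt A u v))"
  have ad: "v * n < 2 ^ L" "v * n + i < 2 ^ L" "v * n + i + 4 * (n * n) < 2 ^ L" if "i < n" for i
    by (rule addr_bound, use row_less[OF v(2)] cell_less[OF v(2) that] in linarith)+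
  have vb: "a < ?b \<or> ?b + n \<le> a" if "a < 4 * (n * n)" for a using that by simp
  have one: "enc N 1 = 1" using N_pos by (rule enc_1)
  let ?c = "block (addr 27 4 15 17 @ [Store 27 26, Arith Bxor 16 16 26])"
  let ?d = "block (addr 27 4 15 15 @ [Load 28 27, Arith Bxor 28 28 16, Store 27 28])"
  show ?thesis unfolding row_prog_def
  proof (rule wp_block_seq[where t = "n * (?tw + 7) + 7"])
    show "straight L [Imm 16 1, copy 17 0] (wp L (Seq (For 17 (Seq weight_prog ?c)) ?d) (n * (?tw + 7) + 7) Q) R M \<omega>"
      unfolding copy_def
    proof (simp add: G consts_less, rule wp_seq[where ?t1.0 = "n * (?tw + 7) + 1" and ?t2.0 = 6],
        rule wp_For[where I = ?I and b = n and t = "?tw + 5"])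
      fix m R' M' \<omega>' assume m: "m < n" "R' 17 = Suc m" "?I (Suc m) R' M' \<omega>'"
      let ?R = "R'(17 := m)"
      have g': "glob ?R" by (rule glob_frame[OF g]) (use m(3) in auto)
      have i': "inp M'" by (rule inp_frame[OF i]) (use m(3) vb in blast)
      have r: "R' 15 = v" "R' 14 = A" using m(3) v A by auto
      have S: "(\<Sum>u=m..<n. wt A u v) = wt A m v + (\<Sum>u=Suc m..<n. wt A u v)"
        using m(1) by (simp add: sum.atLeast_Suc_lessThan)
      show "R' 2 = 1 \<and> wp L (Seq weight_prog ?c) (?tw + 5) (\<lambda>R M \<omega>. R 17 = m \<and> ?I m R M \<omega>) ?R M' \<omega>'"
      proof (intro conjI wp_seq[where ?t1.0 = ?tw and ?t2.0 = 5])
        show "R' 2 = 1" using m(3) G by simp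
        show "wp L weight_prog ?tw (wp L ?c 5 (\<lambda>R M \<omega>. R 17 = m \<and> ?I m R M \<omega>)) ?R M' \<omega>'"
        proof (rule wp_weight[OF g' i', where u = m and v = v and A = A])
          fix R'' assume R'': "\<And>i. i < 18 \<Longrightarrow> R'' i = ?R i" "R'' 26 = enc N (wt A m v)"
          have r'': "R'' 0 = n" "R'' 4 = 4 * (n * n)" "R'' 15 = v" "R'' 17 = m"
            "R'' 16 = enc N (1 + (\<Sum>u=Suc m..<n. wt A u v))" "\<forall>i<16. R'' i = R i"
            using R'' m(3) G v by auto
          have c: "v * n + m + 4 * (n * n) = ?b + m" by simp
          show "wp L ?c 5 (\<lambda>R M \<omega>. R 17 = m \<and> ?I m R M \<omega>) R'' M' \<omega>'"
          proof (rule wp_block)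
            show "straight L (addr 27 4 15 17 @ [Store 27 26, Arith Bxor 16 16 26])
              (\<lambda>R M \<omega>. R 17 = m \<and> ?I m R M \<omega>) R'' M' \<omega>'"
              using m(1,3) r'' ad[OF m(1)]
              by (simp add: addr_def R''(2) c enc_add S add_ac)
          qed (simp_all add: addr_def)
        qed (use m r v(2) in auto)
      qed simp
    next
      fix R' M' \<omega>' assume R': "?I 0 R' M' \<omega>'"
      then have r': "R' 0 = n" "R' 4 = 4 * (n * n)" "R' 15 = v"
            "R' 16 = enc N (1 + (\<Sum>u=0..<n. wt A u v))" "M' (?b + v) = enc N (wt A v v)"
        using G v by auto
      have c: "v * n + v + 4 * (n * n) = ?b + v" by simp
      have e: "entry A v v = wt A v v + (1 + (\<Sum>u=0..<n. wt A u v))"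
        by (simp add: entry_def atLeast0LessThan)
      have e': "entry A v i = wt A i v" if "i \<noteq> v" for i using that by (simp add: entry_def)
      show "wp L ?d 6 Q R' M' \<omega>'"
      proof (rule wp_block)
        have "Q (R'(27 := ?b + v, 28 := enc N (entry A v v))) (M'(?b + v := enc N (entry A v v))) \<omega>"
          by (rule Q) (use R' v e' in auto)
        then show "straight L (addr 27 4 15 15 @ [Load 28 27, Arith Bxor 28 28 16, Store 27 28]) Q R' M' \<omega>'"
          using R' r' ad[OF v(2)] by (simp add: addr_def c enc_add e[symmetric])
      qed (simp_all add: addr_def)
    qed (use G v one in \<open>auto\<close>)
  qed (use t in \<open>auto simp: algebra_simps\<close>)
qed

lemma wp_build:
  assumes g: "glob R" and i: "inp M" and A: "R 14 = A"
    and Q: "\<And>R' M'. (\<And>i. i < 15 \<Longrightarrow> R' i = R i) \<Longrightarrow> (\<And>a. a < 4 * (n * n) \<Longrightarrow> M' a = M a) \<Longrightarrow>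
      (\<And>v i. v < n \<Longrightarrow> i < n \<Longrightarrow> M' (4 * (n * n) + v * n + i) = enc N (entry A v i)) \<Longrightarrow> Q R' M' \<omega>"
    and t: "n * (n * (k * 11 + N * 8 + 28) + 11) + 2 \<le> t"
  shows "wp L build_prog t Q R M \<omega>"
proof -
  note G = globD[OF g]
  let ?tr = "n * (k * 11 + N * 8 + 28) + 9"
  let ?b = "\<lambda>v. 4 * (n * n) + v * n"
  let ?I = "\<lambda>m R' M' \<omega>'. (\<forall>i<15. R' i = R i) \<and> \<omega>' = \<omega> \<and> m \<le> n \<and>
    (\<forall>a<4 * (n * n). M' a = M a) \<and> (\<forall>v i. m \<le> v \<and> v < n \<and> i < n \<longrightarrow> M' (?b v + i) = enc N (entry A v i))"
  show ?thesis unfolding build_prog_def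
  proof (rule wp_block_seq[where t = "n * (?tr + 2) + 1"])
    show "straight L [copy 15 0] (wp L (For 15 row_prog) (n * (?tr + 2) + 1) Q) R M \<omega>"
      unfolding copy_def
    proof (simp add: G, rule wp_For[where I = ?I and b = n and t = ?tr])
      fix m R' M' \<omega>' assume m: "m < n" "R' 15 = Suc m" "?I (Suc m) R' M' \<omega>'"
      let ?R = "R'(15 := m)"
      have g': "glob ?R" by (rule glob_frame[OF g]) (use m(3) in auto)
      have i': "inp M'" by (rule inp_frame[OF i]) (use m(3) in blast)
      have "wp L row_prog ?tr (\<lambda>R M \<omega>. R 15 = m \<and> ?I m R M \<omega>) ?R M' \<omega>'"
      proof (rule wp_row[OF g' i', where v = m and A = A])
        fix R'' M'' assume R'': "\<And>i. i < 16 \<Longrightarrow> R'' i = ?R i"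
          and M'': "\<And>a. a < ?b m \<or> ?b m + n \<le> a \<Longrightarrow> M'' a = M' a"
          "\<And>i. i < n \<Longrightarrow> M'' (?b m + i) = enc N (entry A m i)"
        have "M'' (?b v + i) = enc N (entry A v i)" if "m \<le> v" "v < n" "i < n" for v i
        proof (cases "v = m")
          case False
          then have "Suc m * n \<le> v * n" using that by (intro mult_le_mono1) simp
          then have "?b m + n \<le> ?b v + i" by simp
          then show ?thesis using M''(1) m(3) that False by (simp add: Suc_le_eq)
        qed (use M''(2) that in simp)
        moreover have "M'' a = M a" if "a < 4 * (n * n)" for a using M''(1)[of a] m(3) that by simp
        ultimately show "R'' 15 = m \<and> ?I m R'' M'' \<omega>'" using R'' m by auto
      qed (use m A in auto)
      then show "R' 2 = 1 \<and> wp L row_prog ?tr (\<lambda>R M \<omega>. R 15 = m \<and> ?I m R M \<omega>) ?R M' \<omega>'"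
        using m(3) G by auto
    qed (use G Q in \<open>auto\<close>)
  qed (use t in \<open>auto simp: algebra_simps\<close>)
qed

end

section \<open>Gaussian elimination on the machine\<close>

text \<open>One row operation: 15 holds the pivot index \<open>p\<close>, 18 the row and 19 the
  multiplier. Only columns below \<open>p\<close> are changed, since later rounds read nothing but
  the leading block.\<close>

definition cols_prog :: prog where
  "cols_prog = Seq (block [copy 20 15]) (For 20 (Seq (block (addr 24 4 15 20 @ [Load 41 24, copy 40 19]))
     (Seq clmul (block (addr 25 4 18 20 @ [Load 26 25, Arith Bxor 26 26 42, Store 25 26])))))"

definition rows_prog :: prog where
  "rows_prog = Seq (block [copy 18 15]) (For 18 (Seq (block (addr 24 4 18 15 @ [Load 40 24, copy 41 17]))
     (Seq clmul (Seq (block [copy 19 42]) cols_prog))))"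

text \<open>Register 15 runs through the pivots from the last one down, 16 collects their product,
  and 17 keeps the inverse of the current pivot.\<close>

definition elim_prog :: prog where
  "elim_prog = Seq (block [Imm 16 1, copy 15 0]) (For 15
     (Seq (block (addr 24 4 15 15 @ [Load 36 24, copy 40 16, copy 41 36]))
     (Seq clmul (Seq (block [copy 16 42]) (Seq cinv (Seq (block [copy 17 37]) rows_prog))))))"

context sieve_machine
begin

abbreviation base :: "nat \<Rightarrow> nat" where "base i \<equiv> 4 * (n * n) + i * n"

lemma row_disjoint:
  assumes "i \<noteq> i'" "j < n"
  shows "base i + j < base i' \<or> base i' + n \<le> base i + j"
proof (cases "i < i'")
  case True
  then have "Suc i * n \<le> i' * n" by (intro mult_le_mono1) simp
  then show ?thesis using assms by simp
next
  case False
  then have "Suc i' * n \<le> i * n" using assms by (intro mult_le_mono1) simp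
  then show ?thesis by simp
qed

lemma addr_ok:
  shows "i < n \<Longrightarrow> i * n < 2 ^ L" "i < n \<Longrightarrow> j < n \<Longrightarrow> i * n + j < 2 ^ L"
    "i < n \<Longrightarrow> j < n \<Longrightarrow> i * n + j + 4 * (n * n) < 2 ^ L"
  by (rule addr_bound, use row_less[of i] cell_less[of i j] in linarith)+

definition T_cols where "T_cols = n * (N * 8 + 16) + 2"
definition T_rows where "T_rows = n * (N * 8 + 11 + T_cols) + 2"
definition T_pivot where "T_pivot = N * 8 + N * (N * 8 + 8) + T_rows + 15"
definition T_elim where "T_elim = n * (T_pivot + 2) + 3"

lemma wp_cols:
  assumes g: "glob R" and R: "R 15 = p" "R 18 = i" "R 19 = enc N f" and p: "p < n" "i < p"
    and P: "\<And>j. j < p \<Longrightarrow> M (base p + j) = enc N (F j)"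
    and I: "\<And>j. j < p \<Longrightarrow> M (base i + j) = enc N (G j)"
    and Q: "\<And>R' M'. (\<And>i. i < 20 \<Longrightarrow> R' i = R i) \<Longrightarrow>
      (\<And>a. a < base i \<or> base i + p \<le> a \<Longrightarrow> M' a = M a) \<Longrightarrow>
      (\<And>j. j < p \<Longrightarrow> M' (base i + j) = enc N (G j + f * F j)) \<Longrightarrow> Q R' M' \<omega>"
  shows "wp L cols_prog T_cols Q R M \<omega>"
proof -
  note G = globD[OF g]
  let ?I = "\<lambda>m R' M' \<omega>'. (\<forall>i<20. R' i = R i) \<and> \<omega>' = \<omega> \<and> m \<le> p \<and>
    (\<forall>a. a < base i + m \<or> base i + p \<le> a \<longrightarrow> M' a = M a) \<and>
    (\<forall>j. m \<le> j \<and> j < p \<longrightarrow> M' (base i + j) = enc N (G j + f * F j))"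
  let ?c = "block (addr 25 4 18 20 @ [Load 26 25, Arith Bxor 26 26 42, Store 25 26])"
  let ?b = "Seq (block (addr 24 4 15 20 @ [Load 41 24, Arith Div 40 19 2])) (Seq clmul ?c)"
  show ?thesis unfolding cols_prog_def copy_def
  proof (rule wp_block_seq[where t = "p * (N * 8 + 14 + 2) + 1"])
    show "straight L [Arith Div 20 15 2] (wp L (For 20 ?b) (p * (N * 8 + 14 + 2) + 1) Q) R M \<omega>"
    proof (simp only: straight.simps, intro conjI, simp, rule wp_For[where I = ?I and b = p and t = "N * 8 + 14"])
      fix m R' M' \<omega>' assume m: "m < p" "R' 20 = Suc m" "?I (Suc m) R' M' \<omega>'"
      have r: "R' 0 = n" "R' 2 = 1" "R' 3 = 2" "R' 4 = 4 * (n * n)" "R' 9 = 2 ^ N" "R' 10 = N"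
        "R' 15 = p" "R' 18 = i" "R' 19 = enc N f" using m(3) G R by auto
      have mn: "m < n" "i < n" using m(1) p by auto
      \<comment> \<open>The pivot row is a different row and still has its initial contents.\<close>
      have "base p + m < base i + Suc m \<or> base i + p \<le> base p + m"
        using row_disjoint[of p i m] p mn by auto
      then have "M' (base p + m) = M (base p + m)" using m(3) by blast
      then have M'p: "M' (p * n + m + 4 * (n * n)) = enc N (F m)"
        using P[OF m(1)] by (simp add: add_ac)
      have M'i: "M' (i * n + m + 4 * (n * n)) = enc N (G m)"
        using m(3) I[OF m(1)] by (simp add: add_ac)
      have c: "i * n + m + 4 * (n * n) = base i + m" by simp
      define J where "J = (\<lambda>R M \<omega>. R 20 = m \<and> ?I m R M \<omega>)"
      have "wp L ?b (N * 8 + 14) J (R'(20 := m)) M' \<omega>'"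
      proof (rule wp_block_seq[where t = "N * 8 + 9"])
        show "straight L (addr 24 4 15 20 @ [Load 41 24, Arith Div 40 19 2])
          (wp L (Seq clmul ?c) (N * 8 + 9) J) (R'(20 := m)) M' \<omega>'"
        proof (simp add: addr_def r addr_ok p mn M'p, rule wp_clmul_seq[where N = N and f = f and g = "F m" and ?t2.0 = 6])
          fix R'' assume R'': "\<And>i. i < 40 \<Longrightarrow> R'' i = (R'(20 := m, 24 := p * n + m + 4 * (n * n), 41 := enc N (F m), 40 := enc N f)) i"
            "R'' 42 = enc N (f * F m)"
          show "wp L (block [Arith Mul 25 18 0, Arith Add 25 25 20, Arith Add 25 25 4, Load 26 25,
            Arith Bxor 26 26 42, Store 25 26]) 6 J R'' M' \<omega>'"
          proof (rule wp_block)
            show "straight L [Arith Mul 25 18 0, Arith Add 25 25 20, Arith Add 25 25 4, Load 26 25,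
              Arith Bxor 26 26 42, Store 25 26] J R'' M' \<omega>'"
              using m(1,3) addr_ok(3)[OF mn(2,1)] by (simp add: J_def R'' r addr_ok mn I[OF m(1)] enc_add c)
          qed simp_all
        qed (simp_all add: r)
      qed (simp_all add: addr_def)
      then show "R' 2 = 1 \<and> wp L ?b (N * 8 + 14) (\<lambda>R M \<omega>. R 20 = m \<and> ?I m R M \<omega>) (R'(20 := m)) M' \<omega>'"
        using r unfolding J_def by blast
    qed (use G R Q in auto)
  next
    have "p * (N * 8 + 14 + 2) \<le> n * (N * 8 + 16)" using p by (intro mult_le_mono) auto
    then show "length [Arith Div 20 15 2] + (p * (N * 8 + 14 + 2) + 1) \<le> T_cols" by (simp add: T_cols_def)
  qed simp
qed

lemma wp_rows:
  assumes g: "glob R" and R: "R 15 = p" "R 17 = enc N (inverse (F p p))" and p: "p < n"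
    and M: "\<And>i j. i \<le> p \<Longrightarrow> j \<le> p \<Longrightarrow> M (base i + j) = enc N (F i j)"
    and Q: "\<And>R' M'. (\<And>i. i < 18 \<Longrightarrow> R' i = R i) \<Longrightarrow> (\<And>a. a < 4 * (n * n) \<Longrightarrow> M' a = M a) \<Longrightarrow>
      (\<And>i j. i < p \<Longrightarrow> j < p \<Longrightarrow> M' (base i + j) = enc N (F i j + F i p * inverse (F p p) * F p j)) \<Longrightarrow> Q R' M' \<omega>"
  shows "wp L rows_prog T_rows Q R M \<omega>"
proof -
  note G = globD[OF g]
  let ?F = "\<lambda>i j. F i j + F i p * inverse (F p p) * F p j"
  \<comment> \<open>Rows from \<open>m\<close> on are updated; rows below \<open>m\<close> and the
    pivot row are intact, including column \<open>p\<close>, from which the multipliers are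
    computed.\<close>
  let ?I = "\<lambda>m R' M' \<omega>'. (\<forall>i<18. R' i = R i) \<and> \<omega>' = \<omega> \<and> m \<le> p \<and>
    (\<forall>a<4 * (n * n). M' a = M a) \<and>
    (\<forall>i j. i \<le> p \<and> j \<le> p \<and> (i < m \<or> i = p) \<longrightarrow> M' (base i + j) = enc N (F i j)) \<and>
    (\<forall>i j. m \<le> i \<and> i < p \<and> j < p \<longrightarrow> M' (base i + j) = enc N (?F i j))"
  let ?b = "Seq (block (addr 24 4 18 15 @ [Load 40 24, Arith Div 41 17 2])) (Seq clmul (Seq (block [Arith Div 19 42 2]) cols_prog))"
  show ?thesis unfolding rows_prog_def copy_def
  proof (rule wp_block_seq[where t = "p * (N * 8 + 9 + T_cols + 2) + 1"])
    show "straight L [Arith Div 18 15 2] (wp L (For 18 ?b) (p * (N * 8 + 9 + T_cols + 2) + 1) Q) R M \<omega>"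
    proof (simp only: straight.simps, intro conjI, simp, rule wp_For[where I = ?I and b = p and t = "N * 8 + 9 + T_cols"])
      fix m R' M' \<omega>' assume m: "m < p" "R' 18 = Suc m" "?I (Suc m) R' M' \<omega>'"
      have r: "R' 0 = n" "R' 2 = 1" "R' 3 = 2" "R' 4 = 4 * (n * n)" "R' 9 = 2 ^ N" "R' 10 = N"
        "R' 15 = p" "R' 17 = enc N (inverse (F p p))" using m(3) G R by auto
      have mn: "m < n" using m(1) p by auto
      have M'm: "M' (m * n + p + 4 * (n * n)) = enc N (F m p)"
        using m(1,3) by (simp add: add_ac)
      let ?f = "F m p * inverse (F p p)"
      have "wp L ?b (N * 8 + 9 + T_cols) (\<lambda>R M \<omega>. R 18 = m \<and> ?I m R M \<omega>) (R'(18 := m)) M' \<omega>'"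
      proof (rule wp_block_seq[where t = "N * 8 + 4 + T_cols"])
        let ?c = "Seq (block [Arith Div 19 42 2]) cols_prog"
        show "straight L (addr 24 4 18 15 @ [Load 40 24, Arith Div 41 17 2])
          (wp L (Seq clmul ?c) (N * 8 + 4 + T_cols) (\<lambda>R M \<omega>. R 18 = m \<and> ?I m R M \<omega>)) (R'(18 := m)) M' \<omega>'"
        proof (simp add: addr_def r addr_ok p mn M'm, rule wp_clmul_seq[where N = N and f = "F m p" and g = "inverse (F p p)" and ?t2.0 = "1 + T_cols"])
          fix R'' assume R'': "\<And>i. i < 40 \<Longrightarrow> R'' i = (R'(18 := m, 24 := m * n + p + 4 * (n * n), 40 := enc N (F m p), 41 := enc N (inverse (F p p)))) i"
            "R'' 42 = enc N ?f"
          show "wp L ?c (1 + T_cols) (\<lambda>R M \<omega>. R 18 = m \<and> ?I m R M \<omega>) R'' M' \<omega>'"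
          proof (rule wp_block_seq[where t = T_cols])
            have "wp L cols_prog T_cols (\<lambda>R M \<omega>. R 18 = m \<and> ?I m R M \<omega>) (R''(19 := enc N ?f)) M' \<omega>'"
            proof (rule wp_cols[where p = p and i = m and f = ?f and F = "F p" and G = "F m"])
              show "glob (R''(19 := enc N ?f))" by (rule glob_frame[OF g]) (use R'' m(3) in auto)
              fix R3 M3 assume R3: "\<And>i. i < 20 \<Longrightarrow> R3 i = (R''(19 := enc N ?f)) i"
                and M3: "\<And>a. a < base m \<or> base m + p \<le> a \<Longrightarrow> M3 a = M' a"
                "\<And>j. j < p \<Longrightarrow> M3 (base m + j) = enc N (F m j + ?f * F p j)"
              have keep: "M3 (base i + j) = M' (base i + j)" if "i \<noteq> m" "j < n" for i j
                using row_disjoint[OF that] p by (intro M3(1)) auto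
              have "M3 (base i + j) = enc N (F i j)" if "i \<le> p" "j \<le> p" "i < m \<or> i = p" for i j
                using keep[of i j] that m(1,3) p by auto
              moreover have "M3 (base i + j) = enc N (?F i j)" if "m \<le> i" "i < p" "j < p" for i j
                using keep[of i j] that m(3) p M3(2)[of j] by (cases "i = m") auto
              moreover have "M3 a = M a" if "a < 4 * (n * n)" for a
                using M3(1)[of a] that m(3) by simp
              ultimately show "R3 18 = m \<and> ?I m R3 M3 \<omega>'" using R3 R'' m by auto
            qed (use R'' r m p in auto)
            then show "straight L [Arith Div 19 42 2] (wp L cols_prog T_cols (\<lambda>R M \<omega>. R 18 = m \<and> ?I m R M \<omega>)) R'' M' \<omega>'"
              using R'' r by simp
          qed auto
        qed (simp_all add: r)
      qed (simp_all add: addr_def)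
      then show "R' 2 = 1 \<and> wp L ?b (N * 8 + 9 + T_cols) (\<lambda>R M \<omega>. R 18 = m \<and> ?I m R M \<omega>) (R'(18 := m)) M' \<omega>'"
        using r by simp
    qed (use G R Q M in auto)
  next
    have "p * (N * 8 + 9 + T_cols + 2) \<le> n * (N * 8 + 11 + T_cols)" using p by (intro mult_le_mono) auto
    then show "length [Arith Div 18 15 2] + (p * (N * 8 + 9 + T_cols + 2) + 1) \<le> T_rows" by (simp add: T_rows_def)
  qed simp
qed

text \<open>The invariant is \<open>d * pdet m H = pdet n F\<close>: pivots collected so far times
  the determinant of the remaining leading block. \<open>H\<close> and \<open>d\<close> are exact
  power series of which the cells hold truncations; the constant terms in the invariant keep the
  next pivot invertible.\<close>

lemma wp_elim:
  assumes g: "glob R" and u: "\<And>i j. i < n \<Longrightarrow> j < n \<Longrightarrow> fps_nth (F i j) 0 = of_bool (i = j)"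
    and M: "\<And>i j. i < n \<Longrightarrow> j < n \<Longrightarrow> M (base i + j) = enc N (F i j)"
    and Q: "\<And>R' M'. (\<And>i. i < 15 \<Longrightarrow> R' i = R i) \<Longrightarrow> (\<And>a. a < 4 * (n * n) \<Longrightarrow> M' a = M a) \<Longrightarrow>
      R' 16 = enc N (pdet n F) \<Longrightarrow> Q R' M' \<omega>"
  shows "wp L elim_prog T_elim Q R M \<omega>"
proof -
  note G = globD[OF g]
  let ?I = "\<lambda>m R' M' \<omega>'. (\<forall>i<15. R' i = R i) \<and> \<omega>' = \<omega> \<and> m \<le> n \<and> (\<forall>a<4 * (n * n). M' a = M a) \<and>
    (\<exists>H d. (\<forall>i<m. \<forall>j<m. fps_nth (H i j) 0 = of_bool (i = j) \<and> M' (base i + j) = enc N (H i j)) \<and>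
      R' 16 = enc N d \<and> d * pdet m H = pdet n F)"
  let ?c4 = "Seq (block [Arith Div 17 37 2]) rows_prog"
  let ?c3 = "Seq cinv ?c4"
  let ?c2 = "Seq (block [Arith Div 16 42 2]) ?c3"
  let ?b = "Seq (block (addr 24 4 15 15 @ [Load 36 24, Arith Div 40 16 2, Arith Div 41 36 2])) (Seq clmul ?c2)"
  let ?ti = "N * (N * 8 + 8) + 4"
  show ?thesis unfolding elim_prog_def copy_def
  proof (rule wp_block_seq[where t = "n * (T_pivot + 2) + 1"])
    show "straight L [Imm 16 1, Arith Div 15 0 2] (wp L (For 15 ?b) (n * (T_pivot + 2) + 1) Q) R M \<omega>"
    proof (simp add: consts_less G, rule wp_For[where I = ?I and b = n and t = T_pivot])
      fix m R' M' \<omega>' assume m: "m < n" "R' 15 = Suc m" "?I (Suc m) R' M' \<omega>'"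
      have r: "R' 0 = n" "R' 2 = 1" "R' 3 = 2" "R' 4 = 4 * (n * n)" "R' 9 = 2 ^ N" "R' 10 = N"
        using m(3) G by auto
      from m(3) obtain H d where H: "\<And>i j. i < Suc m \<Longrightarrow> j < Suc m \<Longrightarrow> fps_nth (H i j) 0 = of_bool (i = j)"
        "\<And>i j. i < Suc m \<Longrightarrow> j < Suc m \<Longrightarrow> M' (base i + j) = enc N (H i j)"
        "R' 16 = enc N d" "d * pdet (Suc m) H = pdet n F" by blast
      have M'm: "M' (m * n + m + 4 * (n * n)) = enc N (H m m)"
        using H(2)[of m m] by (simp add: add_ac)
      define J where "J = (\<lambda>R M \<omega>. R 15 = m \<and> ?I m R M \<omega>)"
      have "wp L ?b T_pivot J (R'(15 := m)) M' \<omega>'"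
      proof (rule wp_block_seq[where t = "N * 8 + 3 + (1 + (?ti + (1 + T_rows)))"])
        let ?d4 = "Seq (block [Arith Div 17 37 2]) rows_prog"
        let ?d2 = "Seq (block [Arith Div 16 42 2]) (Seq cinv ?d4)"
        show "straight L (addr 24 4 15 15 @ [Load 36 24, Arith Div 40 16 2, Arith Div 41 36 2])
          (wp L (Seq clmul ?d2) (N * 8 + 3 + (1 + (?ti + (1 + T_rows)))) J) (R'(15 := m)) M' \<omega>'"
        proof (simp add: addr_def r addr_ok m(1) M'm H(3), rule wp_clmul_seq[where N = N and f = d and g = "H m m" and ?t2.0 = "1 + (?ti + (1 + T_rows))"])
          fix R'' assume R'': "\<And>i. i < 40 \<Longrightarrow> R'' i = (R'(15 := m, 24 := m * n + m + 4 * (n * n), 36 := enc N (H m m),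
            40 := enc N d, 41 := enc N (H m m))) i" "R'' 42 = enc N (d * H m m)"
          show "wp L ?d2 (1 + (?ti + (1 + T_rows))) J R'' M' \<omega>'"
          proof (rule wp_block_seq[where t = "?ti + (1 + T_rows)"])
            have "wp L (Seq cinv ?d4) (?ti + (1 + T_rows)) J (R''(16 := enc N (d * H m m))) M' \<omega>'"
            proof (rule wp_seq[where ?t1.0 = ?ti and ?t2.0 = "1 + T_rows"], rule wp_cinv[where N = N and p = "H m m"])
              fix R3 assume R3: "\<And>i. i < 36 \<Longrightarrow> R3 i = (R''(16 := enc N (d * H m m))) i"
                "R3 37 = enc N (inverse (H m m))"
              show "wp L ?d4 (1 + T_rows) J R3 M' \<omega>'"
              proof (rule wp_block_seq[where t = T_rows])
                have "wp L rows_prog T_rows J (R3(17 := enc N (inverse (H m m)))) M' \<omega>'"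
                proof (rule wp_rows[where p = m and F = H])
                  show "glob (R3(17 := enc N (inverse (H m m))))"
                    by (rule glob_frame[OF g]) (use R3 R'' m(3) in auto)
                  fix R4 M4 assume R4: "\<And>i. i < 18 \<Longrightarrow> R4 i = (R3(17 := enc N (inverse (H m m)))) i"
                    and M4: "\<And>a. a < 4 * (n * n) \<Longrightarrow> M4 a = M' a"
                      "\<And>i j. i < m \<Longrightarrow> j < m \<Longrightarrow> M4 (base i + j) = enc N (H i j + H i m * inverse (H m m) * H m j)"
                  let ?H = "\<lambda>i j. H i j + H i m * inverse (H m m) * H m j"
                  have "\<forall>i<m. \<forall>j<m. fps_nth (?H i j) 0 = of_bool (i = j) \<and> M4 (base i + j) = enc N (?H i j)"
                    using H(1) M4(2) by simp
                  moreover have "(d * H m m) * pdet m ?H = pdet n F" using H(4) by (simp add: mult.assoc)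
                  moreover have "R4 16 = enc N (d * H m m)" using R4 R3 by simp
                  ultimately have "\<exists>H' d'. (\<forall>i<m. \<forall>j<m. fps_nth (H' i j) 0 = of_bool (i = j) \<and> M4 (base i + j) = enc N (H' i j)) \<and>
                    R4 16 = enc N d' \<and> d' * pdet m H' = pdet n F"
                    by (intro exI[of _ ?H] exI[of _ "d * H m m"] conjI)
                  moreover have "\<forall>i<15. R4 i = R i" "R4 15 = m" using R4 R3 R'' m(3) by auto
                  moreover have "\<forall>a<4 * (n * n). M4 a = M a" using M4(1) m(3) by auto
                  ultimately show "J R4 M4 \<omega>'" unfolding J_def using m(1,3) by auto
                qed (use R3 R'' r m H(2) in auto)
                then show "straight L [Arith Div 17 37 2] (wp L rows_prog T_rows J) R3 M' \<omega>'"
                  using R3 R'' r by simp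
              qed auto
            qed (use R'' r H(1) N_pos in auto)
            then show "straight L [Arith Div 16 42 2] (wp L (Seq cinv ?d4) (?ti + (1 + T_rows)) J) R'' M' \<omega>'"
              using R'' r by simp
          qed auto
        qed (simp_all add: r)
      qed (simp_all add: addr_def T_pivot_def)
      then show "R' 2 = 1 \<and> wp L ?b T_pivot (\<lambda>R M \<omega>. R 15 = m \<and> ?I m R M \<omega>) (R'(15 := m)) M' \<omega>'"
        using r unfolding J_def by blast
    next
      have "\<exists>H d. (\<forall>i<n. \<forall>j<n. fps_nth (H i j) 0 = of_bool (i = j) \<and> M (base i + j) = enc N (H i j)) \<and>
        1 = enc N d \<and> d * pdet n H = pdet n F"
        by (rule exI[of _ F], rule exI[of _ 1]) (use u M N_pos in \<open>simp add: enc_1\<close>)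
      then show "?I n (R(16 := 1, 15 := n)) M \<omega>" by auto
    qed (use G Q in auto)
  qed (auto simp: T_elim_def)
qed

end

section \<open>Constants, sampling and the sum over the label sets\<close>

text \<open>Register 4 enters with \<open>n - k\<close> and is decremented to the number of unmarked
  arcs. Thus 13 becomes \<open>(2 ^ D) ^ (n - 1 - k) * (2 ^ (D * n)) ^ k\<close>, the shift to the
  start of the window. \<open>2 ^ N\<close> arises as \<open>(2 ^ (D * n)) ^ n\<close>, and 4 is
  finally reused for the base of the matrix.\<close>

definition init_prog :: prog where
  "init_prog = Seq (block [Arith Sub 4 4 2, Arith Mul 5 0 0, Arith Mul 6 5 3, copy 30 6]) (Seq (pow_prog 7 3 30)
    (Seq (block [copy 30 0]) (Seq (pow_prog 8 7 30) (Seq (block [copy 30 0]) (Seq (pow_prog 9 8 30)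
    (Seq (block [Arith Mul 10 5 6, Arith Add 11 6 5, copy 30 4]) (Seq (pow_prog 13 7 30)
    (Seq (block [copy 30 1]) (Seq (pow_prog 31 8 30) (Seq (block [Arith Mul 13 13 31, copy 30 1])
    (Seq (pow_prog 14 3 30) (block [Arith Add 4 11 5, Imm 12 0]))))))))))))"

definition sample_prog :: prog where
  "sample_prog = Seq (block [copy 15 11]) (For 15 (Seq (block [Imm 20 0, Imm 21 1, copy 16 0])
    (Seq (For 16 (block [Toss 22, Arith Mul 22 22 21, Arith Add 20 20 22, Arith Add 21 21 21]))
      (block [Arith Add 22 15 5, Store 22 20]))))"

definition loop_prog :: prog where
  "loop_prog = For 14 (Seq build_prog (Seq elim_prog (block [Arith Bxor 12 12 16])))"

definition main_prog :: prog where
  "main_prog = Seq init_prog (Seq sample_prog (Seq loop_prog (block [Arith Div 0 12 13, Arith Mod 0 0 7])))"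

text \<open>Truncated subtraction leaves 0 in register 4 exactly if \<open>n \<le> k\<close>, where
  the answer is NO. Otherwise \<open>k < n\<close>, so that even \<open>2 ^ k\<close> fits into a
  cell of polynomial length.\<close>

definition iob_prog :: prog where
  "iob_prog = Seq (block [Imm 2 1, Imm 3 2, Arith Sub 4 0 1]) (Cond 4 main_prog (Imm 0 0))"


context sieve_machine
begin

definition T_init where "T_init = D * 3 + n * 6 + (n - (k + 1)) * 3 + k * 6 + 30"
definition T_sample where "T_sample = 3 * (n * n) * (6 * n + 8) + 2"
definition T_iter where "T_iter = n * (n * (k * 11 + N * 8 + 28) + 11) + T_elim + 5"

lemma n_le: "n \<le> D * n" "n \<le> N"
proof -
  have "0 < n * n" using n by simp
  then have "1 \<le> D" unfolding D_def by linarith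
  then have "1 * n \<le> D * n" by (rule mult_le_mono1)
  then show "n \<le> D * n" by simp
  then show "n \<le> N" by (rule order.trans) (rule shift_le_N(1))
qed

lemma wp_init:
  assumes R: "R 0 = n" "R 1 = k" "R 2 = 1" "R 3 = 2" "R 4 = n - k"
    and Q: "\<And>R'. glob R' \<Longrightarrow> R' 12 = 0 \<Longrightarrow> R' 13 = 2 ^ (D * (n * k + (n - 1 - k))) \<Longrightarrow> R' 14 = 2 ^ k \<Longrightarrow> Q R' M \<omega>"
  shows "wp L init_prog T_init Q R M \<omega>"
proof -
  have nn: "n * n < 2 ^ L" "n * n * 2 < 2 ^ L" "3 * (n * n) < 2 ^ L" "4 * (n * n) < 2 ^ L"
    by (rule addr_bound, use n in simp)+
  have NL: "N < 2 ^ L" "D < 2 ^ L"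
    using less_trans[OF N_lt_L less_exp] shift_le_N(2) by simp_all
  have DL: "n * n * 2 = D" "2 * (n * n) = D" "D * n * n = N" "n * n * D = N" "D + n * n = 3 * (n * n)"
    by (simp_all add: D_def N_def)
  have kn: "D * (n - (k + 1)) \<le> N" "D * n * k \<le> N" "k \<le> N"
  proof -
    have "n - (k + 1) \<le> n * n" using le_square[of n] by linarith
    then have "D * (n - (k + 1)) \<le> D * (n * n)" by (rule mult_le_mono2)
    then show "D * (n - (k + 1)) \<le> N" by (simp add: N_def mult.commute)
    have "D * n * k \<le> D * n * n" using k by (intro mult_le_mono2) simp
    then show "D * n * k \<le> N" by (simp add: DL)
    show "k \<le> N" using n_le(2) k by simp
  qed
  have pp: "2 ^ (D * (n - (k + 1))) * 2 ^ (D * n * k) < (2 :: nat) ^ L"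
    using kn by (intro prod_bound power_increasing) auto
  have pe: "(2 :: nat) ^ (D * (n - (k + 1))) * 2 ^ (D * n * k) = 2 ^ (D * (n * k + (n - 1 - k)))"
    by (simp add: algebra_simps flip: power_add)
  have eL: "D < L" "D * n < L" "D * (n - (k + 1)) < L" "D * n * k < L" "k < L"
    using le_less_trans[OF _ N_lt_L] shift_le_N kn by auto
  note B = nn NL consts_less eL pp DL
  show ?thesis unfolding init_prog_def copy_def
    apply (rule wp_blk_seq', simp add: T_init_def)
    apply (simp add: R B)
    apply (rule wp_pow_seq[where x = 2 and e = D], simp add: R B T_init_def)
    subgoal premises p1 for R1
      apply (rule wp_blk_seq', simp add: T_init_def)
      apply (simp add: p1 R B)
      apply (rule wp_pow_seq[where x = "2 ^ D" and e = n], simp add: p1 R B T_init_def flip: power_mult)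
      subgoal premises p2 for R2
        apply (rule wp_blk_seq', simp add: T_init_def)
        apply (simp add: p2 p1 R B)
        apply (rule wp_pow_seq[where x = "2 ^ (D * n)" and e = n], simp add: p2 p1 R B T_init_def flip: power_mult)
        subgoal premises p3 for R3
          apply (rule wp_blk_seq', simp add: T_init_def)
          apply (simp add: p3 p2 p1 R B)
          apply (rule wp_pow_seq[where x = "2 ^ D" and e = "n - (k + 1)"], simp add: p3 p2 p1 R B T_init_def flip: power_mult)
          subgoal premises p4 for R4
            apply (rule wp_blk_seq', simp add: T_init_def)
            apply (simp add: p4 p3 p2 p1 R B)
            apply (rule wp_pow_seq[where x = "2 ^ (D * n)" and e = k], simp add: p4 p3 p2 p1 R B T_init_def flip: power_mult)
            subgoal premises p5 for R5
              apply (rule wp_blk_seq', simp add: T_init_def)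
              apply (simp add: p5 p4 p3 p2 p1 R B flip: power_mult)
              apply (rule wp_pow_seq[where x = 2 and e = k], simp add: p5 p4 p3 p2 p1 R B T_init_def)
              subgoal premises p6 for R6
                apply (rule wp_block)
                  apply (simp add: p6 p5 p4 p3 p2 p1 R B)
                  apply (rule Q)
                     apply (simp_all add: glob_def p6 p5 p4 p3 p2 p1 R B pe T_init_def flip: power_mult)
                done
              done
            done
          done
        done
      done
    done
qed

lemma horner_sum_stake_Suc:
  "horner_sum of_bool 2 (stake (Suc j) \<omega>) = horner_sum of_bool 2 (stake j \<omega>) + of_bool (\<omega> !! j) * (2 :: nat) ^ j"
  by (simp add: stake_Suc horner_sum_append del: stake.simps)

lemma n_less: "j \<le> n \<Longrightarrow> (2 :: nat) ^ j < 2 ^ L"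
  by (rule power_strict_increasing[OF le_less_trans[OF _ N_lt_L]]) (use n_le in auto)

lemma wp_number:
  assumes R: "R 0 = n" "R 2 = 1" "R 16 = n" "R 20 = 0" "R 21 = 1"
    and Q: "\<And>R'. (\<And>i. i < 16 \<Longrightarrow> R' i = R i) \<Longrightarrow> R' 20 = horner_sum of_bool 2 (stake n \<omega>) \<Longrightarrow> Q R' M (sdrop n \<omega>)"
  shows "wp L (For 16 (block [Toss 22, Arith Mul 22 22 21, Arith Add 20 20 22, Arith Add 21 21 21])) (n * 6 + 1) Q R M \<omega>"
proof -
  let ?I = "\<lambda>m R' M' \<omega>'. (\<forall>i<16. R' i = R i) \<and> M' = M \<and> \<omega>' = sdrop (n - m) \<omega> \<and> m \<le> n \<and>
    R' 20 = horner_sum of_bool 2 (stake (n - m) \<omega>) \<and> R' 21 = 2 ^ (n - m)"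
  show ?thesis
  proof (rule wp_For[where I = ?I and b = n and t = 4])
    fix m R' M' \<omega>' assume m: "m < n" "R' 16 = Suc m" "?I (Suc m) R' M' \<omega>'"
    let ?j = "n - Suc m"
    have j: "n - m = Suc ?j" using m(1) by simp
    have w: "shd \<omega>' = \<omega> !! ?j" "stl \<omega>' = sdrop (n - m) \<omega>" using m(3) unfolding j by (simp_all add: sdrop_simps)
    have h: "horner_sum of_bool 2 (stake (n - m) \<omega>) =
        horner_sum of_bool 2 (stake ?j \<omega>) + of_bool (\<omega> !! ?j) * (2 :: nat) ^ ?j"
      unfolding j by (rule horner_sum_stake_Suc)
    have "horner_sum of_bool 2 (stake (n - m) \<omega>) < (2 :: nat) ^ (n - m)"
      using horner_sum_of_bool_2_less[of "stake (n - m) \<omega>"] by (simp only: length_stake)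
    also have b0: "\<dots> < 2 ^ L" by (rule n_less) simp
    finally have b: "horner_sum of_bool 2 (stake ?j \<omega>) + of_bool (\<omega> !! ?j) * (2 :: nat) ^ ?j < 2 ^ L"
      unfolding h .
    then have b': "of_bool (\<omega> !! ?j) * (2 :: nat) ^ ?j < 2 ^ L" by linarith
    have d: "(2 :: nat) ^ ?j + 2 ^ ?j = 2 ^ (n - m)" unfolding j by simp
    define e :: nat where "e = of_bool (\<omega> !! ?j)"
    have "wp L (block [Toss 22, Arith Mul 22 22 21, Arith Add 20 20 22, Arith Add 21 21 21]) 4
        (\<lambda>R M \<omega>. R 16 = m \<and> ?I m R M \<omega>) (R'(16 := m)) M' \<omega>'"
    proof (rule wp_block)
      show "straight L [Toss 22, Arith Mul 22 22 21, Arith Add 20 20 22, Arith Add 21 21 21]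
        (\<lambda>R M \<omega>. R 16 = m \<and> ?I m R M \<omega>) (R'(16 := m)) M' \<omega>'"
        using m b[folded e_def] b'[folded e_def] b0 h[folded e_def] w
        by (simp add: e_def[symmetric] d)
    qed simp_all
    then show "R' 2 = 1 \<and> wp L (block [Toss 22, Arith Mul 22 22 21, Arith Add 20 20 22, Arith Add 21 21 21]) 4
        (\<lambda>R M \<omega>. R 16 = m \<and> ?I m R M \<omega>) (R'(16 := m)) M' \<omega>'" using m(3) R by simp
  qed (use R Q in auto)
qed

abbreviation V :: nat where "V \<equiv> 3 * (n * n)"

lemma chunk_stake:
  assumes "i < V"
  shows "chunk n V (stake (V * n) \<omega>) i = stake n (sdrop ((V - Suc i) * n) \<omega>)"
proof -
  have "V * n = (V - Suc i) * n + n + i * n" using assms by (metis Suc_leI add.assoc add_mult_distrib le_add_diff_inverse2 mult_Suc plus_1_eq_Suc)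
  then have "n \<le> V * n - (V - Suc i) * n" by simp
  moreover have "V - 1 - i = V - Suc i" by simp
  ultimately show ?thesis unfolding chunk_def drop_stake take_stake by (simp only: min_absorb1)
qed

lemma wp_sample:
  assumes g: "glob R"
    and Q: "\<And>R' M'. (\<And>i. i < 15 \<Longrightarrow> R' i = R i) \<Longrightarrow> (\<And>a. a < n * n \<Longrightarrow> M' a = M a) \<Longrightarrow>
      (\<And>i. i < V \<Longrightarrow> M' (n * n + i) = horner_sum of_bool 2 (chunk n V (stake (V * n) \<omega>) i)) \<Longrightarrow>
      Q R' M' (sdrop (V * n) \<omega>)"
  shows "wp L sample_prog T_sample Q R M \<omega>"
proof -
  note G = globD[OF g]
  let ?v = "\<lambda>i. horner_sum of_bool 2 (chunk n V (stake (V * n) \<omega>) i)"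
  let ?I = "\<lambda>m R' M' \<omega>'. (\<forall>i<15. R' i = R i) \<and> \<omega>' = sdrop ((V - m) * n) \<omega> \<and> m \<le> V \<and>
    (\<forall>a<n * n. M' a = M a) \<and> (\<forall>i. m \<le> i \<and> i < V \<longrightarrow> M' (n * n + i) = ?v i)"
  let ?f = "For 16 (block [Toss 22, Arith Mul 22 22 21, Arith Add 20 20 22, Arith Add 21 21 21])"
  let ?e = "block [Arith Add 22 15 5, Store 22 20]"
  let ?b = "Seq (block [Imm 20 0, Imm 21 1, Arith Div 16 0 2]) (Seq ?f ?e)"
  show ?thesis unfolding sample_prog_def copy_def
  proof (rule wp_block_seq[where t = "V * (6 * n + 8) + 1"])
    have "wp L (For 15 ?b) (V * (6 * n + 8) + 1) Q (R(15 := V)) M \<omega>"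
    proof (rule wp_For[where I = ?I and b = V and t = "6 * n + 6"])
      fix m R' M' \<omega>' assume m: "m < V" "R' 15 = Suc m" "?I (Suc m) R' M' \<omega>'"
      have r: "R' 0 = n" "R' 2 = 1" "R' 5 = n * n" using m(3) G by auto
      define J where "J = (\<lambda>R M \<omega>. R 15 = m \<and> ?I m R M \<omega>)"
      have "wp L ?b (6 * n + 6) J (R'(15 := m)) M' \<omega>'"
      proof (rule wp_block_seq[where t = "n * 6 + 1 + 2"])
        have "wp L (Seq ?f ?e) (n * 6 + 1 + 2) J (R'(15 := m, 20 := 0, 21 := 1, 16 := n)) M' \<omega>'"
        proof (rule wp_seq[OF _ order.refl], rule wp_number)
          fix R'' assume R'': "\<And>i. i < 16 \<Longrightarrow> R'' i = (R'(15 := m, 20 := 0, 21 := 1, 16 := n)) i"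
            "R'' 20 = horner_sum of_bool 2 (stake n \<omega>')"
          have v: "R'' 20 = ?v m" using R''(2) m(3) by (simp add: chunk_stake[OF m(1)])
          have w: "sdrop n \<omega>' = sdrop ((V - m) * n) \<omega>"
          proof -
            have "n + (V - Suc m) * n = (V - m) * n" using m(1) by (metis Suc_diff_Suc mult_Suc)
            then show ?thesis using m(3) by (simp add: sdrop_add add.commute)
          qed
          have "m + n * n < 2 ^ L" by (rule addr_bound) (use m(1) n in simp)
          moreover have "J (R''(22 := m + n * n)) (M'(m + n * n := ?v m)) (sdrop n \<omega>')"
          proof -
            have "(M'(m + n * n := ?v m)) (n * n + i) = ?v i" if "m \<le> i" "i < V" for i
              using m(3) that by (cases "i = m") (auto simp: add.commute)
            then show ?thesis unfolding J_def w using m R'' by auto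
          qed
          ultimately show "wp L ?e 2 J R'' M' (sdrop n \<omega>')"
            using R''(1) r v by (intro wp_block) simp_all
        qed (use r in simp_all)
        then show "straight L [Imm 20 0, Imm 21 1, Arith Div 16 0 2] (wp L (Seq ?f ?e) (n * 6 + 1 + 2) J) (R'(15 := m)) M' \<omega>'"
          using r consts_less by simp
      qed simp_all
      then show "R' 2 = 1 \<and> wp L ?b (6 * n + 6) (\<lambda>R M \<omega>. R 15 = m \<and> ?I m R M \<omega>) (R'(15 := m)) M' \<omega>'"
        using r unfolding J_def by blast
    next
      fix R' M' \<omega>' assume "?I 0 R' M' \<omega>'"
      then show "Q R' M' \<omega>'" using Q[of R' M'] by simp
    qed (use G in auto)
    then show "straight L [Arith Div 15 11 2] (wp L (For 15 ?b) (V * (6 * n + 8) + 1) Q) R M \<omega>"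
      using G by simp
  qed (simp_all add: T_sample_def)
qed

text \<open>Every weight is a multiple of \<open>X\<close> because \<open>D\<close> and
  \<open>n\<close> are positive; modulo \<open>X\<close> only the virtual arcs remain, and they form
  the identity.\<close>

lemma entry_nth_0:
  assumes "i < n"
  shows "fps_nth (entry A v i) 0 = of_bool (v = i)"
proof -
  have "fps_nth (wt A u w) 0 = 0" if "u < n" for u w
    using n unfolding wt_eq[OF that] by (simp add: D_def fps_X_power_mult_nth)
  then show ?thesis using assms by (simp add: entry_def fps_sum_nth fps_mult_nth_0)
qed

lemma wp_loop:
  assumes g: "glob R" and i: "inp M" and R: "R 14 = B" "R 12 = 0"
    and Q: "\<And>R' M'. (\<And>i. i < 12 \<Longrightarrow> R' i = R i) \<Longrightarrow> R' 13 = R 13 \<Longrightarrow>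
      R' 12 = enc N (\<Sum>A<B. pdet n (entry A)) \<Longrightarrow> Q R' M' \<omega>"
  shows "wp L loop_prog (B * T_iter + 1) Q R M \<omega>"
proof -
  note G = globD[OF g]
  let ?I = "\<lambda>m R' M' \<omega>'. (\<forall>i<12. R' i = R i) \<and> R' 13 = R 13 \<and> \<omega>' = \<omega> \<and> m \<le> B \<and>
    (\<forall>a<4 * (n * n). M' a = M a) \<and> R' 12 = enc N (\<Sum>A=m..<B. pdet n (entry A))"
  let ?tB = "n * (n * (k * 11 + N * 8 + 28) + 11) + 2"
  let ?c = "block [Arith Bxor 12 12 16]"
  show ?thesis unfolding loop_prog_def
  proof (rule wp_For[where I = ?I and b = B and t = "?tB + (T_elim + 1)"])
    fix m R' M' \<omega>' assume m: "m < B" "R' 14 = Suc m" "?I (Suc m) R' M' \<omega>'"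
    have g': "glob (R'(14 := m))" by (rule glob_frame[OF g]) (use m(3) in auto)
    have i': "inp M'" by (rule inp_frame[OF i]) (use m(3) in blast)
    have "wp L (Seq build_prog (Seq elim_prog ?c)) (?tB + (T_elim + 1))
      (\<lambda>R M \<omega>. R 14 = m \<and> ?I m R M \<omega>) (R'(14 := m)) M' \<omega>'"
    proof (rule wp_seq[OF _ order.refl], rule wp_build[OF g' i', where A = m])
      fix R2 M2 assume 2: "\<And>i. i < 15 \<Longrightarrow> R2 i = (R'(14 := m)) i" "\<And>a. a < 4 * (n * n) \<Longrightarrow> M2 a = M' a"
        "\<And>v i. v < n \<Longrightarrow> i < n \<Longrightarrow> M2 (base v + i) = enc N (entry m v i)"
      have g2: "glob R2" by (rule glob_frame[OF g']) (use 2(1) in auto)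
      show "wp L (Seq elim_prog ?c) (T_elim + 1) (\<lambda>R M \<omega>. R 14 = m \<and> ?I m R M \<omega>) R2 M2 \<omega>'"
      proof (rule wp_seq[OF _ order.refl], rule wp_elim[OF g2, where F = "entry m"])
        fix R3 M3 assume 3: "\<And>i. i < 15 \<Longrightarrow> R3 i = R2 i" "\<And>a. a < 4 * (n * n) \<Longrightarrow> M3 a = M2 a"
          "R3 16 = enc N (pdet n (entry m))"
        have "(\<Sum>A=m..<B. pdet n (entry A)) = pdet n (entry m) + (\<Sum>A=Suc m..<B. pdet n (entry A))"
          using m(1) by (simp add: sum.atLeast_Suc_lessThan)
        then have "xor (R3 12) (R3 16) = enc N (\<Sum>A=m..<B. pdet n (entry A))"
          using 3 2(1) m(3) by (simp add: enc_add add.commute)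
        then show "wp L ?c 1 (\<lambda>R M \<omega>. R 14 = m \<and> ?I m R M \<omega>) R3 M3 \<omega>'"
          using 3 2 m by (intro wp_block) auto
      qed (use 2 entry_nth_0 in auto)
    qed simp_all
    then show "R' 2 = 1 \<and> wp L (Seq build_prog (Seq elim_prog ?c)) (?tB + (T_elim + 1))
      (\<lambda>R M \<omega>. R 14 = m \<and> ?I m R M \<omega>) (R'(14 := m)) M' \<omega>'" using m(3) G by simp
  next
    fix R' M' \<omega>' assume "?I 0 R' M' \<omega>'"
    then show "Q R' M' \<omega>'" using Q[of R' M'] by (simp add: atLeast0LessThan)
  next
    have "?tB + (T_elim + 1) + 2 = T_iter" by (simp add: T_iter_def)
    then show "B * (?tB + (T_elim + 1) + 2) + 1 \<le> B * T_iter + 1" by (simp only: order.refl)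
  qed (use R in \<open>auto simp: enc_0\<close>)
qed

text \<open>Each counter value encodes one label set, so the accumulated determinants add up to the
  forest sums over all label sets.\<close>

lemma sum_pdet:
  "(\<Sum>A<2 ^ k. pdet n (entry A)) = fps_of_poly (sieve_poly Ar D n k (\<lambda>u v. \<rho> (idx n 0 u v))
     (\<lambda>u v. \<rho> (idx n 1 u v)) (\<lambda>u j. \<rho> (idx n 2 u j)))"
proof -
  let ?g = "\<lambda>S. \<Sum>f | f \<in> {..<n} \<rightarrow>\<^sub>E {..n} \<and> rooted n f. \<Prod>v<n. fps_of_poly (arc_weight Ar D n
    (\<lambda>u v. \<rho> (idx n 0 u v)) (\<lambda>u v. \<rho> (idx n 1 u v)) (\<lambda>u. \<Sum>j\<in>S. \<rho> (idx n 2 u j)) (f v) v)"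
  have "pdet n (entry A) = ?g {j. j < k \<and> bit A (k - Suc j)}" for A
  proof -
    have "pdet n (entry A) = Determinant.det (Matrix.mat n n (\<lambda>(v, i). entry A v i))"
      by (rule pdet_eq_det) (simp add: entry_nth_0)
    also have "\<dots> = (\<Sum>f | f \<in> {..<n} \<rightarrow>\<^sub>E {..n} \<and> rooted n f. \<Prod>v<n. wt A (f v) v)"
      unfolding entry_def by (rule forest_expansion) (simp add: wt_def arc_weight_def)
    finally show ?thesis by (simp add: wt_def label_def[abs_def])
  qed
  then have "(\<Sum>A<2 ^ k. pdet n (entry A)) = (\<Sum>A<2 ^ k. ?g {j. j < k \<and> bit (A :: nat) (k - Suc j)})" by simp
  also have "\<dots> = (\<Sum>S\<in>Pow {..<k}. ?g S)" by (rule sum_bit_sets)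
  finally show ?thesis by (simp add: sieve_poly_def fps_of_poly_sum fps_of_poly_prod)
qed

end

context sieve_machine
begin

lemma wp_main:
  assumes R: "R 0 = n" "R 1 = k" "R 2 = 1" "R 3 = 2" "R 4 = n - k"
    and M: "\<And>u v. u < n \<Longrightarrow> v < n \<Longrightarrow> M (u * n + v) = of_bool ((u, v) \<in> Ar)"
    and \<rho>: "\<rho> = (\<lambda>i. bpoly (chunk n V (stake (V * n) \<omega>) i))"
  shows "wp L main_prog (T_init + (T_sample + (2 ^ k * T_iter + 1 + 2)))
    (\<lambda>R' M' \<omega>'. R' 0 \<noteq> 0 \<longleftrightarrow> (\<Sum>S\<in>mono_of n ` marked_trees n Ar k. \<Prod>i\<in>S. \<rho> i) \<noteq> 0) R M \<omega>"
proof -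
  let ?p = "sieve_poly Ar D n k (\<lambda>u v. \<rho> (idx n 0 u v)) (\<lambda>u v. \<rho> (idx n 1 u v)) (\<lambda>u j. \<rho> (idx n 2 u j))"
  let ?b = "D * (n * k + (n - 1 - k))"
  let ?S = "\<Sum>S\<in>mono_of n ` marked_trees n Ar k. \<Prod>i\<in>S. \<rho> i"
  have deg: "degree (\<rho> i) \<le> n - 1" for i
    using degree_bpoly[of "chunk n V (stake (V * n) \<omega>) i"] unfolding \<rho>
    by (rule order.trans) (simp add: chunk_def diff_le_mono)
  \<comment> \<open>A block of \<open>n\<close> tosses is a polynomial of degree at most
    \<open>n - 1\<close>; this is the bound that \<open>window_sieve_poly\<close> asks of
    \<open>D\<close>.\<close>
  have "2 * (n - 1) * n < 2 * n * n" using n by simp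
  then have d: "2 * (n - 1) * n < D" by (simp add: D_def mult.assoc)
  have win: "window D ?b ?p = ?S"
    unfolding window_sieve_poly[OF k d deg deg deg] by (rule sum_marked_trees) (use k in simp)
  \<comment> \<open>The whole window lies below \<open>X^N\<close>, so truncation does not affect
    it.\<close>
  have "n * k + (n - 1 - k) + 1 \<le> n * n"
  proof -
    have "n * k + n \<le> n * n" using k by (metis Suc_leI add.commute mult_Suc_right mult_le_mono2)
    then show ?thesis using k by linarith
  qed
  then have "D * (n * k + (n - 1 - k) + 1) \<le> D * (n * n)" by (rule mult_le_mono2)
  then have "?b + D \<le> N" unfolding N_def by (simp only: distrib_left mult.commute[of D] mult_1_left)
  note res = window_ne_0_iff[OF this, of ?p, unfolded win]
  show ?thesis unfolding main_prog_def
  proof (rule wp_seq[OF _ order.refl], rule wp_init[OF R])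
    fix R1 assume R1: "glob R1" "R1 12 = 0" "R1 13 = 2 ^ ?b" "R1 14 = 2 ^ k"
    let ?end = "block [Arith Div 0 12 13, Arith Mod 0 0 7]"
    let ?Q = "\<lambda>R' M' \<omega>'. R' 0 \<noteq> 0 \<longleftrightarrow> ?S \<noteq> 0"
    show "wp L (Seq sample_prog (Seq loop_prog ?end)) (T_sample + (2 ^ k * T_iter + 1 + 2)) ?Q R1 M \<omega>"
    proof (rule wp_seq[OF _ order.refl], rule wp_sample[OF R1(1)])
      fix R2 M2 assume 2: "\<And>i. i < 15 \<Longrightarrow> R2 i = R1 i" "\<And>a. a < n * n \<Longrightarrow> M2 a = M a"
        "\<And>i. i < V \<Longrightarrow> M2 (n * n + i) = horner_sum of_bool 2 (chunk n V (stake (V * n) \<omega>) i)"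
      have "glob R2" by (rule glob_frame[OF R1(1)]) (use 2(1) in auto)
      moreover have "inp M2" unfolding inp_def
      proof (intro conjI allI impI)
        fix u v assume "u < n" "v < n"
        then show "M2 (u * n + v) = of_bool ((u, v) \<in> Ar)" using 2(2) cell_less M by simp
      next
        fix i assume i: "i < V"
        have "length (chunk n V (stake (V * n) \<omega>) i) \<le> N" using n_le(2) by (simp add: chunk_stake[OF i])
        then show "M2 (n * n + i) = enc N (fps_of_poly (\<rho> i))"
          unfolding \<rho> by (simp add: enc_bpoly 2(3)[OF i])
      qed
      moreover have "R2 14 = 2 ^ k" "R2 12 = 0" using 2(1) R1 by auto
      ultimately show "wp L (Seq loop_prog ?end) (2 ^ k * T_iter + 1 + 2) ?Q R2 M2 (sdrop (V * n) \<omega>)"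
      proof (intro wp_seq[OF _ order.refl], elim wp_loop)
        fix R3 M3 assume 3: "\<And>i. i < 12 \<Longrightarrow> R3 i = R2 i" "R3 13 = R2 13"
          "R3 12 = enc N (\<Sum>A<2 ^ k. pdet n (entry A))"
        have "R3 12 = enc N (fps_of_poly ?p)" "R3 13 = 2 ^ ?b" "R3 7 = 2 ^ D"
          using 3 2(1) R1 globD[OF R1(1)] by (simp_all add: sum_pdet)
        then show "wp L ?end 2 ?Q R3 M3 (sdrop (V * n) \<omega>)"
          using res by (intro wp_block) simp_all
      qed
    qed
  qed
qed

end

section \<open>Polynomial running time and the error bound\<close>

definition is_polyfun :: "(nat \<Rightarrow> nat) \<Rightarrow> bool" where
  "is_polyfun f \<longleftrightarrow> (\<exists>p. \<forall>x. poly p x = f x)"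

lemma is_polyfun_intros:
  "is_polyfun (\<lambda>_. c)" "is_polyfun (\<lambda>x. x)"
  "is_polyfun f \<Longrightarrow> is_polyfun g \<Longrightarrow> is_polyfun (\<lambda>x. f x + g x)"
  "is_polyfun f \<Longrightarrow> is_polyfun g \<Longrightarrow> is_polyfun (\<lambda>x. f x * g x)"
  "is_polyfun f \<Longrightarrow> is_polyfun (\<lambda>x. f x ^ m)"
proof -
  show "is_polyfun (\<lambda>_. c)" unfolding is_polyfun_def by (rule exI[of _ "[:c:]"]) simp
  show "is_polyfun (\<lambda>x. x)" unfolding is_polyfun_def by (rule exI[of _ "[:0, 1:]"]) simp
  show "is_polyfun f \<Longrightarrow> is_polyfun g \<Longrightarrow> is_polyfun (\<lambda>x. f x + g x)"
    unfolding is_polyfun_def by (metis poly_add)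
  show "is_polyfun f \<Longrightarrow> is_polyfun g \<Longrightarrow> is_polyfun (\<lambda>x. f x * g x)"
    unfolding is_polyfun_def by (metis poly_mult)
  show "is_polyfun f \<Longrightarrow> is_polyfun (\<lambda>x. f x ^ m)"
    unfolding is_polyfun_def by (metis poly_power)
qed

text \<open>These mirror the machine's size and time expressions with \<open>n\<close> and
  \<open>k\<close> replaced by an upper bound \<open>x\<close> and without subtraction, which makes
  them monotone polynomials. The extra \<open>x\<close> in \<open>bound_L\<close> pays for the
  length of \<open>k\<close>.\<close>

definition bound_N where "bound_N x = x * x * (2 * (x * x))" for x :: nat
definition bound_cols where "bound_cols x = x * (bound_N x * 8 + 16) + 2" for x :: nat
definition bound_rows where "bound_rows x = x * (bound_N x * 8 + 11 + bound_cols x) + 2" for x :: nat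
definition bound_elim where "bound_elim x = x * (bound_N x * 8 + bound_N x * (bound_N x * 8 + 8) + bound_rows x + 15 + 2) + 3" for x :: nat
definition bound_iter where "bound_iter x = x * (x * (x * 11 + bound_N x * 8 + 28) + 11) + bound_elim x + 5" for x :: nat
definition bound_L where "bound_L x = 4 * x ^ 4 + 5 * (x * x) + 8 + x" for x :: nat
definition time_poly where
  "time_poly x = ((2 * (x * x)) * 3 + x * 6 + x * 3 + x * 6 + 30 + (3 * (x * x) * (6 * x + 8) + 2) + bound_iter x + 10) * (1 + bound_L x)\<^sup>2"
  for x :: nat

lemma is_polyfun_time_poly: "is_polyfun time_poly"
proof -
  have "is_polyfun bound_N" unfolding bound_N_def[abs_def] by (intro is_polyfun_intros)
  note i = is_polyfun_intros this
  have "is_polyfun bound_cols" unfolding bound_cols_def[abs_def] by (intro i)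
  note i = i this
  have "is_polyfun bound_rows" unfolding bound_rows_def[abs_def] by (intro i)
  note i = i this
  have "is_polyfun bound_elim" unfolding bound_elim_def[abs_def] by (intro i)
  note i = i this
  have "is_polyfun bound_iter" unfolding bound_iter_def[abs_def] by (intro i)
  note i = i this
  have "is_polyfun bound_L" unfolding bound_L_def[abs_def] by (intro i)
  note i = i this
  show ?thesis unfolding time_poly_def[abs_def] by (intro i)
qed

text \<open>Only the loop is repeated \<open>2 ^ k\<close> times; set-up and sampling are absorbed
  because \<open>1 \<le> 2 ^ k\<close>.\<close>

lemma (in sieve_machine) time_bound:
  assumes x: "n \<le> x" and L': "L \<le> bound_L x"
  shows "(T_init + (T_sample + (2 ^ k * T_iter + 1 + 2)) + 1 + 3) * (1 + L)\<^sup>2 \<le> 2 ^ k * time_poly x"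
proof -
  have kx: "k \<le> x" using k x by simp
  have N: "N \<le> bound_N x" unfolding N_def D_def bound_N_def by (intro mult_le_mono x order.refl)
  note m = add_mono mult_le_mono x kx N order.refl
  have C: "T_cols \<le> bound_cols x" unfolding T_cols_def bound_cols_def by (intro m)
  have R: "T_rows \<le> bound_rows x" unfolding T_rows_def bound_rows_def by (intro m C)
  have E: "T_elim \<le> bound_elim x" unfolding T_elim_def T_pivot_def bound_elim_def by (intro m R)
  have I: "T_iter \<le> bound_iter x" unfolding T_iter_def bound_iter_def by (intro m E)
  have "n - (k + 1) \<le> x" using x by simp
  then have 0: "T_init \<le> (2 * (x * x)) * 3 + x * 6 + x * 3 + x * 6 + 30" unfolding T_init_def D_def by (intro m)
  have S: "T_sample \<le> 3 * (x * x) * (6 * x + 8) + 2" unfolding T_sample_def by (intro m)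
  let ?a = "(2 * (x * x)) * 3 + x * 6 + x * 3 + x * 6 + 30" and ?s = "3 * (x * x) * (6 * x + 8) + 2"
  have one: "(1 :: nat) \<le> 2 ^ k" by simp
  have sum_le: "a + (b + (c + 1 + 2)) + 1 + 3 \<le> 1 * (a' + b' + 7) + c'"
    if "a \<le> a'" "b \<le> b'" "c \<le> c'" for a b c a' b' c' :: nat
    using that by simp
  have "T_init + (T_sample + (2 ^ k * T_iter + 1 + 2)) + 1 + 3 \<le> 1 * (?a + ?s + 7) + 2 ^ k * bound_iter x"
    by (rule sum_le[OF 0 S mult_le_mono2[OF I, of "2 ^ k"]])
  also have "\<dots> \<le> 2 ^ k * (?a + ?s + 10) + 2 ^ k * bound_iter x"
    by (intro add_mono mult_le_mono one order.refl) simp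
  also have "\<dots> = 2 ^ k * (?a + ?s + bound_iter x + 10)" by (simp add: algebra_simps)
  finally have "(T_init + (T_sample + (2 ^ k * T_iter + 1 + 2)) + 1 + 3) * (1 + L)\<^sup>2 \<le>
      2 ^ k * (?a + ?s + bound_iter x + 10) * (1 + bound_L x)\<^sup>2"
    by (intro mult_le_mono power_mono) (use L' in auto)
  then show ?thesis by (simp add: time_poly_def mult.assoc)
qed

lemma encode_eq:
  assumes "pverts G = {..<n}"
  shows "encode G k = ((\<lambda>_. 0)(0 := n, 1 := k), \<lambda>a. of_bool ((a div n, a mod n) \<in> parcs G))"
  using assms by (simp add: encode_def)

text \<open>The start state contains \<open>k\<close> before it is compared with \<open>n\<close>,
  so \<open>L\<close> must cover the length of an arbitrary \<open>k\<close>.\<close>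

lemma bnd_encode:
  assumes "L = 4 * n ^ 4 + 5 * (n * n) + 8 + len k"
  shows "bnd L ((\<lambda>_. 0)(0 := n, 1 := k)) (\<lambda>a. of_bool (P a))"
proof -
  have "n \<le> n * n" by (rule le_square)
  then have "n \<le> L" using assms by linarith
  then have n: "n < 2 ^ L" by (rule le_less_trans) (rule less_exp)
  have "len k \<le> L" using assms by simp
  then have k: "k < 2 ^ L" by (rule floorlog_leD) simp
  have "1 < (2 :: nat) ^ L" by (rule one_less_power) (use assms in auto)
  then have "of_bool b < (2 :: nat) ^ L" for b by (cases b) auto
  then show ?thesis using n k assms by (auto simp: bnd_def)
qed

text \<open>If there is no marked tree, the sum is empty and every sequence is bad: this is why the
  error is one-sided.\<close>

definition bad_tosses :: "(nat \<times> nat) set \<Rightarrow> nat \<Rightarrow> nat \<Rightarrow> bool stream set" where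
  "bad_tosses Ar n k = {\<omega>. (\<Sum>S\<in>mono_of n ` marked_trees n Ar k.
     \<Prod>i\<in>S. bpoly (chunk n (3 * (n * n)) (stake (3 * (n * n) * n) \<omega>) i)) = 0}"

lemma iob_prog_correct:
  assumes G: "pair_digraph G" "pverts G = {..<n}"
  shows "\<exists>t R M \<omega>'. exec iob_prog (encode G k, \<omega>) t ((R, M), \<omega>') \<and>
    t \<le> 2 ^ k * time_poly (input_size G k) \<and> (R 0 = 0 \<longleftrightarrow> n \<le> k \<or> \<omega> \<in> bad_tosses (parcs G) n k)"
proof -
  define L where "L = 4 * n ^ 4 + 5 * (n * n) + 8 + len k"
  let ?x = "input_size G k"
  let ?R = "(\<lambda>_. 0)(0 := n, 1 := k)" and ?M = "\<lambda>a. of_bool ((a div n, a mod n) \<in> parcs G) :: nat"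
  have x: "?x = n * n + len n + len k" using G by (simp add: input_size_def power2_eq_square)
  have nx: "n \<le> ?x" unfolding x using le_square[of n] by linarith
  have Lx: "L \<le> bound_L ?x" unfolding L_def bound_L_def
    using nx x by (intro add_mono mult_le_mono power_mono order.refl) auto
  have b: "bnd L ?R ?M" by (rule bnd_encode) (simp add: L_def)
  have consts_less: "2 < (2 :: nat) ^ L"
    using power_increasing[of 2 L "2 :: nat"] by (simp add: L_def)
  have ex: "\<exists>t R M \<omega>'. exec iob_prog (encode G k, \<omega>) t ((R, M), \<omega>') \<and>
      t \<le> 2 ^ k * time_poly ?x \<and> (R 0 = 0 \<longleftrightarrow> n \<le> k \<or> \<omega> \<in> bad_tosses (parcs G) n k)"
    if "wp L iob_prog T (\<lambda>R M \<omega>'. R 0 = 0 \<longleftrightarrow> n \<le> k \<or> \<omega> \<in> bad_tosses (parcs G) n k) ?R ?M \<omega>"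
      "T * (1 + L)\<^sup>2 \<le> 2 ^ k * time_poly ?x" for T
    using that b unfolding encode_eq[OF G(2)] wp_def by (meson order.trans)
  show ?thesis
  proof (cases "k < n")
    case False
    show ?thesis
    proof (rule ex)
      show "wp L iob_prog (3 + (1 + 1)) (\<lambda>R M \<omega>'. R 0 = 0 \<longleftrightarrow> n \<le> k \<or> \<omega> \<in> bad_tosses (parcs G) n k) ?R ?M \<omega>"
        unfolding iob_prog_def
      proof (rule wp_block_seq[where t = "1 + 1"])
        have "wp L (Cond 4 main_prog (Imm 0 0)) (1 + 1)
          (\<lambda>R M \<omega>'. R 0 = 0 \<longleftrightarrow> n \<le> k \<or> \<omega> \<in> bad_tosses (parcs G) n k) (?R(2 := 1, 3 := 2, 4 := n - k)) ?M \<omega>"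
          by (rule wp_Cond_false, use False in simp, rule wp_single, use False in simp)
        then show "straight L [Imm 2 1, Imm 3 2, Arith Sub 4 0 1] (wp L (Cond 4 main_prog (Imm 0 0)) (1 + 1)
          (\<lambda>R M \<omega>'. R 0 = 0 \<longleftrightarrow> n \<le> k \<or> \<omega> \<in> bad_tosses (parcs G) n k)) ?R ?M \<omega>"
          using consts_less by simp
      qed auto
      \<comment> \<open>The five units of an immediate NO are covered by the summand 10 in
        \<open>time_poly\<close>.\<close>
      have "1 * 10 * (1 + L)\<^sup>2 \<le> 2 ^ k * time_poly ?x" unfolding time_poly_def mult.assoc
        using Lx by (intro mult_le_mono power_mono) auto
      then show "(3 + (1 + 1)) * (1 + L)\<^sup>2 \<le> 2 ^ k * time_poly ?x" by (rule order.trans[rotated]) simp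
    qed
  next
    case True
    interpret sieve_machine n k L "parcs G" "\<lambda>i. bpoly (chunk n (3 * (n * n)) (stake (3 * (n * n) * n) \<omega>) i)"
      by unfold_locales (use True in \<open>auto simp: L_def\<close>)
    let ?t = "T_init + (T_sample + (2 ^ k * T_iter + 1 + 2))"
    show ?thesis
    proof (rule ex)
      let ?Q = "\<lambda>R M \<omega>'. R 0 = 0 \<longleftrightarrow> n \<le> k \<or> \<omega> \<in> bad_tosses (parcs G) n k"
      show "wp L iob_prog (?t + 1 + 3) ?Q ?R ?M \<omega>"
        unfolding iob_prog_def
      proof (rule wp_block_seq[where t = "?t + 1"])
        have "wp L (Cond 4 main_prog (Imm 0 0)) (?t + 1) ?Q (?R(2 := 1, 3 := 2, 4 := n - k)) ?M \<omega>"
        proof (rule wp_Cond_true)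
          show "wp L main_prog ?t ?Q (?R(2 := 1, 3 := 2, 4 := n - k)) ?M \<omega>"
            by (rule wp_mono[OF wp_main]) (use True in \<open>auto simp: bad_tosses_def\<close>)
        qed (use True in simp)
        then show "straight L [Imm 2 1, Imm 3 2, Arith Sub 4 0 1] (wp L (Cond 4 main_prog (Imm 0 0)) (?t + 1) ?Q) ?R ?M \<omega>"
          using consts_less by simp
      qed auto
      show "(?t + 1 + 3) * (1 + L)\<^sup>2 \<le> 2 ^ k * time_poly ?x" by (rule time_bound[OF nx Lx])
    qed
  qed
qed

text \<open>For fixed tosses the run is unique, so the answer of the run constructed above is the
  only one.\<close>

lemma answers_no_iff:
  assumes "pair_digraph G" "pverts G = {..<n}"
  shows "answers_no iob_prog (encode G k) \<omega> \<longleftrightarrow> n \<le> k \<or> \<omega> \<in> bad_tosses (parcs G) n k"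
proof -
  from iob_prog_correct[OF assms, of k \<omega>] obtain t R M \<omega>' where
    e: "exec iob_prog (encode G k, \<omega>) t ((R, M), \<omega>') \<and> t \<le> 2 ^ k * time_poly (input_size G k) \<and>
      (R 0 = 0 \<longleftrightarrow> n \<le> k \<or> \<omega> \<in> bad_tosses (parcs G) n k)"
    by (elim exE) (rule that)
  note e1 = conjunct1[OF e] and e2 = conjunct2[OF conjunct2[OF e]]
  show ?thesis unfolding answers_no_def e2[symmetric]
    using e1 exec_deterministic[OF e1] by (metis Pair_inject)
qed

text \<open>There are \<open>3 * (n * n)\<close> variables with \<open>n\<close> tosses
  each.\<close>

lemma measure_bad_tosses:
  assumes "marked_trees n Ar k \<noteq> {}" "k \<le> n"
  shows "measure coin_space (bad_tosses Ar n k) \<le> real (3 * (n * n)) / 2 ^ n"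
  unfolding bad_tosses_def
  by (rule prob_multilinear_eq_0[OF inj_on_bpoly]) (use assms(1) mono_of_subset[OF _ assms(2)] in blast)+

theorem theorem1:
  shows "\<exists>(A :: prog) (p :: nat poly) (\<epsilon> :: nat \<Rightarrow> real).
    \<epsilon> \<longlonglongrightarrow> 0 \<and>
    (\<forall>(n :: nat) (G :: nat pair_pre_digraph) (k :: nat).
       pair_digraph G \<longrightarrow> pverts G = {..<n} \<longrightarrow>
         halts_within A (encode G k) (2 ^ k * poly p (input_size G k)) \<and>
         (has_internal_out_branching (with_proj G) k \<longrightarrow>
            measure coin_space {\<omega>. answers_no A (encode G k) \<omega>} \<le> \<epsilon> n) \<and>
         (\<not> has_internal_out_branching (with_proj G) k \<longrightarrow>
            (\<forall>\<omega>. answers_no A (encode G k) \<omega>)))"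
proof -
  from is_polyfun_time_poly obtain p where p: "\<And>x. poly p x = time_poly x" by (auto simp: is_polyfun_def)
  let ?\<epsilon> = "\<lambda>n. real (3 * (n * n)) / 2 ^ n"
  \<comment> \<open>As \<open>?x\<close> squares to \<open>1 / 2\<close>, the bound is 3 times the
    square of \<open>n * ?x ^ n\<close>, whose limit is 0.\<close>
  let ?x = "sqrt (1 / 2)"
  have "(\<lambda>n. 3 * (real n * ?x ^ n)\<^sup>2) \<longlonglongrightarrow> 3 * 0\<^sup>2"
    by (intro tendsto_mult tendsto_const tendsto_power powser_times_n_limit_0) simp
  moreover have "3 * (real n * ?x ^ n)\<^sup>2 = ?\<epsilon> n" for n
  proof -
    have "(?x ^ n)\<^sup>2 = (?x\<^sup>2) ^ n" by (simp only: power_mult[symmetric] mult.commute)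
    also have "\<dots> = 1 / 2 ^ n" by (simp add: power_one_over)
    finally show ?thesis by (simp only: power_mult_distrib) (simp add: power2_eq_square)
  qed
  ultimately have "?\<epsilon> \<longlonglongrightarrow> 0" by simp
  moreover have "halts_within iob_prog (encode G k) (2 ^ k * poly p (input_size G k)) \<and>
         (has_internal_out_branching (with_proj G) k \<longrightarrow>
            measure coin_space {\<omega>. answers_no iob_prog (encode G k) \<omega>} \<le> ?\<epsilon> n) \<and>
         (\<not> has_internal_out_branching (with_proj G) k \<longrightarrow>
            (\<forall>\<omega>. answers_no iob_prog (encode G k) \<omega>))"
    if G: "pair_digraph G" "pverts G = {..<n}" for n G k
  proof (intro conjI impI allI)
    show "halts_within iob_prog (encode G k) (2 ^ k * poly p (input_size G k))"
      unfolding halts_within_def p using iob_prog_correct[OF G] by (metis surj_pair)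
  next
    assume h: "has_internal_out_branching (with_proj G) k"
    \<comment> \<open>This also gives \<open>0 < n\<close>, which the equivalence with marked trees
      requires.\<close>
    have kn: "k < n" by (rule has_internal_less[OF G h])
    then have "marked_trees n (parcs G) k \<noteq> {}" using has_internal_iff_marked_trees[OF G] h by simp
    with kn show "measure coin_space {\<omega>. answers_no iob_prog (encode G k) \<omega>} \<le> ?\<epsilon> n"
      using measure_bad_tosses[of n "parcs G" k] by (simp add: answers_no_iff[OF G])
  next
    fix \<omega> assume h: "\<not> has_internal_out_branching (with_proj G) k"
    show "answers_no iob_prog (encode G k) \<omega>"
    proof (cases "k < n")
      case True
      then have "marked_trees n (parcs G) k = {}" using has_internal_iff_marked_trees[OF G] h by simp
      then show ?thesis by (simp add: answers_no_iff[OF G] bad_tosses_def)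
    qed (simp add: answers_no_iff[OF G])
  qed
  ultimately show ?thesis by blast
qed

end
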